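(* Let $0<\bar T<\infty$, $I=(0,\bar T)$, $k>0$, $0\le c<2\sqrt k$, and $\omega_d=\sqrt{k-c^2/4}$. The equation $$-\langle \dot u,\dot\varphi\rangle_c+k\langle u,\varphi\rangle_c=\langle f,\varphi\rangle_c+\langle\dot v_{0,\bar T},\dot\varphi\rangle_c-k\langle v_{0,\bar T},\varphi\rangle_c\qquad\text{for all }\varphi\in C^\infty_0(I),\tag{W}$$ with unknown $u\in H^1_0(I)$, is the weak form of the equation $\ddot x+c\dot x+kx=f$ in $[0,\bar T]$ with boundary conditions $x(0)=x_0$, $x(\bar T)=x_{\bar T}$ (where $x=u+v_{0,\bar T}$). Equivalently: 1. If $\bar T$ is fixed and does not belong to the exceptional set $\{\tau\in\mathbb{R}:\sin(\omega_d\tau)=0\}$, and if $v_{0,\bar T}\in H^1(I)$ satisfies the boundary conditions $v_{0,\bar T}(0)=x_0$, $v_{0,\bar T}(\bar T)=x_{\bar T}$, then for every $f\in H^{-1}(I)$ the weak form (W) admits a unique solution $u\in H^1_0(I)$. 2. Moreover, if $f\in H^s(\bar I)$ for some $s\ge-1$, then $u\in H^{s+2}$. 3. The boundary value problems solved by the weak formulation (W), when the function $v_{0,\bar T}\in C^{s+2}$ is allowed to vary, are in a one-to-one correspondence with the initial condition problems solved by the ODE $\ddot x+c\dot x+kx=f$.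
   Context: $H^s$ is the $L^2$-based Sobolev space of order $s$ of real functions on $I$, and $H^1_0(I)=\{u\in H^1(I):u(0)=u(\bar T)=0\}$. $H^{-1}(I)$ is the space of weak derivatives of functions in $L^2(I)$. $C^\infty_0(I)$ is the space of smooth functions with support contained in $I$, and $C^{s+2}$ denotes $s+2$ times continuously differentiable functions. $\langle\varphi,\psi\rangle_c=\int_0^{\bar T}e^{ct}\varphi(t)\psi(t)\,dt$; for $f\in H^{-1}(I)$, $\langle f,\varphi\rangle_c$ is understood as $-\int_0^{\bar T}F\dot\varphi\,dt$, where $F\in L^2(I)$ has weak derivative $e^{ct}f$. Initial condition problems prescribe $x(0)=x_0\in\mathbb{R}$ and $\dot x(0)=\dot x_0\in\mathbb{R}$. The boundary value $x_{\bar T}$ corresponding to $(x_0,\dot x_0)$ is $x_{\bar T}=\mathcal{B}_{x_0,f,\bar T}(\dot x_0)$, the value at time $\bar T$ of the solution of $\ddot x+c\dot x+kx=f$ with initial data $(x_0,\dot x_0)$. For the initial and final velocities to be well defined, $f$ is assumed to be of class $H^{-1/2+\varepsilon}$ for some $\varepsilon>0$ on $[0,\delta]$ and $[\bar T-\delta,\bar T]$ for some $\delta>0$.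
   Formalization: In item 2, u in H^{s+2} is proved when v is in C^{s+2} or H^{s+2}; for v merely in H^1 it fails (f=0, s=0, zero boundary data, v in H^1_0 but not H^2 gives u=-v), and there x=u+v in H^{s+2} is proved instead. *)

theory Defs
  imports "HOL-Analysis.Analysis"
begin

section \<open>Test functions and distributions on an open interval\<close>

definition test_functions :: "real \<Rightarrow> real \<Rightarrow> (real \<Rightarrow> real) set" where
  "test_functions a b =
     {\<phi>. (\<forall>n. (deriv ^^ n) \<phi> differentiable_on UNIV) \<and> closure {t. \<phi> t \<noteq> 0} \<subseteq> {a<..<b}}"

text \<open>A distribution on \<open>(a, b)\<close> is represented by a functional that is only ever evaluated
  on \<open>test_functions a b\<close>; its values on other functions are irrelevant. In particular the
  restriction of a distribution to a subinterval is the same functional.\<close>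

type_synonym distribution = "(real \<Rightarrow> real) \<Rightarrow> real"

definition L2 :: "real \<Rightarrow> real \<Rightarrow> (real \<Rightarrow> real) set" where
  "L2 a b = {u. set_borel_measurable lebesgue {a<..<b} u \<and>
                set_integrable lebesgue {a<..<b} (\<lambda>t. (u t)\<^sup>2)}"

definition regular_dist :: "real \<Rightarrow> real \<Rightarrow> (real \<Rightarrow> real) \<Rightarrow> distribution" where
  "regular_dist a b u = (\<lambda>\<phi>. LINT t:{a<..<b}|lebesgue. u t * \<phi> t)"

definition dist_deriv :: "distribution \<Rightarrow> distribution" where
  "dist_deriv \<Lambda> = (\<lambda>\<phi>. - \<Lambda> (deriv \<phi>))"

definition dist_mult :: "(real \<Rightarrow> real) \<Rightarrow> distribution \<Rightarrow> distribution" where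
  "dist_mult w \<Lambda> = (\<lambda>\<phi>. \<Lambda> (\<lambda>t. w t * \<phi> t))"

definition dist_eq :: "real \<Rightarrow> real \<Rightarrow> distribution \<Rightarrow> distribution \<Rightarrow> bool" where
  "dist_eq a b \<Lambda> \<Lambda>' \<longleftrightarrow> (\<forall>\<phi>\<in>test_functions a b. \<Lambda> \<phi> = \<Lambda>' \<phi>)"

definition has_weak_deriv ::
  "real \<Rightarrow> real \<Rightarrow> nat \<Rightarrow> (real \<Rightarrow> real) \<Rightarrow> (real \<Rightarrow> real) \<Rightarrow> bool" where
  "has_weak_deriv a b j u g \<longleftrightarrow>
     dist_eq a b (regular_dist a b g) ((dist_deriv ^^ j) (regular_dist a b u))"

text \<open>The first weak derivative, determined up to a null set.\<close>

definition weak_deriv :: "real \<Rightarrow> real \<Rightarrow> (real \<Rightarrow> real) \<Rightarrow> real \<Rightarrow> real" where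
  "weak_deriv a b u = (SOME g. g \<in> L2 a b \<and> has_weak_deriv a b 1 u g)"

section \<open>Sobolev spaces of real order on a bounded interval\<close>

text \<open>Finiteness of the Sobolev--Slobodeckij (Gagliardo) seminorm of order \<open>\<sigma> \<in> (0, 1)\<close>.\<close>

definition finite_gagliardo :: "real \<Rightarrow> real \<Rightarrow> real \<Rightarrow> (real \<Rightarrow> real) \<Rightarrow> bool" where
  "finite_gagliardo a b \<sigma> g \<longleftrightarrow>
     set_integrable lebesgue ({a<..<b} \<times> {a<..<b})
       (\<lambda>(x, y). (g x - g y)\<^sup>2 / \<bar>x - y\<bar> powr (1 + 2 * \<sigma>))"

text \<open>\<open>sobolev_fun a b s\<close>, for \<open>s \<ge> 0\<close>, is \<open>H\<^sup>s(a, b)\<close> as a space of functions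
  (representatives of almost everywhere classes): all weak derivatives up to order
  \<open>\<lfloor>s\<rfloor>\<close> are square integrable, and for non-integral \<open>s\<close> the last one has finite
  seminorm of order \<open>s - \<lfloor>s\<rfloor>\<close>.\<close>

definition sobolev_fun :: "real \<Rightarrow> real \<Rightarrow> real \<Rightarrow> (real \<Rightarrow> real) set" where
  "sobolev_fun a b s =
     {u \<in> L2 a b. \<forall>j \<le> nat \<lfloor>s\<rfloor>. \<exists>g \<in> L2 a b. has_weak_deriv a b j u g \<and>
        (j = nat \<lfloor>s\<rfloor> \<and> frac s > 0 \<longrightarrow> finite_gagliardo a b (frac s) g)}"

text \<open>\<open>H\<^sup>s(a, b)\<close> as a space of distributions, for every real \<open>s\<close>. For \<open>s \<ge> 0\<close> these are the
  distributions given by functions in \<open>H\<^sup>s\<close>. For \<open>s < 0\<close> they are the \<open>m\<close>-th weak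
  derivatives of functions in \<open>H\<^sup>s\<^sup>+\<^sup>m\<close>, where \<open>m = \<lceil>-s\<rceil>\<close>, so that \<open>0 \<le> s + m < 1\<close>;
  on a bounded interval this is the space of restrictions to \<open>(a, b)\<close> of elements of
  \<open>H\<^sup>s(\<real>)\<close>, i.e. the space of order \<open>s\<close> up to the boundary.\<close>

definition sobolev :: "real \<Rightarrow> real \<Rightarrow> real \<Rightarrow> distribution set" where
  "sobolev a b s = (let m = nat \<lceil>- s\<rceil> in
     {\<Lambda>. \<exists>F \<in> sobolev_fun a b (s + real m).
        dist_eq a b \<Lambda> ((dist_deriv ^^ m) (regular_dist a b F))})"

lemma sobolev_fun_0: "sobolev_fun a b 0 = L2 a b"
  by (auto simp: sobolev_fun_def has_weak_deriv_def dist_eq_def)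

lemma sobolev_minus_1:
  "sobolev a b (-1) = {\<Lambda>. \<exists>F \<in> L2 a b. dist_eq a b \<Lambda> (dist_deriv (regular_dist a b F))}"
  by (simp add: sobolev_def Let_def sobolev_fun_0)

text \<open>Elements of \<open>H\<^sup>1\<close> are represented by their representative that is continuous on the
  closed interval, to which the boundary values refer.\<close>

definition H1 :: "real \<Rightarrow> real \<Rightarrow> (real \<Rightarrow> real) set" where
  "H1 a b = {u \<in> sobolev_fun a b 1. continuous_on {a..b} u}"

definition H1_0 :: "real \<Rightarrow> real \<Rightarrow> (real \<Rightarrow> real) set" where
  "H1_0 a b = {u \<in> H1 a b. u a = 0 \<and> u b = 0}"

text \<open>\<open>m\<close> times continuously differentiable on the closed interval, with one-sided
  derivatives at the end points.\<close>

definition Cm :: "real \<Rightarrow> real \<Rightarrow> nat \<Rightarrow> (real \<Rightarrow> real) set" where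
  "Cm a b m = {v. \<exists>g. (\<forall>t\<in>{a..b}. g 0 t = v t) \<and>
     (\<forall>j<m. \<forall>t\<in>{a..b}. (g j has_real_derivative g (Suc j) t) (at t within {a..b})) \<and>
     (\<forall>j\<le>m. continuous_on {a..b} (g j))}"

text \<open>\<open>C\<^sup>r\<close> for real \<open>r \<ge> 0\<close>: a non-integral number of derivatives is rounded up, so that
  \<open>C\<^sup>r \<subseteq> H\<^sup>r\<close> also for non-integral \<open>r\<close>.\<close>

definition Cr :: "real \<Rightarrow> real \<Rightarrow> real \<Rightarrow> (real \<Rightarrow> real) set" where
  "Cr a b r = Cm a b (nat \<lceil>r\<rceil>)"

section \<open>Weak form, boundary value problems and initial condition problems\<close>

definition weighted_inner ::
  "real \<Rightarrow> real \<Rightarrow> (real \<Rightarrow> real) \<Rightarrow> (real \<Rightarrow> real) \<Rightarrow> real" where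
  "weighted_inner T c \<phi> \<psi> = (LINT t:{0<..<T}|lebesgue. exp (c * t) * \<phi> t * \<psi> t)"

text \<open>The pairing with \<open>\<Lambda> \<in> H\<^sup>-\<^sup>1\<close>: the function \<open>F \<in> L\<^sup>2\<close> with weak derivative
  \<open>e\<^sup>c\<^sup>t \<Lambda>\<close> is determined up to an additive constant, which the integral does not see.\<close>

definition weighted_pairing :: "real \<Rightarrow> real \<Rightarrow> distribution \<Rightarrow> (real \<Rightarrow> real) \<Rightarrow> real" where
  "weighted_pairing T c \<Lambda> \<phi> =
     (let F = (SOME F. F \<in> L2 0 T \<and>
                 dist_eq 0 T (dist_deriv (regular_dist 0 T F)) (dist_mult (\<lambda>t. exp (c * t)) \<Lambda>))
      in - (LINT t:{0<..<T}|lebesgue. F t * deriv \<phi> t))"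

definition weak_form ::
  "real \<Rightarrow> real \<Rightarrow> real \<Rightarrow> distribution \<Rightarrow> (real \<Rightarrow> real) \<Rightarrow> (real \<Rightarrow> real) \<Rightarrow> bool" where
  "weak_form T c k f v u \<longleftrightarrow>
     (\<forall>\<phi>\<in>test_functions 0 T.
        - weighted_inner T c (weak_deriv 0 T u) (deriv \<phi>) + k * weighted_inner T c u \<phi> =
        weighted_pairing T c f \<phi> + weighted_inner T c (weak_deriv 0 T v) (deriv \<phi>)
          - k * weighted_inner T c v \<phi>)"

text \<open>The equation \<open>x'' + c x' + k x = f\<close> in the sense of distributions on \<open>(0, T)\<close>.\<close>

definition solves_ode ::
  "real \<Rightarrow> real \<Rightarrow> real \<Rightarrow> distribution \<Rightarrow> (real \<Rightarrow> real) \<Rightarrow> bool" where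
  "solves_ode T c k f x \<longleftrightarrow> (let X = regular_dist 0 T x in
     dist_eq 0 T (\<lambda>\<phi>. dist_deriv (dist_deriv X) \<phi> + c * dist_deriv X \<phi> + k * X \<phi>) f)"

definition solves_bvp ::
  "real \<Rightarrow> real \<Rightarrow> real \<Rightarrow> distribution \<Rightarrow> real \<Rightarrow> real \<Rightarrow> (real \<Rightarrow> real) \<Rightarrow> bool" where
  "solves_bvp T c k f x0 xT x \<longleftrightarrow>
     x \<in> H1 0 T \<and> solves_ode T c k f x \<and> x 0 = x0 \<and> x T = xT"

definition solves_ivp ::
  "real \<Rightarrow> real \<Rightarrow> real \<Rightarrow> distribution \<Rightarrow> real \<Rightarrow> real \<Rightarrow> (real \<Rightarrow> real) \<Rightarrow> bool" where
  "solves_ivp T c k f x0 p x \<longleftrightarrow>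
     x \<in> H1 0 T \<and> solves_ode T c k f x \<and> x 0 = x0 \<and>
     (x has_real_derivative p) (at 0 within {0..T})"

text \<open>The value at time \<open>T\<close> of the solution with initial position \<open>x0\<close> and velocity \<open>p\<close>.\<close>

definition boundary_map ::
  "real \<Rightarrow> real \<Rightarrow> distribution \<Rightarrow> real \<Rightarrow> real \<Rightarrow> real \<Rightarrow> real" where
  "boundary_map c k f T x0 p = (THE y. \<exists>x. solves_ivp T c k f x0 p x \<and> x T = y)"

text \<open>Regularity of the forcing near both end points that makes the initial and the final
  velocity well defined.\<close>

definition regular_at_ends :: "real \<Rightarrow> distribution \<Rightarrow> bool" where
  "regular_at_ends T f \<longleftrightarrow>
     (\<exists>\<epsilon>>0. \<exists>\<delta>>0. \<delta> \<le> T \<and>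
        f \<in> sobolev 0 \<delta> (- 1/2 + \<epsilon>) \<and> f \<in> sobolev (T - \<delta>) T (- 1/2 + \<epsilon>))"

end

theory Submission
  imports Defs "HOL-Computational_Algebra.Polynomial"
begin

text \<open>Multiplying a test function by \<open>e\<^sup>c\<^sup>t\<close> turns the weighted weak form (W) into the equation
  \<open>x'' + c x' + k x = f\<close> in the sense of distributions for \<open>x = u + v\<close>. Writing \<open>f = F'\<close> with \<open>F\<close> in
  \<open>L\<^sup>2\<close>, the lemma of du Bois-Reymond makes this equivalent to the integral equation
  \<open>x' = F - c x - k \<integral>x + C\<close> for absolutely continuous \<open>x\<close>. It is solved by convolving \<open>F\<close> with the
  derivative of the impulse response, and two solutions differ by a combination of
  \<open>e\<^sup>-\<^sup>c\<^sup>t\<^sup>/\<^sup>2 cos (\<omega> t)\<close> and \<open>e\<^sup>-\<^sup>c\<^sup>t\<^sup>/\<^sup>2 sin (\<omega> t)\<close>; boundary data determine it as soon as \<open>sin (\<omega> T) \<noteq> 0\<close>.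
  Regularity is bootstrapped from the integral equation, using that \<open>H\<^sup>1\<close> embeds into \<open>H\<^sup>\<sigma>\<close> for
  \<open>\<sigma> < 1\<close>. If \<open>F\<close> has finite Gagliardo seminorm of order above 1/2 near 0, its averages over \<open>(0, t)\<close>
  converge as \<open>t\<close> tends to 0, so every solution is differentiable at 0; initial velocities
  and final values are then in affine bijection.\<close>

section \<open>Smooth functions and test functions\<close>

text \<open>For \<open>f\<close> in H^-1 the velocity is only an L^2 function, so neither a
  pointwise equation nor an initial velocity makes sense at the outset. The way out is to use
  \<open>f = F'\<close> only through \<open>F\<close>. Convolving the impulse response
  \<open>h\<close> with \<open>f\<close> would solve the equation; moving the derivative from
  \<open>F\<close> to \<open>h\<close> leaves \<open>h'\<close> convolved with \<open>F\<close>,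
  which is meaningful for square integrable \<open>F\<close>. Since \<open>F\<close> is fixed only
  up to a constant, the integral equation carries a free constant \<open>C\<close>, which takes the
  place of the initial velocity.

  The threshold 1/2 is that of traces. What differentiability of \<open>x\<close> at 0 needs is a
  limit of averages of \<open>F\<close>; comparing the averages over \<open>(0, t)\<close> and
  \<open>(0, s)\<close> with \<open>t \<le> 2 s\<close> costs \<open>t\<close> to the power
  \<open>\<sigma> - 1/2\<close>, and these costs can be summed along repeated halving once
  \<open>\<sigma> > 1/2\<close>.

  The bijection is drawn from existence and uniqueness for the two problems rather than from a
  formula for the boundary map: each solution of one problem is read as a solution of the
  other.\<close>

definition diffn :: "nat \<Rightarrow> (real \<Rightarrow> real) \<Rightarrow> bool" where
  "diffn n f \<longleftrightarrow> (\<forall>m<n. (deriv ^^ m) f differentiable_on UNIV)"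

definition smooth :: "(real \<Rightarrow> real) \<Rightarrow> bool" where
  "smooth f \<longleftrightarrow> (\<forall>n. (deriv ^^ n) f differentiable_on UNIV)"

text \<open>Induction over the order needs the finite version: the product and chain rules bring
  back the functions together with their derivatives, so closure is proved for
  \<open>diffn n\<close> with the functions arbitrary and only then passed to
  \<open>smooth\<close>.\<close>

lemma smooth_iff_diffn: "smooth f \<longleftrightarrow> (\<forall>n. diffn n f)"
  unfolding smooth_def diffn_def by (meson lessI)

lemma diffn_0 [simp]: "diffn 0 f"
  by (simp add: diffn_def)

lemma diffn_Suc: "diffn (Suc n) f \<longleftrightarrow> f differentiable_on UNIV \<and> diffn n (deriv f)"
proof -
  have "(\<forall>m<Suc n. (deriv ^^ m) f differentiable_on UNIV) \<longleftrightarrow>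
        (deriv ^^ 0) f differentiable_on UNIV \<and> (\<forall>m<n. (deriv ^^ Suc m) f differentiable_on UNIV)"
    using less_Suc_eq_0_disj by auto
  then show ?thesis unfolding diffn_def by (simp only: funpow_Suc_right o_def) simp
qed

lemma diffn_SucI:
  assumes "\<And>x. (f has_real_derivative f' x) (at x)" "diffn n f'"
  shows "diffn (Suc n) f"
proof -
  have "deriv f = f'" using assms(1) DERIV_imp_deriv by blast
  moreover have "f differentiable_on UNIV"
    using assms(1) by (auto simp: differentiable_on_def real_differentiable_def)
  ultimately show ?thesis using assms(2) by (simp add: diffn_Suc)
qed

lemma diffn_DERIV: "diffn (Suc n) f \<Longrightarrow> (f has_real_derivative deriv f x) (at x)"
  by (metis DERIV_imp_deriv UNIV_I diffn_Suc differentiable_on_def real_differentiable_def)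

lemma diffn_mono: "diffn n f \<Longrightarrow> m \<le> n \<Longrightarrow> diffn m f"
  by (simp add: diffn_def)

lemma diffn_add: "diffn n f \<Longrightarrow> diffn n g \<Longrightarrow> diffn n (\<lambda>x. f x + g x)"
proof (induction n arbitrary: f g)
  case (Suc n)
  show ?case
  proof (rule diffn_SucI)
    show "((\<lambda>x. f x + g x) has_real_derivative deriv f x + deriv g x) (at x)" for x
      by (intro DERIV_add diffn_DERIV[OF Suc.prems(1)] diffn_DERIV[OF Suc.prems(2)])
    show "diffn n (\<lambda>x. deriv f x + deriv g x)"
      using Suc by (simp add: diffn_Suc)
  qed
qed auto

lemma diffn_mult: "diffn n f \<Longrightarrow> diffn n g \<Longrightarrow> diffn n (\<lambda>x. f x * g x)"
proof (induction n arbitrary: f g)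
  case (Suc n)
  show ?case
  proof (rule diffn_SucI)
    show "((\<lambda>x. f x * g x) has_real_derivative deriv f x * g x + f x * deriv g x) (at x)" for x
      using DERIV_mult[OF diffn_DERIV[OF Suc.prems(1)] diffn_DERIV[OF Suc.prems(2)]]
      by (simp add: algebra_simps)
    show "diffn n (\<lambda>x. deriv f x * g x + f x * deriv g x)"
      using Suc diffn_mono[OF Suc.prems(1), of n] diffn_mono[OF Suc.prems(2), of n]
      by (intro diffn_add Suc.IH) (auto simp: diffn_Suc)
  qed
qed auto

lemma diffn_const: "diffn n (\<lambda>x. c)"
proof (induction n arbitrary: c)
  case (Suc n)
  show ?case by (rule diffn_SucI[where f'="\<lambda>x. 0"]) (auto intro: Suc)
qed auto

lemma diffn_exp: "diffn n f \<Longrightarrow> diffn n (\<lambda>x. exp (f x))"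
proof (induction n arbitrary: f)
  case (Suc n)
  show ?case
  proof (rule diffn_SucI)
    show "((\<lambda>x. exp (f x)) has_real_derivative exp (f x) * deriv f x) (at x)" for x
      by (intro DERIV_fun_exp diffn_DERIV[OF Suc.prems])
    show "diffn n (\<lambda>x. exp (f x) * deriv f x)"
      using Suc diffn_mono[OF Suc.prems, of n] by (intro diffn_mult Suc.IH) (auto simp: diffn_Suc)
  qed
qed auto

lemma diffn_affine: "diffn n f \<Longrightarrow> diffn n (\<lambda>x. f (p + m * x))"
proof (induction n arbitrary: f)
  case (Suc n)
  show ?case
  proof (rule diffn_SucI)
    show "((\<lambda>x. f (p + m * x)) has_real_derivative deriv f (p + m * x) * m) (at x)" for x
      by (rule DERIV_chain2[OF diffn_DERIV[OF Suc.prems]]) (auto intro!: derivative_eq_intros)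
    show "diffn n (\<lambda>x. deriv f (p + m * x) * m)"
      using Suc by (intro diffn_mult diffn_const Suc.IH) (auto simp: diffn_Suc)
  qed
qed auto

lemma diffn_ident: "diffn n (\<lambda>x. x)"
proof (cases n)
  case (Suc m)
  show ?thesis unfolding Suc
    by (rule diffn_SucI[where f'="\<lambda>x. 1"]) (auto intro: diffn_const)
qed auto

lemma smooth_const: "smooth (\<lambda>x. c)"
  and smooth_ident: "smooth (\<lambda>x. x)"
  and smooth_add: "smooth f \<Longrightarrow> smooth g \<Longrightarrow> smooth (\<lambda>x. f x + g x)"
  and smooth_mult: "smooth f \<Longrightarrow> smooth g \<Longrightarrow> smooth (\<lambda>x. f x * g x)"
  and smooth_exp: "smooth f \<Longrightarrow> smooth (\<lambda>x. exp (f x))"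
  and smooth_affine: "smooth f \<Longrightarrow> smooth (\<lambda>x. f (p + m * x))"
  by (auto simp: smooth_iff_diffn diffn_const diffn_add diffn_mult diffn_exp diffn_affine diffn_ident)

lemma smooth_diff:
  assumes "smooth f" "smooth g" shows "smooth (\<lambda>x. f x - g x)"
  using smooth_add[OF assms(1) smooth_mult[OF smooth_const[of "-1"] assms(2)]] by simp

lemma smooth_deriv: "smooth f \<Longrightarrow> smooth (deriv f)"
  unfolding smooth_def by (metis funpow_swap1 funpow.simps(2) o_apply)

lemma smooth_DERIV: "smooth f \<Longrightarrow> (f has_real_derivative deriv f x) (at x)"
  by (meson diffn_DERIV smooth_iff_diffn)

lemma smooth_continuous: "smooth f \<Longrightarrow> continuous_on A f"
  by (meson DERIV_continuous_on smooth_DERIV DERIV_subset subset_UNIV)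

lemma smooth_antiderivative:
  assumes "\<And>x. (f has_real_derivative f' x) (at x)" "smooth f'"
  shows "smooth f"
  unfolding smooth_iff_diffn
proof
  fix n
  have "diffn (Suc n) f" using assms diffn_SucI smooth_iff_diffn by blast
  then show "diffn n f" by (rule diffn_mono) simp
qed

text \<open>The family of all \<open>p(1/x) exp(-1/x)\<close>, extended by zero to \<open>x \<le> 0\<close>, is closed under
  differentiation.\<close>

definition flat :: "real poly \<Rightarrow> real \<Rightarrow> real" where
  "flat p x = (if x > 0 then poly p (1 / x) * exp (- (1 / x)) else 0)"

text \<open>With \<open>y = 1/x\<close> the limit from the right is exponential decay beating a
  polynomial at infinity; on the left the function is zero.\<close>

lemma flat_tendsto_0: "(flat p \<longlongrightarrow> 0) (at 0)"
proof -
  have mono: "((\<lambda>y::real. y ^ n * exp (- y)) \<longlongrightarrow> 0) at_top" for n :: nat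
    using tendsto_power_div_exp_0[of n, unfolded divide_inverse exp_minus[symmetric]] .
  have "((\<lambda>y. (\<Sum>i\<le>degree p. coeff p i * (y ^ i * exp (- y)))) \<longlongrightarrow>
        (\<Sum>i\<le>degree p. coeff p i * 0)) at_top"
    by (intro tendsto_sum tendsto_mult tendsto_const mono)
  then have "((\<lambda>y. poly p y * exp (- y)) \<longlongrightarrow> 0) at_top"
    by (simp add: poly_altdef sum_distrib_right mult.assoc)
  then have "((\<lambda>x. poly p (1 / x) * exp (- (1 / x))) \<longlongrightarrow> 0) (at_right 0)"
    using filterlim_compose[OF _ filterlim_inverse_at_top_right] by (simp add: inverse_eq_divide)
  then have "(flat p \<longlongrightarrow> 0) (at_right 0)"
    by (rule Lim_transform_eventually) (auto simp: flat_def eventually_at_filter)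
  moreover have "(flat p \<longlongrightarrow> 0) (at_left 0)"
    by (rule Lim_transform_eventually[OF tendsto_const])
       (auto simp: flat_def eventually_at_filter)
  ultimately show ?thesis
    by (simp add: filterlim_split_at)
qed

text \<open>For \<open>x > 0\<close> the derivative of \<open>p(1/x) exp(-1/x)\<close> is
  \<open>x^-2 (p - p')(1/x) exp(-1/x)\<close>; the two leading \<open>pCons 0\<close> supply the
  factor \<open>x^-2\<close>.\<close>

lemma flat_DERIV: "(flat p has_real_derivative flat (pCons 0 (pCons 0 (p - pderiv p))) x) (at x)"
proof -
  consider "x > 0" | "x < 0" | "x = 0" by linarith
  then show ?thesis
  proof cases
    case 1
    have "((\<lambda>x. poly p (1 / x) * exp (- (1 / x))) has_real_derivative
          flat (pCons 0 (pCons 0 (p - pderiv p))) x) (at x)"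
    proof -
      have "((\<lambda>x. poly p (1 / x) * exp (- (1 / x))) has_real_derivative
          (poly (pderiv p) (1 / x) * (- (1 / x\<^sup>2))) * exp (- (1 / x)) +
          (exp (- (1 / x)) * (1 / x\<^sup>2)) * poly p (1 / x)) (at x)"
        by (intro DERIV_mult DERIV_chain2[OF poly_DERIV] DERIV_fun_exp)
           (use 1 in \<open>auto intro!: derivative_eq_intros simp: power2_eq_square\<close>)
      then show ?thesis
        using 1 by (simp add: flat_def algebra_simps power2_eq_square)
    qed
    moreover have "\<forall>\<^sub>F y in nhds x. flat p y = poly p (1 / y) * exp (- (1 / y))"
      using eventually_nhds_in_open[of "{0<..}" x, OF open_greaterThan] 1
      by (simp, elim eventually_mono) (simp add: flat_def)
    ultimately show ?thesis by (simp add: DERIV_cong_ev[OF refl _ refl])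
  next
    case 2
    have "\<forall>\<^sub>F y in nhds x. flat p y = 0"
      using eventually_nhds_in_open[of "{..<0}" x, OF open_lessThan] 2
      by (simp, elim eventually_mono) (simp add: flat_def)
    then show ?thesis using 2 by (simp add: DERIV_cong_ev[OF refl _ refl] flat_def)
  next
    case 3
    \<comment> \<open>At 0 the difference quotient is again a member of the family, so
      \<open>flat_tendsto_0\<close> evaluates the derivative.\<close>
    have "(\<lambda>h. (flat p (0 + h) - flat p 0) / h) = flat (pCons 0 p)"
      by (auto simp: flat_def)
    then show ?thesis
      using flat_tendsto_0[of "pCons 0 p"] 3 by (simp add: DERIV_def flat_def)
  qed
qed

lemma smooth_flat: "smooth (flat p)"
proof -
  have "diffn n (flat p)" for n
    by (induction n arbitrary: p) (auto intro: diffn_SucI[OF flat_DERIV])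
  then show ?thesis by (simp add: smooth_iff_diffn)
qed

text \<open>A nonempty compact support has a least and a greatest element, which serve as
  \<open>p\<close> and \<open>q\<close>; this form of the support condition is the convenient one to
  verify. The zero function has empty support and takes the midpoint for both.\<close>

lemma test_functions_iff:
  assumes "a < b"
  shows "\<phi> \<in> test_functions a b \<longleftrightarrow>
    smooth \<phi> \<and> (\<exists>p q. a < p \<and> p \<le> q \<and> q < b \<and> (\<forall>t. t \<notin> {p..q} \<longrightarrow> \<phi> t = 0))"
proof -
  have "closure {t. \<phi> t \<noteq> 0} \<subseteq> {a<..<b} \<longleftrightarrow>
    (\<exists>p q. a < p \<and> p \<le> q \<and> q < b \<and> (\<forall>t. t \<notin> {p..q} \<longrightarrow> \<phi> t = 0))" (is "?L = ?R")
  proof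
    let ?S = "closure {t. \<phi> t \<noteq> 0}"
    assume L: ?L
    show ?R
    proof (cases "?S = {}")
      case True
      then have "\<forall>t. \<phi> t = 0" by auto
      then show ?R using assms by (intro exI[of _ "(a+b)/2"]) auto
    next
      case False
      have "bounded ?S" using L bounded_subset[OF bounded_box, of ?S a b] by simp
      then have "compact ?S" by (simp add: compact_eq_bounded_closed)
      then obtain p q where pq: "p \<in> ?S" "q \<in> ?S" "\<forall>t\<in>?S. p \<le> t" "\<forall>t\<in>?S. t \<le> q"
        using compact_attains_inf[OF _ False] compact_attains_sup[OF _ False] by blast
      have "t \<in> ?S" if "\<phi> t \<noteq> 0" for t
        using that closure_subset[of "{t. \<phi> t \<noteq> 0}"] by blast
      then have "\<forall>t. t \<notin> {p..q} \<longrightarrow> \<phi> t = 0" using pq by fastforce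
      moreover have "a < p" "p \<le> q" "q < b" using pq L by (auto simp: subset_iff)
      ultimately show ?R by blast
    qed
  next
    assume ?R
    then obtain p q where pq: "a < p" "p \<le> q" "q < b" "\<forall>t. t \<notin> {p..q} \<longrightarrow> \<phi> t = 0" by blast
    then have "closure {t. \<phi> t \<noteq> 0} \<subseteq> {p..q}" by (intro closure_minimal) auto
    then show ?L using pq by auto
  qed
  then show ?thesis by (simp add: test_functions_def smooth_def)
qed

section \<open>Closure properties of test functions\<close>

lemma test_functionE:
  assumes "\<phi> \<in> test_functions a b" "a < b"
  obtains p q where "smooth \<phi>" "a < p" "p \<le> q" "q < b" "\<And>t. t \<notin> {p..q} \<Longrightarrow> \<phi> t = 0"
  using assms test_functions_iff by blast

lemma test_functionI:
  assumes "smooth \<phi>" "a < p" "p \<le> q" "q < b" "\<And>t. t \<notin> {p..q} \<Longrightarrow> \<phi> t = 0"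
  shows "\<phi> \<in> test_functions a b"
  using assms test_functions_iff[of a b] by force

lemma test_function_deriv:
  assumes "\<phi> \<in> test_functions a b" "a < b"
  shows "deriv \<phi> \<in> test_functions a b"
proof -
  obtain p q where pq: "smooth \<phi>" "a < p" "p \<le> q" "q < b" "\<And>t. t \<notin> {p..q} \<Longrightarrow> \<phi> t = 0"
    using assms test_functionE by blast
  show ?thesis
  proof (rule test_functionI[OF smooth_deriv])
    fix t assume t: "t \<notin> {p..q}"
    have "\<forall>\<^sub>F y in nhds t. y \<in> - {p..q}"
      using t by (intro eventually_nhds_in_open) auto
    then have "\<forall>\<^sub>F y in nhds t. \<phi> y = 0"
      by eventually_elim (use pq in auto)
    then have "(\<phi> has_real_derivative 0) (at t)"
      by (simp add: DERIV_cong_ev[OF refl _ refl])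
    then show "deriv \<phi> t = 0" by (rule DERIV_imp_deriv)
  qed (use pq in auto)
qed

lemma test_function_mult:
  assumes "\<phi> \<in> test_functions a b" "a < b" "smooth w"
  shows "(\<lambda>t. w t * \<phi> t) \<in> test_functions a b"
  using assms by (elim test_functionE) (auto intro!: test_functionI smooth_mult)

lemma test_function_add:
  assumes "\<phi> \<in> test_functions a b" "\<psi> \<in> test_functions a b" "a < b"
  shows "(\<lambda>t. \<phi> t + \<psi> t) \<in> test_functions a b"
proof -
  obtain p q where pq: "smooth \<phi>" "a < p" "p \<le> q" "q < b" "\<And>t. t \<notin> {p..q} \<Longrightarrow> \<phi> t = 0"
    using assms test_functionE by blast
  obtain p' q' where pq': "smooth \<psi>" "a < p'" "p' \<le> q'" "q' < b" "\<And>t. t \<notin> {p'..q'} \<Longrightarrow> \<psi> t = 0"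
    using assms test_functionE by blast
  have "\<phi> t + \<psi> t = 0" if "t \<notin> {min p p'..max q q'}" for t
  proof -
    have "t \<notin> {p..q}" "t \<notin> {p'..q'}" using that by auto
    then show ?thesis using pq(5) pq'(5) by simp
  qed
  then show ?thesis
    by (rule test_functionI[where p="min p p'" and q="max q q'", rotated 4])
       (use pq pq' in \<open>auto intro!: smooth_add\<close>)
qed

lemma test_function_cmult:
  assumes "\<phi> \<in> test_functions a b" "a < b"
  shows "(\<lambda>t. c * \<phi> t) \<in> test_functions a b"
  using test_function_mult[OF assms smooth_const] .

lemma test_function_mono:
  assumes "\<phi> \<in> test_functions a b" "a' \<le> a" "b \<le> b'"
  shows "\<phi> \<in> test_functions a' b'"
  using assms unfolding test_functions_def by (auto simp: subset_iff)

text \<open>The witness is \<open>1 - exp (- n \<beta>)\<close> for a bump \<open>\<beta>\<close> that is positive exactly on \<open>(p, q)\<close>.\<close>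

lemma test_functions_to_indicator:
  assumes "a < p" "p < q" "q < b"
  obtains \<phi> :: "nat \<Rightarrow> real \<Rightarrow> real" where
    "\<And>n. \<phi> n \<in> test_functions a b" "\<And>n t. 0 \<le> \<phi> n t" "\<And>n t. \<phi> n t \<le> 1"
    "\<And>t. (\<lambda>n. \<phi> n t) \<longlonglongrightarrow> indicator {p<..<q} t" "\<And>t. t \<in> {p<..<q} \<Longrightarrow> 0 < \<phi> 1 t"
proof -
  define \<beta> where "\<beta> = (\<lambda>t. flat 1 (- p + 1 * t) * flat 1 (q + (-1) * t))"
  define \<phi> where "\<phi> = (\<lambda>(n::nat) t. 1 - exp (- real n * \<beta> t))"
  have sm: "smooth (\<phi> n)" for n
    unfolding \<phi>_def \<beta>_def
    by (intro smooth_diff smooth_const smooth_exp smooth_mult smooth_affine smooth_flat)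
  have pos: "\<beta> t > 0" if "t \<in> {p<..<q}" for t using that by (simp add: \<beta>_def flat_def)
  have zero: "\<beta> t = 0" if "t \<notin> {p<..<q}" for t using that by (auto simp: \<beta>_def flat_def)
  have nonneg: "\<beta> t \<ge> 0" for t using pos zero by (metis less_eq_real_def)
  show ?thesis
  proof (rule that[of \<phi>])
    show "\<phi> n \<in> test_functions a b" for n
      by (rule test_functionI[OF sm, of _ p q]) (use assms zero in \<open>auto simp: \<phi>_def\<close>)
    show "0 \<le> \<phi> n t" "\<phi> n t \<le> 1" for n t using nonneg[of t] by (auto simp: \<phi>_def)
    show "0 < \<phi> 1 t" if "t \<in> {p<..<q}" for t using pos[OF that] by (simp add: \<phi>_def)
    show "(\<lambda>n. \<phi> n t) \<longlonglongrightarrow> indicator {p<..<q} t" for t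
    proof (cases "t \<in> {p<..<q}")
      case True
      have "filterlim (\<lambda>n. real n * \<beta> t) at_top sequentially"
        by (rule filterlim_at_top_mult_tendsto_pos[OF tendsto_const pos[OF True] filterlim_real_sequentially])
      then have "(\<lambda>n. exp (- (real n * \<beta> t))) \<longlonglongrightarrow> 0"
        by (intro filterlim_compose[OF exp_at_bot] filterlim_compose[OF filterlim_uminus_at_bot_at_top])
      then have "(\<lambda>n. 1 - exp (- (real n * \<beta> t))) \<longlonglongrightarrow> 1 - 0"
        by (intro tendsto_diff tendsto_const)
      then show ?thesis using True by (simp add: \<phi>_def)
    next
      case False
      then show ?thesis using zero[of t] by (simp add: \<phi>_def)
    qed
  qed
qed

section \<open>Integration preliminaries\<close>

text \<open>Bridge between the two integrals in use: Bochner integration speaks of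
  \<open>AE\<close>, while gauge integral rules such as \<open>integral_spike\<close> ask for a
  negligible exceptional set.\<close>

lemma AE_lebesgue_iff_negligible:
  "(AE x in lebesgue. P x) \<longleftrightarrow> (\<exists>N. negligible N \<and> (\<forall>x. x \<notin> N \<longrightarrow> P x))"
proof
  assume "AE x in lebesgue. P x"
  then have "negligible {x. \<not> P x}"
    by (simp add: completion.AE_iff_null_sets negligible_iff_null_sets)
  then show "\<exists>N. negligible N \<and> (\<forall>x. x \<notin> N \<longrightarrow> P x)" by blast
next
  assume "\<exists>N. negligible N \<and> (\<forall>x. x \<notin> N \<longrightarrow> P x)"
  then obtain N where "negligible N" "\<forall>x. x \<notin> N \<longrightarrow> P x" by blast
  then have "negligible {x. \<not> P x}" by (auto intro: negligible_subset)
  then show "AE x in lebesgue. P x"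
    by (simp add: completion.AE_iff_null_sets negligible_iff_null_sets)
qed

lemma AE_lebesgueE:
  assumes "AE x in lebesgue. P x"
  obtains N where "negligible N" "\<And>x. x \<notin> N \<Longrightarrow> P x"
  using assms unfolding AE_lebesgue_iff_negligible by blast

text \<open>Fubini and Tonelli are applied over \<open>lborel\<close>, which demands Borel
  functions. A Lebesgue integrable function is therefore replaced, off a null set, by a Borel one
  extended by zero.\<close>

lemma borel_representative:
  fixes g :: "'a::euclidean_space \<Rightarrow> real"
  assumes "g absolutely_integrable_on S"
  obtains G N where "G \<in> borel_measurable borel" "integrable lborel G" "negligible N"
    "\<And>x. x \<notin> N \<Longrightarrow> G x = (if x \<in> S then g x else 0)"
proof -
  let ?g = "\<lambda>x. indicator S x *\<^sub>R g x"
  have int: "integrable lebesgue ?g" using assms by (simp add: set_integrable_def)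
  then have meas: "?g \<in> borel_measurable lebesgue" by simp
  from completion_ex_borel_measurable_real[OF this]
  obtain G where G: "G \<in> borel_measurable lborel" "AE x in lborel. ?g x = G x" by blast
  have ae: "AE x in lebesgue. ?g x = G x" by (rule AE_completion) (rule G)
  have "integrable lebesgue G"
    by (rule Bochner_Integration.integrable_cong_AE_imp[OF int])
       (use G ae in \<open>auto intro: measurable_completion\<close>)
  then have "integrable lborel G" using G integrable_completion by blast
  moreover obtain N where "negligible N" "\<forall>x. x \<notin> N \<longrightarrow> ?g x = G x"
    using ae AE_lebesgue_iff_negligible[of "\<lambda>x. ?g x = G x"] by blast
  moreover have "(if x \<in> S then g x else 0) = ?g x" for x by (simp add: indicator_def)
  ultimately show ?thesis using that[of G N] G by auto
qed

text \<open>Open intervals form an intersection-stable generator of the Borel sets, so vanishing of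
  the integral spreads from them to all Borel sets; a density with zero integral over every set is
  zero almost everywhere.\<close>

lemma interval_integrals_zero_imp_AE_zero:
  fixes G :: "real \<Rightarrow> real"
  assumes int: "integrable lborel G"
    and zero: "\<And>p q. p < q \<Longrightarrow> (LINT x:{p<..<q}|lborel. G x) = 0"
  shows "AE x in lborel. G x = 0"
proof -
  have si: "set_integrable lborel A G" if "A \<in> sets lborel" for A
    unfolding set_integrable_def by (rule integrable_mult_indicator[OF that int])
  \<comment> \<open>Closure under complements needs the integral over the whole line, obtained as a
    limit over growing intervals.\<close>
  have univ: "(LINT x:UNIV|lborel. G x) = 0"
  proof -
    have "(\<lambda>n. LINT x:{- real (Suc n)<..<real (Suc n)}|lborel. G x) \<longlonglongrightarrow>
        (LINT x:(\<Union>n. {- real (Suc n)<..<real (Suc n)})|lborel. G x)"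
      by (rule set_integral_cont_up) (auto simp: incseq_def intro!: si)
    moreover have "(\<Union>n. {- real (Suc n)<..<real (Suc n)}) = UNIV"
    proof -
      have "\<exists>n. - real (Suc n) < x \<and> x < real (Suc n)" for x
      proof -
        obtain n where "\<bar>x\<bar> < real n" using reals_Archimedean2 by blast
        then show ?thesis by (intro exI[of _ n]) auto
      qed
      then show ?thesis by auto
    qed
    ultimately show ?thesis using zero by (simp add: LIMSEQ_const_iff)
  qed
  have "(LINT x:A|lborel. G x) = 0" if "A \<in> sets lborel" for A
  proof -
    let ?E = "range (\<lambda>(a, b). box a b :: real set)"
    have S: "sets lborel = sigma_sets UNIV ?E"
      using borel_eq_box by (metis sets_lborel sets_measure_of subset_UNIV Pow_UNIV)
    have "Int_stable ?E"
      by (auto simp: Int_stable_def box_real Int_greaterThanLessThan image_iff)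
    moreover have "?E \<subseteq> Pow UNIV" by simp
    moreover have "A \<in> sigma_sets UNIV ?E"
      using that S by simp
    ultimately show ?thesis
    proof (induction rule: sigma_sets_induct_disjoint)
      case (basic A)
      then obtain p q where "A = {p<..<q}" by (auto simp: box_real)
      then show ?case using zero[of p q] by (cases "p < q") (auto simp: set_lebesgue_integral_def)
    next
      case empty
      show ?case by (simp add: set_lebesgue_integral_def)
    next
      case (compl A)
      then have A: "A \<in> sets lborel"
        using S by simp
      have "(LINT x:A \<union> (UNIV - A)|lborel. G x) =
          (LINT x:A|lborel. G x) + (LINT x:UNIV - A|lborel. G x)"
        using A by (intro set_integral_Un si) auto
      moreover have "A \<union> (UNIV - A) = UNIV" by auto
      ultimately show ?case using compl univ by simp
    next
      case (union A)
      have A: "A i \<in> sets lborel" for i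
        using union S by auto
      have "(LINT x:(\<Union>i. A i)|lborel. G x) = (\<Sum>i. (LINT x:(A i)|lborel. G x))"
        by (rule lebesgue_integral_countable_add)
           (use A union in \<open>auto simp: disjoint_family_on_def intro!: si\<close>)
      then show ?case using union by simp
    qed
  qed
  then show ?thesis
    by (intro density_unique_real) (use int in \<open>auto simp: set_lebesgue_integral_def\<close>)
qed

section \<open>Continuous weights, primitives, and open versus closed intervals\<close>

lemma absolutely_integrable_continuous_mult:
  fixes w g :: "real \<Rightarrow> real"
  assumes "continuous_on {a..b} w" "g absolutely_integrable_on {a..b}"
  shows "(\<lambda>t. w t * g t) absolutely_integrable_on {a..b}"
  by (rule absolutely_integrable_bounded_measurable_product_real)
     (use assms in \<open>auto intro: compact_imp_bounded compact_continuous_image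
        continuous_imp_measurable_on_sets_lebesgue\<close>)

lemma has_integral_DERIV:
  fixes f :: "real \<Rightarrow> real"
  assumes "\<And>t. (f has_real_derivative f' t) (at t)" "a \<le> b"
  shows "(f' has_integral (f b - f a)) {a..b}"
proof (rule fundamental_theorem_of_calculus[OF assms(2)])
  fix t
  show "(f has_vector_derivative f' t) (at t within {a..b})"
    unfolding has_real_derivative_iff_has_vector_derivative[symmetric]
    by (rule has_field_derivative_at_within[OF assms(1)])
qed

lemma LINT_Ioo_eq_integral:
  fixes g :: "real \<Rightarrow> real"
  assumes "g absolutely_integrable_on {a..b}"
  shows "(LINT t:{a<..<b}|lebesgue. g t) = integral {a..b} g"
  using set_lebesgue_integral_eq_integral(2)[of "{a<..<b}" g] assms
  by (simp add: absolutely_integrable_on_Icc_iff_Ioo integral_open_interval_real)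

lemma regular_dist_eq_integral:
  assumes "u absolutely_integrable_on {a..b}" "continuous_on {a..b} \<phi>"
  shows "regular_dist a b u \<phi> = integral {a..b} (\<lambda>t. u t * \<phi> t)"
  using absolutely_integrable_continuous_mult[OF assms(2,1)]
  by (simp add: regular_dist_def LINT_Ioo_eq_integral mult.commute)

lemma continuous_on_primitive:
  fixes g :: "real \<Rightarrow> real"
  assumes "g absolutely_integrable_on {a..b}"
  shows "continuous_on {a..b} (\<lambda>t. integral {a..t} g)"
  using assms by (intro indefinite_integral_continuous_1) (simp add: set_lebesgue_integral_eq_integral)

text \<open>Fubini on the triangle \<open>a \<le> s \<le> t \<le> b\<close>. It serves twice: a
  kernel \<open>\<phi>' t\<close> gives integration by parts for a merely integrable
  \<open>g\<close>, and a kernel \<open>K' (t - s)\<close> differentiates a convolution.\<close>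

lemma integral_triangle_swap:
  fixes g :: "real \<Rightarrow> real" and K :: "real \<Rightarrow> real \<Rightarrow> real"
  assumes g: "g absolutely_integrable_on {a..b}"
    and K: "continuous_on UNIV (\<lambda>z. K (fst z) (snd z))"
  shows "(\<lambda>t. integral {a..t} (\<lambda>s. K t s * g s)) integrable_on {a..b}"
    and "integral {a..b} (\<lambda>t. integral {a..t} (\<lambda>s. K t s * g s)) =
         integral {a..b} (\<lambda>s. g s * integral {s..b} (\<lambda>t. K t s))"
proof -
  let ?M2 = "lborel \<Otimes>\<^sub>M lborel :: (real \<times> real) measure"
  obtain G N where G: "G \<in> borel_measurable borel" "integrable lborel G" "negligible N"
    "\<And>x. x \<notin> N \<Longrightarrow> G x = (if x \<in> {a..b} then g x else 0)"
    using borel_representative[OF g] by blast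
  note [measurable] = G(1)
  have Kb [measurable]: "(\<lambda>z. K (fst z) (snd z)) \<in> borel_measurable borel"
    using K by (rule borel_measurable_continuous_onI)
  have Kp [measurable]: "(\<lambda>z. K (fst z) (snd z)) \<in> borel_measurable ?M2"
    using Kb by (simp add: lborel_prod)
  have K1: "continuous_on A (\<lambda>s. K t s)" for t A
    using continuous_on_compose2[OF K, of A "\<lambda>s. (t, s)"] by (simp add: continuous_on_Pair)
  have K2: "continuous_on A (\<lambda>t. K t s)" for s A
    using continuous_on_compose2[OF K, of A "\<lambda>t. (t, s)"] by (simp add: continuous_on_Pair)
  have "bounded ((\<lambda>z. K (fst z) (snd z)) ` ({a..b} \<times> {a..b}))"
    by (intro compact_imp_bounded compact_continuous_image compact_Times continuous_on_subset[OF K]) auto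
  then obtain M where M: "\<forall>x\<in>(\<lambda>z. K (fst z) (snd z)) ` ({a..b} \<times> {a..b}). norm x \<le> M"
    unfolding bounded_iff by blast
  then have KM: "\<bar>K t s\<bar> \<le> M" if "t \<in> {a..b}" "s \<in> {a..b}" for t s using that by force
  \<comment> \<open>The integrand cut off to the triangle, with the Borel representative in place of
    \<open>g\<close> so that it is jointly measurable.\<close>
  define \<Phi> where "\<Phi> t s = (if a \<le> s \<and> s \<le> t \<and> t \<le> b then K t s * G s else 0)" for t s
  have \<Phi>m [measurable]: "(\<lambda>z. \<Phi> (fst z) (snd z)) \<in> borel_measurable ?M2"
    unfolding \<Phi>_def by measurable
  have \<Phi>m1 [measurable]: "\<Phi> t \<in> borel_measurable borel" for t
    using measurable_compose[OF measurable_Pair1' \<Phi>m, of t] by simp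
  have \<Phi>m2 [measurable]: "(\<lambda>t. \<Phi> t s) \<in> borel_measurable borel" for s
    using measurable_compose[OF measurable_Pair2' \<Phi>m, of s] by simp
  \<comment> \<open>A majorant with separated variables: \<open>K\<close> is bounded on the square
    and the cut-off confines \<open>t\<close> to \<open>[a, b]\<close>. All integrability claims
    follow from it.\<close>
  have \<Phi>bd: "\<bar>\<Phi> t s\<bar> \<le> indicator {a..b} t * (\<bar>M\<bar> * \<bar>G s\<bar>)" for t s
    using KM[of t s] by (auto simp: \<Phi>_def abs_mult intro!: mult_right_mono)
  have int_ind: "integrable lborel (\<lambda>t. indicator {a..b} t * c)" for c :: real
    by (intro integrable_mult_left integrable_real_indicator) (auto simp: emeasure_lborel_Icc_eq)
  have \<Phi>1: "integrable lborel (\<Phi> t)" for t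
    by (rule Bochner_Integration.integrable_bound[of _ "\<lambda>s. indicator {a..b} t * (\<bar>M\<bar> * \<bar>G s\<bar>)"])
       (use G \<Phi>bd in auto)
  have \<Phi>2: "integrable lborel (\<lambda>t. \<Phi> t s)" for s
    by (rule Bochner_Integration.integrable_bound[OF int_ind[of "\<bar>M\<bar> * \<bar>G s\<bar>"]])
       (use \<Phi>bd in auto)
  have int2: "integrable ?M2 (case_prod \<Phi>)"
  proof (rule lborel_pair.Fubini_integrable)
    show "case_prod \<Phi> \<in> borel_measurable ?M2"
      using \<Phi>m by (simp add: case_prod_unfold)
    show "AE t in lborel. integrable lborel (\<lambda>s. case (t, s) of (t, s) \<Rightarrow> \<Phi> t s)"
      using \<Phi>1 by simp
    show "integrable lborel (\<lambda>t. LINT s|lborel. norm (case (t, s) of (t, s) \<Rightarrow> \<Phi> t s))"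
    proof (rule Bochner_Integration.integrable_bound[OF int_ind[of "\<bar>M\<bar> * (LINT s|lborel. \<bar>G s\<bar>)"]])
      show "AE t in lborel. norm (LINT s|lborel. norm (case (t, s) of (t, s) \<Rightarrow> \<Phi> t s))
          \<le> norm (indicator {a..b} t * (\<bar>M\<bar> * (LINT s|lborel. \<bar>G s\<bar>)))"
      proof (rule AE_I2)
        fix t
        have "(LINT s|lborel. \<bar>\<Phi> t s\<bar>) \<le> (LINT s|lborel. indicator {a..b} t * (\<bar>M\<bar> * \<bar>G s\<bar>))"
          using G \<Phi>1[of t] \<Phi>bd by (intro integral_mono) auto
        then show "norm (LINT s|lborel. norm (case (t, s) of (t, s) \<Rightarrow> \<Phi> t s))
          \<le> norm (indicator {a..b} t * (\<bar>M\<bar> * (LINT s|lborel. \<bar>G s\<bar>)))"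
          by simp
      qed
    qed measurable
  qed
  have inner: "(LINT s|lborel. \<Phi> t s) = (if t \<in> {a..b} then integral {a..t} (\<lambda>s. K t s * g s) else 0)" for t
  proof (cases "t \<in> {a..b}")
    case True
    have "(LINT s|lborel. \<Phi> t s) = integral UNIV (\<Phi> t)"
      by (simp add: integral_lborel \<Phi>1)
    also have "\<dots> = integral UNIV (\<lambda>s. if s \<in> {a..t} then K t s * g s else 0)"
      by (rule integral_spike[OF G(3)]) (use True G(4) in \<open>auto simp: \<Phi>_def\<close>)
    also have "\<dots> = integral {a..t} (\<lambda>s. K t s * g s)"
      by (rule integral_restrict_UNIV)
    finally show ?thesis using True by simp
  next
    case False
    then have "\<Phi> t = (\<lambda>s. 0)" by (auto simp: \<Phi>_def fun_eq_iff)
    then show ?thesis using False by auto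
  qed
  have inner2: "(LINT t|lborel. \<Phi> t s) = (if a \<le> s then G s * integral {s..b} (\<lambda>t. K t s) else 0)" for s
  proof (cases "a \<le> s")
    case True
    have "(LINT t|lborel. \<Phi> t s) = integral UNIV (\<lambda>t. \<Phi> t s)"
      by (simp add: integral_lborel \<Phi>2)
    also have "\<dots> = integral UNIV (\<lambda>t. if t \<in> {s..b} then G s * K t s else 0)"
      by (rule arg_cong[where f="integral UNIV"]) (use True in \<open>auto simp: \<Phi>_def fun_eq_iff\<close>)
    also have "\<dots> = integral {s..b} (\<lambda>t. G s * K t s)"
      by (rule integral_restrict_UNIV)
    finally show ?thesis using True by simp
  next
    case False
    then have "(\<lambda>t. \<Phi> t s) = (\<lambda>t. 0)" by (auto simp: \<Phi>_def fun_eq_iff)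
    then show ?thesis using False by simp
  qed
  let ?J = "\<lambda>t. integral {a..t} (\<lambda>s. K t s * g s)"
  let ?K = "\<lambda>s. g s * integral {s..b} (\<lambda>t. K t s)"
  show "?J integrable_on {a..b}"
    using integrable_on_lborel[OF lborel_pair.integrable_fst[OF int2]]
    unfolding inner by (simp only: integrable_restrict_UNIV)
  have "integral {a..b} ?J =
      integral UNIV (\<lambda>t. LINT s|lborel. \<Phi> t s)"
    unfolding inner by (rule integral_restrict_UNIV[symmetric])
  also have "\<dots> = (LINT t|lborel. LINT s|lborel. \<Phi> t s)"
    using lborel_pair.integrable_fst[OF int2] by (rule integral_lborel)
  also have "\<dots> = (LINT s|lborel. LINT t|lborel. \<Phi> t s)"
    by (rule lborel_pair.Fubini_integral[OF int2, symmetric])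
  also have "\<dots> = integral UNIV (\<lambda>s. LINT t|lborel. \<Phi> t s)"
    using lborel_pair.integrable_snd[OF int2] by (rule integral_lborel[symmetric])
  also have "\<dots> = integral UNIV (\<lambda>s. if s \<in> {a..b} then ?K s else 0)"
    unfolding inner2 by (rule integral_spike[OF G(3)]) (use G(4) in auto)
  also have "\<dots> = integral {a..b} ?K"
    by (rule integral_restrict_UNIV)
  finally show "integral {a..b} ?J =
         integral {a..b} ?K" .
qed

text \<open>Triangle swap with the kernel \<open>deriv \<phi> t\<close>: the inner integral is
  \<open>\<phi> b - \<phi> s = - \<phi> s\<close>. The boundary term at \<open>a\<close> vanishes
  together with the primitive.\<close>

lemma integral_by_parts_smooth:
  fixes g :: "real \<Rightarrow> real"
  assumes g: "g absolutely_integrable_on {a..b}" and \<phi>: "smooth \<phi>" "\<phi> b = 0"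
  shows "integral {a..b} (\<lambda>t. integral {a..t} g * deriv \<phi> t) = - integral {a..b} (\<lambda>t. g t * \<phi> t)"
proof -
  have "continuous_on UNIV (\<lambda>z. deriv \<phi> (fst z) :: real)" for z :: "real \<times> real"
    by (rule continuous_on_compose2[OF smooth_continuous[OF smooth_deriv[OF \<phi>(1)], of UNIV]])
       (auto intro: continuous_intros)
  then have "integral {a..b} (\<lambda>t. integral {a..t} (\<lambda>s. deriv \<phi> t * g s)) =
         integral {a..b} (\<lambda>s. g s * integral {s..b} (\<lambda>t. deriv \<phi> t))"
    by (intro integral_triangle_swap(2)[OF g])
  also have "\<dots> = integral {a..b} (\<lambda>s. - (g s * \<phi> s))"
  proof (rule integral_cong)
    fix s assume "s \<in> {a..b}"
    then have "(deriv \<phi> has_integral (\<phi> b - \<phi> s)) {s..b}"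
      by (intro has_integral_DERIV smooth_DERIV \<phi>(1)) simp
    then show "g s * integral {s..b} (deriv \<phi>) = - (g s * \<phi> s)"
      using \<phi>(2) by (simp add: integral_unique)
  qed
  finally show ?thesis by (simp add: mult.commute)
qed

text \<open>Test functions between 0 and 1 converge to the indicator of an interval compactly inside
  \<open>(a, b)\<close>, so by dominated convergence \<open>G\<close> has integral zero over it.
  Intervals that touch an end point follow by continuity of the primitive.\<close>

lemma fundamental_lemma_of_variations:
  fixes G :: "real \<Rightarrow> real"
  assumes ab: "a < b" and G: "G absolutely_integrable_on {a..b}"
    and zero: "\<And>\<phi>. \<phi> \<in> test_functions a b \<Longrightarrow> integral {a..b} (\<lambda>t. G t * \<phi> t) = 0"
  shows "AE t in lebesgue. t \<in> {a<..<b} \<longrightarrow> G t = 0"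
proof -
  have Gi: "set_integrable lebesgue {a<..<b} G"
    using G by (simp add: absolutely_integrable_on_Icc_iff_Ioo)
  have 1: "(LINT t:{p<..<q}|lebesgue. G t) = 0" if pq: "a < p" "p < q" "q < b" for p q
  proof -
    obtain \<phi> :: "nat \<Rightarrow> real \<Rightarrow> real" where \<phi>:
      "\<And>n. \<phi> n \<in> test_functions a b" "\<And>n t. 0 \<le> \<phi> n t" "\<And>n t. \<phi> n t \<le> 1"
      "\<And>t. (\<lambda>n. \<phi> n t) \<longlonglongrightarrow> indicator {p<..<q} t"
      using test_functions_to_indicator[OF pq] by metis
    have cont: "continuous_on {a..b} (\<phi> n)" for n
      using \<phi>(1)[of n] ab by (elim test_functionE) (auto intro: smooth_continuous)
    have ai: "set_integrable lebesgue {a<..<b} (\<lambda>t. \<phi> n t * G t)" for n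
      using absolutely_integrable_continuous_mult[OF cont G] by (simp add: absolutely_integrable_on_Icc_iff_Ioo)
    have "(\<lambda>n. LINT t:{a<..<b}|lebesgue. \<phi> n t * G t) \<longlonglongrightarrow> (LINT t:{p<..<q}|lebesgue. G t)"
      unfolding set_lebesgue_integral_def
    proof (rule integral_dominated_convergence)
      show "integrable lebesgue (\<lambda>t. norm (indicator {a<..<b} t *\<^sub>R G t))"
        using Gi unfolding set_integrable_def by (rule integrable_norm)
      show "(\<lambda>t. indicator {p<..<q} t *\<^sub>R G t) \<in> borel_measurable lebesgue"
        by (rule borel_measurable_integrable, fold set_integrable_def)
           (rule set_integrable_subset[OF Gi], use pq in auto)
      show "(\<lambda>t. indicator {a<..<b} t *\<^sub>R (\<phi> n t * G t)) \<in> borel_measurable lebesgue" for n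
        using ai[of n] by (auto simp: set_integrable_def)
      show "AE t in lebesgue. norm (indicator {a<..<b} t *\<^sub>R (\<phi> n t * G t))
           \<le> norm (indicator {a<..<b} t *\<^sub>R G t)" for n
        using \<phi>(2,3)[of n] by (intro AE_I2) (auto simp: indicator_def abs_mult intro: mult_left_le_one_le)
      show "AE t in lebesgue. (\<lambda>n. indicator {a<..<b} t *\<^sub>R (\<phi> n t * G t)) \<longlonglongrightarrow> indicator {p<..<q} t *\<^sub>R G t"
      proof (rule AE_I2)
        fix t
        have "(\<lambda>n. indicator {a<..<b} t *\<^sub>R (\<phi> n t * G t)) \<longlonglongrightarrow>
            indicator {a<..<b} t *\<^sub>R (indicator {p<..<q} t * G t)"
          by (intro tendsto_scaleR tendsto_mult tendsto_const \<phi>(4))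
        moreover have "indicator {a<..<b} t *\<^sub>R (indicator {p<..<q} t * G t) = indicator {p<..<q} t *\<^sub>R G t"
          using pq by (auto simp: indicator_def)
        ultimately show "(\<lambda>n. indicator {a<..<b} t *\<^sub>R (\<phi> n t * G t)) \<longlonglongrightarrow> indicator {p<..<q} t *\<^sub>R G t"
          by (simp only:)
      qed
    qed
    moreover have "(LINT t:{a<..<b}|lebesgue. \<phi> n t * G t) = 0" for n
      using LINT_Ioo_eq_integral[OF absolutely_integrable_continuous_mult[OF cont[of n] G]] zero[OF \<phi>(1)[of n]]
      by (simp add: mult.commute)
    ultimately show ?thesis by (simp add: LIMSEQ_const_iff)
  qed
  have 2: "(LINT t:{p<..<q}|lebesgue. G t) = 0" if pq: "a \<le> p" "p < q" "q \<le> b" for p q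
  proof -
    have sub: "G absolutely_integrable_on {r..s}" if "a \<le> r" "s \<le> b" for r s
      using absolutely_integrable_on_subinterval[OF G] that by simp
    have comb: "integral {a..r} G + (LINT t:{r<..<s}|lebesgue. G t) = integral {a..s} G"
      if "a \<le> r" "r \<le> s" "s \<le> b" for r s
      using that LINT_Ioo_eq_integral[OF sub] set_lebesgue_integral_eq_integral(1)[OF sub]
      by (simp add: Henstock_Kurzweil_Integration.integral_combine)
    define h where "h = (\<lambda>t. integral {a..t} G)"
    define m where "m = (a + b) / 2"
    have m: "a < m" "m < b" using ab by (auto simp: m_def)
    have const: "h t = h m" if "t \<in> {a<..<b}" for t
      using comb[of t m] 1[of t m] comb[of m t] 1[of m t] that m
      by (cases t m rule: linorder_cases) (auto simp: h_def)
    have "continuous_on (closure {a<..<b}) h"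
      using continuous_on_primitive[OF G] ab by (simp add: h_def)
    then have "h t = h m" if "t \<in> {a..b}" for t
      using continuous_constant_on_closure[of "{a<..<b}" h "h m" t] const that ab by simp
    then show ?thesis using comb[of p q] pq by (simp add: h_def)
  qed
  obtain G' N where G': "G' \<in> borel_measurable borel" "integrable lborel G'" "negligible N"
    "\<And>x. x \<notin> N \<Longrightarrow> G' x = (if x \<in> {a<..<b} then G x else 0)"
    using borel_representative[OF Gi] by blast
  \<comment> \<open>Any interval of the line meets \<open>(a, b)\<close> in an interval already
    treated, and \<open>G'\<close> vanishes almost everywhere outside.\<close>
  have "AE x in lborel. G' x = 0"
  proof (rule interval_integrals_zero_imp_AE_zero[OF G'(2)])
    fix p q :: real assume "p < q"
    have [measurable]: "G' \<in> borel_measurable borel" by fact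
    have ae: "AE x in lebesgue. G' x = (if x \<in> {a<..<b} then G x else 0)"
      using G'(3,4) AE_lebesgue_iff_negligible by blast
    let ?I = "{max a p<..<min b q}"
    have "(LINT x:{p<..<q}|lborel. G' x) = (LINT x|lebesgue. indicator {p<..<q} x *\<^sub>R G' x)"
      unfolding set_lebesgue_integral_def by (rule integral_completion[symmetric]) measurable
    also have "\<dots> = (LINT x:?I|lebesgue. G x)"
      unfolding set_lebesgue_integral_def
    proof (rule integral_cong_AE)
      show "(\<lambda>x. indicator {p<..<q} x *\<^sub>R G' x) \<in> borel_measurable lebesgue"
        by (rule measurable_completion) measurable
      show "(\<lambda>x. indicator ?I x *\<^sub>R G x) \<in> borel_measurable lebesgue"
        by (rule borel_measurable_integrable, fold set_integrable_def)
           (rule set_integrable_subset[OF Gi], auto)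
      show "AE x in lebesgue. indicator {p<..<q} x *\<^sub>R G' x = indicator ?I x *\<^sub>R G x"
        using ae by eventually_elim (auto simp: indicator_def)
    qed
    also have "\<dots> = 0"
      using 2[of "max a p" "min b q"] by (cases "max a p < min b q") (auto simp: set_lebesgue_integral_def)
    finally show "(LINT x:{p<..<q}|lborel. G' x) = 0" .
  qed
  then have "AE x in lebesgue. G' x = 0" by (rule AE_completion)
  moreover have "AE x in lebesgue. G' x = (if x \<in> {a<..<b} then G x else 0)"
    using G'(3,4) AE_lebesgue_iff_negligible by blast
  ultimately show ?thesis by eventually_elim (auto split: if_splits)
qed

text \<open>Every test function differs from a derivative of a test function by a multiple of a fixed
  one, which reduces the du Bois-Reymond lemma to the fundamental lemma.\<close>

lemma du_Bois_Reymond: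
  fixes G :: "real \<Rightarrow> real"
  assumes ab: "a < b" and G: "G absolutely_integrable_on {a..b}"
    and zero: "\<And>\<phi>. \<phi> \<in> test_functions a b \<Longrightarrow> integral {a..b} (\<lambda>t. G t * deriv \<phi> t) = 0"
  obtains C where "AE t in lebesgue. t \<in> {a<..<b} \<longrightarrow> G t = C"
proof -
  define p0 where "p0 = (2 * a + b) / 3"
  define q0 where "q0 = (a + 2 * b) / 3"
  have pq0: "a < p0" "p0 < q0" "q0 < b" using ab by (auto simp: p0_def q0_def)
  obtain \<beta> :: "nat \<Rightarrow> real \<Rightarrow> real" where \<beta>:
    "\<And>n. \<beta> n \<in> test_functions a b" "\<And>n t. 0 \<le> \<beta> n t" "\<And>n t. \<beta> n t \<le> 1"
    "\<And>t. (\<lambda>n. \<beta> n t) \<longlonglongrightarrow> indicator {p0<..<q0} t" "\<And>t. t \<in> {p0<..<q0} \<Longrightarrow> 0 < \<beta> 1 t"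
    by (rule test_functions_to_indicator[OF pq0]) blast
  define \<rho> where "\<rho> = \<beta> 1"
  have \<rho>: "\<rho> \<in> test_functions a b" "\<And>t. 0 \<le> \<rho> t" "\<And>t. t \<in> {p0<..<q0} \<Longrightarrow> 0 < \<rho> t"
    using \<beta> by (auto simp: \<rho>_def)
  have smooth_test: "smooth \<phi>" if "\<phi> \<in> test_functions a b" for \<phi>
    using that ab test_functions_iff by blast
  have int_test: "\<phi> integrable_on {s..t}" if "\<phi> \<in> test_functions a b" for \<phi> s t
    using smooth_test[OF that] by (intro integrable_continuous_real smooth_continuous)
  have mult_int: "(\<lambda>t. G t * \<phi> t) integrable_on {a..b}" if "\<phi> \<in> test_functions a b" for \<phi>
    using set_lebesgue_integral_eq_integral(1)[OF absolutely_integrable_continuous_mult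
      [OF smooth_continuous[OF smooth_test[OF that]] G]] by (simp add: mult.commute)
  define m where "m = integral {a..b} \<rho>"
  have "m \<noteq> 0"
  proof
    assume "m = 0"
    then have "\<forall>t\<in>{a..b}. \<rho> t = 0"
      using integral_eq_0_iff[of a b \<rho>] \<rho>(2) ab smooth_continuous[OF smooth_test[OF \<rho>(1)]]
      by (simp add: m_def)
    then show False using \<rho>(3)[of "(a + b) / 2"] ab by (auto simp: p0_def q0_def)
  qed
  define C where "C = integral {a..b} (\<lambda>t. G t * \<rho> t) / m"
  have "AE t in lebesgue. t \<in> {a<..<b} \<longrightarrow> G t - C = 0"
  proof (rule fundamental_lemma_of_variations[OF ab])
    show "(\<lambda>t. G t - C) absolutely_integrable_on {a..b}"
      by (intro set_integral_diff(1)[OF G] absolutely_integrable_continuous_real) auto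
    fix \<psi> assume \<psi>: "\<psi> \<in> test_functions a b"
    \<comment> \<open>Chosen to give \<open>\<eta>\<close> mean zero, so that its primitive returns
      to zero past the support and is a test function.\<close>
    define c where "c = - integral {a..b} \<psi> / m"
    define \<eta> where "\<eta> = (\<lambda>t. \<psi> t + c * \<rho> t)"
    have \<eta>: "\<eta> \<in> test_functions a b"
      unfolding \<eta>_def by (intro test_function_add test_function_cmult \<psi> \<rho> ab)
    then obtain p q where pq: "smooth \<eta>" "a < p" "p \<le> q" "q < b" "\<And>t. t \<notin> {p..q} \<Longrightarrow> \<eta> t = 0"
      using test_functionE[OF \<eta> ab] by blast
    have \<eta>0: "integral {a..b} \<eta> = 0"
    proof -
      have "integral {a..b} \<eta> = integral {a..b} \<psi> + c * integral {a..b} \<rho>"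
        unfolding \<eta>_def
        by (simp add: integral_add[OF int_test[OF \<psi>] integrable_on_mult_right[OF int_test[OF \<rho>(1)]]])
      moreover have "c * m = - integral {a..b} \<psi>" using \<open>m \<noteq> 0\<close> by (simp add: c_def)
      ultimately show ?thesis unfolding m_def by linarith
    qed
    \<comment> \<open>To the left of \<open>a\<close> the interval is empty and the integral is 0,
      so the formula gives the desired primitive on the whole line.\<close>
    define \<phi> where "\<phi> t = integral {a..t} \<eta>" for t
    have \<phi>p: "\<phi> t = 0" if "t < p" for t
    proof -
      have "integral {a..t} \<eta> = integral {a..t} (\<lambda>_. 0)"
        by (rule integral_cong) (use that in \<open>simp add: pq(5)\<close>)
      then show ?thesis by (simp add: \<phi>_def)
    qed
    have \<phi>q: "\<phi> t = 0" if "q < t" for t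
    proof -
      have *: "integral {a..r} \<eta> = integral {a..q} \<eta>" if "q < r" for r
      proof -
        have "integral {a..q} \<eta> + integral {q..r} \<eta> = integral {a..r} \<eta>"
          using pq that by (intro Henstock_Kurzweil_Integration.integral_combine int_test \<eta>) auto
        moreover have "integral {q..r} \<eta> = integral {q..r} (\<lambda>_. 0)"
          by (rule integral_spike[of "{q}"]) (simp_all add: pq(5))
        ultimately show ?thesis by simp
      qed
      show ?thesis using *[OF that] *[OF pq(4)] \<eta>0 by (simp add: \<phi>_def)
    qed
    have D\<phi>: "(\<phi> has_real_derivative \<eta> t) (at t)" for t
    proof (cases "t < p")
      case True
      have "\<forall>\<^sub>F y in nhds t. y \<in> {..<p}" using True by (intro eventually_nhds_in_open) auto
      then have "\<forall>\<^sub>F y in nhds t. \<phi> y = 0" by eventually_elim (simp add: \<phi>p)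
      then show ?thesis using True pq(5)[of t] by (simp add: DERIV_cong_ev[OF refl _ refl])
    next
      case False
      then have "t \<in> {a..t+1}" using pq by simp
      then have "(\<phi> has_real_derivative \<eta> t) (at t within {a..t+1})"
        unfolding \<phi>_def by (intro integral_has_real_derivative smooth_continuous pq)
      moreover have "at t within {a..t+1} = at t"
        by (rule at_within_interior) (use False pq in simp)
      ultimately show ?thesis by (simp only:)
    qed
    have \<phi>: "\<phi> \<in> test_functions a b"
    proof (rule test_functionI[of _ _ p q])
      show "smooth \<phi>" using D\<phi> pq(1) by (rule smooth_antiderivative)
      show "\<phi> t = 0" if "t \<notin> {p..q}" for t
        using that \<phi>p[of t] \<phi>q[of t] by (cases "t < p") simp_all
    qed (use pq in auto)
    have "deriv \<phi> = \<eta>" using D\<phi> DERIV_imp_deriv by blast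
    then have "integral {a..b} (\<lambda>t. G t * \<eta> t) = 0" using zero[OF \<phi>] by simp
    moreover have "integral {a..b} (\<lambda>t. G t * \<eta> t) =
        integral {a..b} (\<lambda>t. G t * \<psi> t + c * (G t * \<rho> t))"
      by (simp add: \<eta>_def algebra_simps)
    moreover have "\<dots> = integral {a..b} (\<lambda>t. G t * \<psi> t) + c * integral {a..b} (\<lambda>t. G t * \<rho> t)"
      using mult_int[OF \<psi>] mult_int[OF \<rho>(1)] by (simp add: integral_add integrable_on_mult_right)
    moreover have "integral {a..b} (\<lambda>t. (G t - C) * \<psi> t) =
        integral {a..b} (\<lambda>t. G t * \<psi> t) - C * integral {a..b} \<psi>"
      using mult_int[OF \<psi>] int_test[OF \<psi>]
      by (simp add: left_diff_distrib integral_diff integrable_on_mult_right)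
    moreover have "c * integral {a..b} (\<lambda>t. G t * \<rho> t) = - C * integral {a..b} \<psi>"
      using \<open>m \<noteq> 0\<close> by (simp add: C_def c_def)
    ultimately show "integral {a..b} (\<lambda>t. (G t - C) * \<psi> t) = 0" by simp
  qed
  then have "AE t in lebesgue. t \<in> {a<..<b} \<longrightarrow> G t = C" by simp
  then show ?thesis by (rule that)
qed

text \<open>Null sets do not affect the integral of \<open>(f - g)^2\<close>, and a nonnegative
  continuous function with integral zero is zero. This singles out the continuous representative of
  an almost everywhere class.\<close>

lemma continuous_AE_eq_imp_eq:
  fixes f g :: "real \<Rightarrow> real"
  assumes "continuous_on {a..b} f" "continuous_on {a..b} g" "a < b"
    and ae: "AE t in lebesgue. t \<in> {a<..<b} \<longrightarrow> f t = g t" and t: "t \<in> {a..b}"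
  shows "f t = g t"
proof -
  obtain N where N: "negligible N" "\<And>t. t \<notin> N \<Longrightarrow> t \<in> {a<..<b} \<longrightarrow> f t = g t"
    using AE_lebesgueE[OF ae] by blast
  have "integral {a..b} (\<lambda>t. (f t - g t)\<^sup>2) = integral {a..b} (\<lambda>t. 0)"
    by (rule integral_spike[of "N \<union> {a, b}"]) (use N in \<open>auto simp: negligible_Un\<close>)
  then have 0: "integral {a..b} (\<lambda>t. (f t - g t)\<^sup>2) = 0" by simp
  have c: "continuous_on {a..b} (\<lambda>t. (f t - g t)\<^sup>2)" by (intro continuous_intros assms)
  have "\<forall>t\<in>{a..b}. (f t - g t)\<^sup>2 = 0"
    using integral_eq_0_iff[OF c \<open>a < b\<close>] 0 by simp
  then show ?thesis using t by simp
qed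

section \<open>Square integrable functions\<close>

text \<open>On a bounded interval \<open>|u| \<le> 1 + u^2\<close> makes square integrable functions
  integrable. Absolute integrability on the closed interval is the form that the gauge integral
  rules take.\<close>

lemma L2_iff:
  "u \<in> L2 a b \<longleftrightarrow> u absolutely_integrable_on {a..b} \<and> (\<lambda>t. (u t)\<^sup>2) absolutely_integrable_on {a..b}"
proof -
  have 1: "set_integrable lebesgue {a<..<b} u"
    if u: "set_borel_measurable lebesgue {a<..<b} u" "set_integrable lebesgue {a<..<b} (\<lambda>t. (u t)\<^sup>2)"
  proof (rule set_integrable_bound[OF _ u(1)])
    show "set_integrable lebesgue {a<..<b} (\<lambda>t. 1 + (u t)\<^sup>2)"
    proof (rule set_integral_add(1)[OF _ u(2)])
      show "set_integrable lebesgue {a<..<b} (\<lambda>t. 1 :: real)"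
        using absolutely_integrable_continuous_real[of a b "\<lambda>_. 1::real"]
        unfolding absolutely_integrable_on_Icc_iff_Ioo by simp
    qed
    have "\<bar>u t\<bar> \<le> 1 + (u t)\<^sup>2" for t
    proof -
      have "2 * \<bar>u t\<bar> \<le> 1 + (u t)\<^sup>2"
        using sum_squares_bound[of 1 "\<bar>u t\<bar>"] by simp
      then show ?thesis by simp
    qed
    then show "AE t in lebesgue. t \<in> {a<..<b} \<longrightarrow> norm (u t) \<le> norm (1 + (u t)\<^sup>2)" by simp
  qed
  have 2: "set_borel_measurable lebesgue {a<..<b} u" if "set_integrable lebesgue {a<..<b} u"
    using that unfolding set_integrable_def set_borel_measurable_def by (rule borel_measurable_integrable)
  show ?thesis
    unfolding absolutely_integrable_on_Icc_iff_Ioo L2_def mem_Collect_eq using 1 2 by blast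
qed

lemma L2_absolutely_integrable: "u \<in> L2 a b \<Longrightarrow> u absolutely_integrable_on {a..b}"
  and L2_square_integrable: "u \<in> L2 a b \<Longrightarrow> (\<lambda>t. (u t)\<^sup>2) absolutely_integrable_on {a..b}"
  by (simp_all add: L2_iff)

lemma L2_integrable: "u \<in> L2 a b \<Longrightarrow> u integrable_on {a..b}"
  by (rule set_lebesgue_integral_eq_integral(1)[OF L2_absolutely_integrable])

lemma L2_add:
  assumes "u \<in> L2 a b" "v \<in> L2 a b"
  shows "(\<lambda>t. u t + v t) \<in> L2 a b"
proof -
  have s: "(\<lambda>t. u t + v t) absolutely_integrable_on {a..b}"
    using assms by (intro set_integral_add(1) L2_absolutely_integrable)
  moreover have "(\<lambda>t. (u t + v t)\<^sup>2) absolutely_integrable_on {a..b}"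
  proof (rule set_integrable_bound)
    show "(\<lambda>t. 2 * (u t)\<^sup>2 + 2 * (v t)\<^sup>2) absolutely_integrable_on {a..b}"
      using assms by (intro set_integral_add(1) set_integrable_mult_right) (auto dest: L2_square_integrable)
    have "(\<lambda>t. indicator {a..b} t *\<^sub>R (u t + v t)) \<in> borel_measurable lebesgue"
      using s unfolding set_integrable_def by (rule borel_measurable_integrable)
    then have "(\<lambda>t. (indicator {a..b} t *\<^sub>R (u t + v t))\<^sup>2) \<in> borel_measurable lebesgue"
      by (rule borel_measurable_power)
    moreover have "(\<lambda>t. (indicator {a..b} t *\<^sub>R (u t + v t))\<^sup>2) = (\<lambda>t. indicator {a..b} t *\<^sub>R (u t + v t)\<^sup>2)"
      by (auto simp: indicator_def fun_eq_iff)
    ultimately show "set_borel_measurable lebesgue {a..b} (\<lambda>t. (u t + v t)\<^sup>2)"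
      unfolding set_borel_measurable_def by (simp only:)
    have "(u t + v t)\<^sup>2 \<le> 2 * (u t)\<^sup>2 + 2 * (v t)\<^sup>2" for t
      using sum_squares_bound[of "u t" "v t"] by (simp add: power2_sum)
    then show "AE t in lebesgue. t \<in> {a..b} \<longrightarrow>
        norm ((u t + v t)\<^sup>2) \<le> norm (2 * (u t)\<^sup>2 + 2 * (v t)\<^sup>2)"
      by (intro AE_I2) simp
  qed
  ultimately show ?thesis by (simp add: L2_iff)
qed

lemma L2_continuous_mult:
  assumes "continuous_on {a..b} w" "u \<in> L2 a b"
  shows "(\<lambda>t. w t * u t) \<in> L2 a b"
  using absolutely_integrable_continuous_mult[OF assms(1) L2_absolutely_integrable[OF assms(2)]]
    absolutely_integrable_continuous_mult[OF continuous_on_power[OF assms(1), of 2] L2_square_integrable[OF assms(2)]]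
  by (simp add: L2_iff power_mult_distrib)

lemma L2_cmult: "u \<in> L2 a b \<Longrightarrow> (\<lambda>t. c * u t) \<in> L2 a b"
  by (rule L2_continuous_mult) auto

lemma L2_diff: "u \<in> L2 a b \<Longrightarrow> v \<in> L2 a b \<Longrightarrow> (\<lambda>t. u t - v t) \<in> L2 a b"
  using L2_add[OF _ L2_cmult[of v a b "-1"]] by simp

lemma L2_continuous: "continuous_on {a..b} u \<Longrightarrow> u \<in> L2 a b"
  by (auto simp: L2_iff intro!: absolutely_integrable_continuous_real continuous_intros)

lemma L2_subinterval: "u \<in> L2 a b \<Longrightarrow> a \<le> a' \<Longrightarrow> b' \<le> b \<Longrightarrow> u \<in> L2 a' b'"
  by (auto simp: L2_iff intro: absolutely_integrable_on_subinterval)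

lemma L2_primitive_continuous: "g \<in> L2 a b \<Longrightarrow> continuous_on {a..b} (\<lambda>t. integral {a..t} g)"
  by (intro continuous_on_primitive L2_absolutely_integrable)

lemma primitive_continuous_on:
  assumes "g \<in> L2 a b" "\<And>t. t \<in> {a..b} \<Longrightarrow> x t = C + integral {a..t} g"
  shows "continuous_on {a..b} x"
proof -
  have "continuous_on {a..b} (\<lambda>t. C + integral {a..t} g)"
    using L2_primitive_continuous[OF assms(1)] by (intro continuous_intros)
  moreover have "continuous_on {a..b} x \<longleftrightarrow> continuous_on {a..b} (\<lambda>t. C + integral {a..t} g)"
    by (rule continuous_on_cong[OF refl assms(2)])
  ultimately show ?thesis by simp
qed

lemma L2_primitive: "g \<in> L2 a b \<Longrightarrow> (\<lambda>t. integral {a..t} g) \<in> L2 a b"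
  by (rule L2_continuous[OF L2_primitive_continuous])

section \<open>Weak derivatives\<close>

lemma test_function_smooth: "\<phi> \<in> test_functions a b \<Longrightarrow> smooth \<phi>"
  by (simp add: test_functions_def smooth_def)

lemma test_function_continuous: "\<phi> \<in> test_functions a b \<Longrightarrow> continuous_on A \<phi>"
  by (intro smooth_continuous test_function_smooth)

lemma test_function_deriv_funpow:
  "\<phi> \<in> test_functions a b \<Longrightarrow> a < b \<Longrightarrow> (deriv ^^ n) \<phi> \<in> test_functions a b"
  by (induction n) (auto intro: test_function_deriv)

lemma dist_deriv_funpow: "(dist_deriv ^^ n) \<Lambda> \<phi> = (-1) ^ n * \<Lambda> ((deriv ^^ n) \<phi>)"
proof (induction n arbitrary: \<phi>)
  case (Suc n)
  have "(dist_deriv ^^ Suc n) \<Lambda> \<phi> = - (dist_deriv ^^ n) \<Lambda> (deriv \<phi>)"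
    by (simp add: dist_deriv_def)
  then show ?case by (simp add: Suc.IH funpow_swap1)
qed simp

lemma regular_dist_test:
  assumes "u \<in> L2 a b" "\<phi> \<in> test_functions a b"
  shows "regular_dist a b u \<phi> = integral {a..b} (\<lambda>t. u t * \<phi> t)"
  using assms by (intro regular_dist_eq_integral L2_absolutely_integrable test_function_continuous)

lemma L2_mult_test_integrable:
  assumes "u \<in> L2 a b" "\<phi> \<in> test_functions a b"
  shows "(\<lambda>t. u t * \<phi> t) integrable_on {a..b}"
  using L2_integrable[OF L2_continuous_mult[OF test_function_continuous[OF assms(2)] assms(1)]]
  by (simp add: mult.commute)

lemma regular_dist_add:
  assumes "u \<in> L2 a b" "v \<in> L2 a b" "\<phi> \<in> test_functions a b"
  shows "regular_dist a b (\<lambda>t. u t + v t) \<phi> = regular_dist a b u \<phi> + regular_dist a b v \<phi>"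
  using assms by (simp add: regular_dist_test L2_add distrib_right integral_add L2_mult_test_integrable)

lemma regular_dist_cmult:
  "regular_dist a b (\<lambda>t. c * u t) \<phi> = c * regular_dist a b u \<phi>"
  by (simp add: regular_dist_def mult.assoc set_integral_mult_right)

lemma regular_dist_inj:
  assumes ab: "a < b" and uv: "u \<in> L2 a b" "v \<in> L2 a b"
    and eq: "dist_eq a b (regular_dist a b u) (regular_dist a b v)"
  shows "AE t in lebesgue. t \<in> {a<..<b} \<longrightarrow> u t = v t"
proof -
  have "AE t in lebesgue. t \<in> {a<..<b} \<longrightarrow> u t - v t = 0"
  proof (rule fundamental_lemma_of_variations[OF ab])
    show "(\<lambda>t. u t - v t) absolutely_integrable_on {a..b}"
      using uv by (intro L2_absolutely_integrable L2_diff)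
    fix \<phi> assume \<phi>: "\<phi> \<in> test_functions a b"
    then have "integral {a..b} (\<lambda>t. u t * \<phi> t) = integral {a..b} (\<lambda>t. v t * \<phi> t)"
      using eq uv by (simp add: dist_eq_def regular_dist_test)
    then show "integral {a..b} (\<lambda>t. (u t - v t) * \<phi> t) = 0"
      using uv \<phi> by (simp add: left_diff_distrib integral_diff L2_mult_test_integrable)
  qed
  then show ?thesis by simp
qed

text \<open>The lemma of du Bois-Reymond in terms of distributions. The constant it produces becomes
  the \<open>C\<close> of the integral equation.\<close>

lemma dist_deriv_regular_eq_imp:
  assumes ab: "a < b" and uv: "u \<in> L2 a b" "v \<in> L2 a b"
    and eq: "dist_eq a b (dist_deriv (regular_dist a b u)) (dist_deriv (regular_dist a b v))"
  obtains C where "AE t in lebesgue. t \<in> {a<..<b} \<longrightarrow> u t = v t + C"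
proof -
  obtain C where "AE t in lebesgue. t \<in> {a<..<b} \<longrightarrow> u t - v t = C"
  proof (rule du_Bois_Reymond[OF ab])
    show "(\<lambda>t. u t - v t) absolutely_integrable_on {a..b}"
      using uv by (intro L2_absolutely_integrable L2_diff)
    fix \<phi> assume \<phi>: "\<phi> \<in> test_functions a b"
    then have d: "deriv \<phi> \<in> test_functions a b" using ab by (rule test_function_deriv)
    have "regular_dist a b u (deriv \<phi>) = regular_dist a b v (deriv \<phi>)"
      using eq \<phi> by (simp add: dist_eq_def dist_deriv_def)
    then have "integral {a..b} (\<lambda>t. u t * deriv \<phi> t) = integral {a..b} (\<lambda>t. v t * deriv \<phi> t)"
      using regular_dist_test[OF uv(1) d] regular_dist_test[OF uv(2) d] by simp
    then show "integral {a..b} (\<lambda>t. (u t - v t) * deriv \<phi> t) = 0"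
      using uv d by (simp add: left_diff_distrib integral_diff L2_mult_test_integrable)
  qed
  then have "AE t in lebesgue. t \<in> {a<..<b} \<longrightarrow> u t = v t + C" by eventually_elim auto
  then show ?thesis by (rule that)
qed

lemma has_weak_deriv_1: "has_weak_deriv a b 1 u g \<longleftrightarrow>
    dist_eq a b (regular_dist a b g) (dist_deriv (regular_dist a b u))"
  by (simp add: has_weak_deriv_def)

text \<open>The constant drops out because \<open>deriv \<phi>\<close> has integral zero; the
  primitive is handled by parts.\<close>

lemma primitive_has_weak_deriv:
  assumes ab: "a < b" and g: "g \<in> L2 a b" and x: "\<And>t. t \<in> {a..b} \<Longrightarrow> x t = C + integral {a..t} g"
  shows "has_weak_deriv a b 1 x g"
  unfolding has_weak_deriv_1 dist_eq_def
proof
  fix \<phi> assume \<phi>: "\<phi> \<in> test_functions a b"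
  have d: "deriv \<phi> \<in> test_functions a b" using \<phi> ab by (rule test_function_deriv)
  obtain p q where pq: "smooth \<phi>" "a < p" "p \<le> q" "q < b" "\<And>t. t \<notin> {p..q} \<Longrightarrow> \<phi> t = 0"
    using test_functionE[OF \<phi> ab] by blast
  have xc: "continuous_on {a..b} x" by (rule primitive_continuous_on[OF g x])
  have "(deriv \<phi> has_integral (\<phi> b - \<phi> a)) {a..b}"
    using ab by (intro has_integral_DERIV smooth_DERIV pq(1)) simp
  then have 0: "integral {a..b} (deriv \<phi>) = 0" using pq by (simp add: integral_unique)
  have "integral {a..b} (\<lambda>t. x t * deriv \<phi> t) =
      integral {a..b} (\<lambda>t. C * deriv \<phi> t + integral {a..t} g * deriv \<phi> t)"
    by (rule integral_cong) (simp add: x algebra_simps)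
  also have "\<dots> = C * integral {a..b} (deriv \<phi>) + integral {a..b} (\<lambda>t. integral {a..t} g * deriv \<phi> t)"
    using integral_add[OF integrable_on_mult_right[OF integrable_continuous_real[OF test_function_continuous[OF d]]]
      integrable_continuous_real[OF continuous_on_mult[OF L2_primitive_continuous[OF g] test_function_continuous[OF d]]]]
    by simp
  also have "\<dots> = - integral {a..b} (\<lambda>t. g t * \<phi> t)"
    using 0 integral_by_parts_smooth[OF L2_absolutely_integrable[OF g] pq(1)] pq by simp
  finally show "regular_dist a b g \<phi> = dist_deriv (regular_dist a b x) \<phi>"
    using \<phi> d g L2_continuous[OF xc] by (simp add: dist_deriv_def regular_dist_test)
qed

lemma has_weak_derivD:
  "has_weak_deriv a b 1 u g \<Longrightarrow> \<phi> \<in> test_functions a b \<Longrightarrow> regular_dist a b g \<phi> = - regular_dist a b u (deriv \<phi>)"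
  unfolding has_weak_deriv_1 dist_eq_def dist_deriv_def by blast

lemma integral_has_weak_deriv:
  "a < b \<Longrightarrow> g \<in> L2 a b \<Longrightarrow> has_weak_deriv a b 1 (\<lambda>t. integral {a..t} g) g"
  by (rule primitive_has_weak_deriv[of _ _ _ _ 0]) simp_all

lemma L2_const: "(\<lambda>t. C) \<in> L2 a b"
  by (rule L2_continuous) simp

lemma const_has_weak_deriv: "a < b \<Longrightarrow> has_weak_deriv a b 1 (\<lambda>t. C) (\<lambda>t. 0)"
  by (rule primitive_has_weak_deriv[OF _ L2_const, of _ _ _ C]) simp_all

text \<open>\<open>u\<close> and the primitive of \<open>g\<close> have the same distributional
  derivative, hence differ by a constant.\<close>

lemma weak_deriv_imp_primitive:
  assumes ab: "a < b" and ug: "u \<in> L2 a b" "g \<in> L2 a b" and w: "has_weak_deriv a b 1 u g"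
  obtains C where "AE t in lebesgue. t \<in> {a<..<b} \<longrightarrow> u t = C + integral {a..t} g"
proof -
  have "dist_eq a b (dist_deriv (regular_dist a b u)) (dist_deriv (regular_dist a b (\<lambda>t. integral {a..t} g)))"
    using w integral_has_weak_deriv[OF ab ug(2)] unfolding has_weak_deriv_1 dist_eq_def by simp
  then obtain C where "AE t in lebesgue. t \<in> {a<..<b} \<longrightarrow> u t = integral {a..t} g + C"
    using dist_deriv_regular_eq_imp[OF ab ug(1) L2_primitive[OF ug(2)]] by blast
  then have "AE t in lebesgue. t \<in> {a<..<b} \<longrightarrow> u t = C + integral {a..t} g" by (simp add: add.commute)
  then show ?thesis by (rule that)
qed

lemma sobolev_fun_1: "u \<in> sobolev_fun a b 1 \<longleftrightarrow> u \<in> L2 a b \<and> (\<exists>g\<in>L2 a b. has_weak_deriv a b 1 u g)"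
proof -
  have "j \<le> Suc 0 \<longleftrightarrow> j = 0 \<or> j = 1" for j by auto
  moreover have "has_weak_deriv a b 0 u u" by (simp add: has_weak_deriv_def dist_eq_def)
  ultimately show ?thesis by (auto simp: sobolev_fun_def)
qed

text \<open>The working form of H^1: absolutely continuous functions with square integrable
  derivative. Continuity turns the almost everywhere identity into one at every point, end points
  included, so that boundary values can be read off.\<close>

lemma H1_iff:
  assumes ab: "a < b"
  shows "x \<in> H1 a b \<longleftrightarrow> (\<exists>g\<in>L2 a b. \<forall>t\<in>{a..b}. x t = x a + integral {a..t} g)"
proof
  assume "x \<in> H1 a b"
  then have x: "x \<in> L2 a b" "continuous_on {a..b} x" and "\<exists>g\<in>L2 a b. has_weak_deriv a b 1 x g"
    by (auto simp: H1_def sobolev_fun_1)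
  then obtain g where g: "g \<in> L2 a b" "has_weak_deriv a b 1 x g" by blast
  obtain C where C: "AE t in lebesgue. t \<in> {a<..<b} \<longrightarrow> x t = C + integral {a..t} g"
    using weak_deriv_imp_primitive[OF ab x(1) g] by blast
  have *: "x t = C + integral {a..t} g" if "t \<in> {a..b}" for t
    by (rule continuous_AE_eq_imp_eq[OF x(2) _ ab C that])
       (intro continuous_intros L2_primitive_continuous g)
  then have "x a = C" using ab by simp
  then show "\<exists>g\<in>L2 a b. \<forall>t\<in>{a..b}. x t = x a + integral {a..t} g" using * g by auto
next
  assume "\<exists>g\<in>L2 a b. \<forall>t\<in>{a..b}. x t = x a + integral {a..t} g"
  then obtain g where g: "g \<in> L2 a b" "\<And>t. t \<in> {a..b} \<Longrightarrow> x t = x a + integral {a..t} g" by blast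
  have "continuous_on {a..b} x" by (rule primitive_continuous_on[OF g])
  then show "x \<in> H1 a b"
    using primitive_has_weak_deriv[OF ab g] g(1) by (auto simp: H1_def sobolev_fun_1 intro: L2_continuous)
qed

section \<open>The Gagliardo seminorm\<close>

text \<open>Changing a function of one variable on \<open>N\<close> changes its Gagliardo quotient
  on the strips over \<open>N\<close> in both coordinates; these have to be null in the
  plane.\<close>

lemma negligible_Times_UNIV:
  fixes N :: "'a::euclidean_space set"
  assumes "negligible N"
  shows "negligible (N \<times> (UNIV :: 'b::euclidean_space set))" "negligible ((UNIV :: 'b set) \<times> N)"
proof -
  obtain N' where N': "N' \<in> null_sets lborel" "N \<subseteq> N'"
    using assms by (auto simp: negligible_iff_null_sets null_sets_completion_iff2)
  have [measurable]: "N' \<in> sets lborel" using N' by auto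
  have "N' \<times> (UNIV :: 'b set) \<in> null_sets (lborel \<Otimes>\<^sub>M lborel)"
    using N' by (auto simp: null_sets_def lborel.emeasure_pair_measure_Times)
  moreover have "(UNIV :: 'b set) \<times> N' \<in> null_sets (lborel \<Otimes>\<^sub>M lborel)"
    using N' by (auto simp: null_sets_def lborel.emeasure_pair_measure_Times)
  ultimately have "negligible (N' \<times> (UNIV :: 'b set))" "negligible ((UNIV :: 'b set) \<times> N')"
    by (auto simp: negligible_iff_null_sets lborel_prod intro: null_sets_completionI)
  then show "negligible (N \<times> (UNIV :: 'b set))" "negligible ((UNIV :: 'b set) \<times> N)"
    using N'(2) by (auto elim!: negligible_subset)
qed

lemma borel_measurable_fst_snd:
  fixes G :: "real \<Rightarrow> real"
  assumes "G \<in> borel_measurable borel"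
  shows "(\<lambda>z :: real \<times> real. G (fst z)) \<in> borel_measurable borel"
    "(\<lambda>z :: real \<times> real. G (snd z)) \<in> borel_measurable borel"
  by (rule measurable_compose[OF _ assms], rule borel_measurable_continuous_onI, intro continuous_intros)+

definition gagliardo_quot :: "real \<Rightarrow> (real \<Rightarrow> real) \<Rightarrow> real \<times> real \<Rightarrow> real" where
  "gagliardo_quot \<sigma> g = (\<lambda>(x, y). (g x - g y)\<^sup>2 / \<bar>x - y\<bar> powr (1 + 2 * \<sigma>))"

lemma finite_gagliardo_iff:
  "finite_gagliardo a b \<sigma> g \<longleftrightarrow> gagliardo_quot \<sigma> g absolutely_integrable_on {a<..<b} \<times> {a<..<b}"
  by (simp add: finite_gagliardo_def gagliardo_quot_def)

lemma gagliardo_quot_nonneg: "0 \<le> gagliardo_quot \<sigma> g z"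
  by (auto simp: gagliardo_quot_def split: prod.split)

lemma borel_measurable_gagliardo_quot:
  assumes "G \<in> borel_measurable borel"
  shows "gagliardo_quot \<sigma> G \<in> borel_measurable borel"
proof -
  note [measurable] = borel_measurable_fst_snd[OF assms] borel_measurable_fst_snd[OF measurable_ident_sets[OF refl], simplified]
  show ?thesis unfolding gagliardo_quot_def case_prod_unfold by measurable
qed

lemma gagliardo_quot_cong_AE:
  assumes "AE x in lebesgue. x \<in> {a<..<b} \<longrightarrow> g x = h x"
  obtains N where "negligible N"
    "\<And>z. z \<in> {a<..<b} \<times> {a<..<b} - N \<Longrightarrow> gagliardo_quot \<sigma> h z = gagliardo_quot \<sigma> g z"
proof -
  obtain N where N: "negligible N" "\<And>x. x \<notin> N \<Longrightarrow> x \<in> {a<..<b} \<longrightarrow> g x = h x"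
    using AE_lebesgueE[OF assms] by blast
  show ?thesis
  proof (rule that[of "N \<times> UNIV \<union> UNIV \<times> N"])
    show "negligible (N \<times> UNIV \<union> UNIV \<times> N)"
      by (intro negligible_Un negligible_Times_UNIV N)
    fix z assume z: "z \<in> {a<..<b} \<times> {a<..<b} - (N \<times> UNIV \<union> UNIV \<times> N)"
    then have "g (fst z) = h (fst z)" "g (snd z) = h (snd z)"
      using N(2)[of "fst z"] N(2)[of "snd z"] by (auto simp: mem_Times_iff)
    then show "gagliardo_quot \<sigma> h z = gagliardo_quot \<sigma> g z"
      by (simp add: gagliardo_quot_def case_prod_unfold)
  qed
qed

lemma finite_gagliardo_cong_AE:
  assumes "AE x in lebesgue. x \<in> {a<..<b} \<longrightarrow> g x = h x" "finite_gagliardo a b \<sigma> g"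
  shows "finite_gagliardo a b \<sigma> h"
proof -
  obtain N where N: "negligible N"
    "\<And>z. z \<in> {a<..<b} \<times> {a<..<b} - N \<Longrightarrow> gagliardo_quot \<sigma> h z = gagliardo_quot \<sigma> g z"
    using gagliardo_quot_cong_AE[OF assms(1)] by blast
  show ?thesis
    unfolding finite_gagliardo_iff
    by (rule absolutely_integrable_spike[OF assms(2)[unfolded finite_gagliardo_iff] N])
qed

text \<open>Measurability in the plane holds for a Borel representative and is carried back to
  \<open>g\<close> off a null set of the plane.\<close>

lemma set_borel_measurable_gagliardo_quot:
  assumes "g absolutely_integrable_on {a..b}"
  shows "set_borel_measurable lebesgue ({a<..<b} \<times> {a<..<b}) (gagliardo_quot \<sigma> g)"
proof -
  obtain G N where G: "G \<in> borel_measurable borel" "integrable lborel G" "negligible N"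
    "\<And>x. x \<notin> N \<Longrightarrow> G x = (if x \<in> {a..b} then g x else 0)"
    using borel_representative[OF assms] by blast
  let ?I = "{a<..<b} \<times> {a<..<b}"
  have "AE x in lebesgue. x \<in> {a<..<b} \<longrightarrow> G x = g x"
    unfolding AE_lebesgue_iff_negligible using G(3,4) by (intro exI[of _ N]) simp
  note cong = gagliardo_quot_cong_AE[OF this, of \<sigma>]
  obtain M where M: "negligible M"
    "\<And>z. z \<in> ?I - M \<Longrightarrow> gagliardo_quot \<sigma> g z = gagliardo_quot \<sigma> G z"
    using cong by blast
  have I: "?I \<in> sets borel" by (intro borel_open open_Times open_greaterThanLessThan)
  have "(\<lambda>z. indicator ?I z *\<^sub>R gagliardo_quot \<sigma> G z) \<in> borel_measurable borel"
    by (rule borel_measurable_scaleR[OF borel_measurable_indicator[OF I]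
        borel_measurable_gagliardo_quot[OF G(1)]])
  then have "(\<lambda>z. indicator ?I z *\<^sub>R gagliardo_quot \<sigma> G z) \<in> borel_measurable lebesgue"
    by (intro measurable_completion) simp
  moreover have "AE z in lebesgue. indicator ?I z *\<^sub>R gagliardo_quot \<sigma> G z = indicator ?I z *\<^sub>R gagliardo_quot \<sigma> g z"
    unfolding AE_lebesgue_iff_negligible using M by (intro exI[of _ M]) (auto simp: indicator_def)
  ultimately show ?thesis unfolding set_borel_measurable_def by (rule borel_measurable_AE)
qed

text \<open>Domination by \<open>(p + q)^2 \<le> 2 p^2 + 2 q^2\<close>; measurability of the
  quotient of the sum is a separate matter, supplied by membership in L^2.\<close>

lemma finite_gagliardo_add:
  assumes "g \<in> L2 a b" "h \<in> L2 a b" "finite_gagliardo a b \<sigma> g" "finite_gagliardo a b \<sigma> h"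
  shows "finite_gagliardo a b \<sigma> (\<lambda>t. g t + h t)"
  unfolding finite_gagliardo_iff
proof (rule set_integrable_bound)
  show "(\<lambda>z. 2 * gagliardo_quot \<sigma> g z + 2 * gagliardo_quot \<sigma> h z) absolutely_integrable_on {a<..<b} \<times> {a<..<b}"
    using assms(3,4) unfolding finite_gagliardo_iff
    by (intro set_integral_add(1) set_integrable_mult_right) auto
  show "set_borel_measurable lebesgue ({a<..<b} \<times> {a<..<b}) (gagliardo_quot \<sigma> (\<lambda>t. g t + h t))"
    using assms by (intro set_borel_measurable_gagliardo_quot L2_absolutely_integrable L2_add)
  have "gagliardo_quot \<sigma> (\<lambda>t. g t + h t) z \<le> 2 * gagliardo_quot \<sigma> g z + 2 * gagliardo_quot \<sigma> h z" for z
  proof -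
    obtain x y where z: "z = (x, y)" by (cases z)
    have "(g x + h x - (g y + h y))\<^sup>2 \<le> 2 * (g x - g y)\<^sup>2 + 2 * (h x - h y)\<^sup>2"
      using sum_squares_bound[of "g x - g y" "h x - h y"] by (simp add: power2_eq_square algebra_simps)
    then have "(g x + h x - (g y + h y))\<^sup>2 / \<bar>x - y\<bar> powr (1 + 2 * \<sigma>) \<le>
        (2 * (g x - g y)\<^sup>2 + 2 * (h x - h y)\<^sup>2) / \<bar>x - y\<bar> powr (1 + 2 * \<sigma>)"
      by (rule divide_right_mono) simp
    then show ?thesis by (simp add: z gagliardo_quot_def add_divide_distrib)
  qed
  then show "AE z in lebesgue. z \<in> {a<..<b} \<times> {a<..<b} \<longrightarrow> norm (gagliardo_quot \<sigma> (\<lambda>t. g t + h t) z)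
      \<le> norm (2 * gagliardo_quot \<sigma> g z + 2 * gagliardo_quot \<sigma> h z)"
    using gagliardo_quot_nonneg by (intro AE_I2) (smt (verit) real_norm_def)
qed

lemma finite_gagliardo_cmult:
  assumes "finite_gagliardo a b \<sigma> g"
  shows "finite_gagliardo a b \<sigma> (\<lambda>t. c * g t)"
proof -
  have "gagliardo_quot \<sigma> (\<lambda>t. c * g t) = (\<lambda>z. c\<^sup>2 * gagliardo_quot \<sigma> g z)"
    by (auto simp: gagliardo_quot_def fun_eq_iff power_mult_distrib simp flip: right_diff_distrib)
  then show ?thesis
    using assms unfolding finite_gagliardo_iff by (simp only:) (intro set_integrable_mult_right, simp)
qed

text \<open>The Cauchy-Schwarz inequality against the constant 1, read off from the nonnegative
  integral of \<open>(g - \<mu>)^2\<close> with \<open>\<mu>\<close> the mean of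
  \<open>g\<close>.\<close>

lemma integral_square_le:
  fixes g :: "real \<Rightarrow> real"
  assumes g: "g \<in> L2 s t" and st: "s \<le> t"
  shows "(integral {s..t} g)\<^sup>2 \<le> (t - s) * integral {s..t} (\<lambda>r. (g r)\<^sup>2)"
proof (cases "s < t")
  case True
  let ?I = "integral {s..t} g"
  define \<mu> where "\<mu> = ?I / (t - s)"
  have g2: "(\<lambda>r. (g r)\<^sup>2) integrable_on {s..t}"
    by (rule set_lebesgue_integral_eq_integral(1)[OF L2_square_integrable[OF g]])
  have "0 \<le> integral {s..t} (\<lambda>r. (g r - \<mu>)\<^sup>2)"
    by (rule integral_nonneg[OF set_lebesgue_integral_eq_integral(1)[OF
          L2_square_integrable[OF L2_diff[OF g L2_continuous[OF continuous_on_const]]]]]) simp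
  also have "integral {s..t} (\<lambda>r. (g r - \<mu>)\<^sup>2) = integral {s..t} (\<lambda>r. (g r)\<^sup>2 - 2 * \<mu> * g r + \<mu>\<^sup>2)"
    by (simp add: power2_diff algebra_simps)
  also have "\<dots> = integral {s..t} (\<lambda>r. (g r)\<^sup>2) - 2 * \<mu> * ?I + \<mu>\<^sup>2 * (t - s)"
    using has_integral_add[OF has_integral_diff[OF integrable_integral[OF g2]
        has_integral_mult_right[OF integrable_integral[OF L2_integrable[OF g]], of "2 * \<mu>"]]
        has_integral_const_real[of "\<mu>\<^sup>2" s t]] True
    by (simp add: integral_unique mult.commute)
  also have "2 * \<mu> * ?I = 2 * ?I\<^sup>2 / (t - s)" by (simp add: \<mu>_def power2_eq_square)
  also have "\<mu>\<^sup>2 * (t - s) = ?I\<^sup>2 / (t - s)" using True by (simp add: \<mu>_def power2_eq_square)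
  finally have "?I\<^sup>2 / (t - s) \<le> integral {s..t} (\<lambda>r. (g r)\<^sup>2)" by simp
  then show ?thesis using True by (simp add: pos_divide_le_eq mult.commute)
next
  case False
  then show ?thesis using st by simp
qed

text \<open>The point is that \<open>M\<close> is independent of \<open>r\<close>, wherever in the
  interval the singularity sits. After a translation each side of the singularity contributes at
  most \<open>J\<close>, the integral of \<open>x powr - \<sigma>\<close> over
  \<open>(0, L)\<close>, finite because \<open>\<sigma> < 1\<close>.\<close>

lemma nn_integral_abs_powr_le:
  fixes \<sigma> :: real
  assumes "\<sigma> < 1" "0 \<le> L"
  obtains M where "0 \<le> M" "\<And>r. r \<in> {a..a + L} \<Longrightarrow>
    (\<integral>\<^sup>+ t. indicator {a<..<a + L} t * ennreal (\<bar>t - r\<bar> powr - \<sigma>) \<partial>lborel) \<le> ennreal M"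
proof -
  let ?k = "\<lambda>\<tau>::real. ennreal (\<bar>\<tau>\<bar> powr - \<sigma>)"
  define J where "J = L powr (- \<sigma> + 1) / (- \<sigma> + 1)"
  have J: "0 \<le> J" using assms by (simp add: J_def)
  have hi: "((\<lambda>x. x powr - \<sigma>) has_integral J) {0..L}"
    unfolding J_def using assms by (intro has_integral_powr_from_0) auto
  have "((\<lambda>x. if x \<in> {0..L} then \<bar>x\<bar> powr - \<sigma> else 0) has_integral J) UNIV"
    unfolding has_integral_restrict_UNIV by (rule has_integral_eq[OF _ hi]) simp
  then have "(\<integral>\<^sup>+ x. ennreal (if x \<in> {0..L} then \<bar>x\<bar> powr - \<sigma> else 0) \<partial>lborel) = J"
    by (intro nn_integral_has_integral_lborel) auto
  moreover have "ennreal (if x \<in> {0..L} then \<bar>x\<bar> powr - \<sigma> else 0) = indicator {0..L} x * ?k x" for x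
    by (auto simp: indicator_def)
  ultimately have pos: "(\<integral>\<^sup>+ x. indicator {0..L} x * ?k x \<partial>lborel) = J" by simp
  have "(\<integral>\<^sup>+ x. indicator {-L..0} x * ?k x \<partial>lborel) =
      ennreal \<bar>-1\<bar> * (\<integral>\<^sup>+ x. indicator {-L..0} (0 + (-1) * x) * ?k (0 + (-1) * x) \<partial>lborel)"
    by (rule nn_integral_real_affine) auto
  also have "(\<lambda>x. indicator {-L..0} (0 + (-1) * x) * ?k (0 + (-1) * x)) = (\<lambda>x. indicator {0..L} x * ?k x)"
    by (auto simp: indicator_def fun_eq_iff)
  finally have neg: "(\<integral>\<^sup>+ x. indicator {-L..0} x * ?k x \<partial>lborel) = J" using pos by simp
  show ?thesis
  proof (rule that[of "J + J"])
    fix r assume r: "r \<in> {a..a + L}"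
    have "(\<integral>\<^sup>+ t. indicator {a<..<a + L} t * ?k (t - r) \<partial>lborel) =
       ennreal \<bar>1\<bar> * (\<integral>\<^sup>+ x. indicator {a<..<a + L} (r + 1 * x) * ?k (r + 1 * x - r) \<partial>lborel)"
      by (rule nn_integral_real_affine) auto
    also have "\<dots> \<le> (\<integral>\<^sup>+ x. indicator {0..L} x * ?k x + indicator {-L..0} x * ?k x \<partial>lborel)"
      using r by (auto intro!: nn_integral_mono simp: indicator_def)
    also have "\<dots> = ennreal (J + J)"
      using J by (subst nn_integral_add) (simp_all add: pos neg del: ennreal_plus flip: ennreal_plus)
    finally show "(\<integral>\<^sup>+ t. indicator {a<..<a + L} t * ?k (t - r) \<partial>lborel) \<le> ennreal (J + J)" .
  qed (use J in simp)
qed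

text \<open>For \<open>s < r < t\<close> one has \<open>(t - s)\<^sup>-\<^sup>2\<^sup>\<sigma> \<le> (t - r)\<^sup>-\<^sup>\<sigma> (r - s)\<^sup>-\<^sup>\<sigma>\<close>; the triple integral of the
  right-hand side against \<open>g(r)\<^sup>2\<close> then splits into single integrals.\<close>

lemma gagliardo_quot_primitive_le:
  assumes g: "g \<in> L2 a b" and x: "\<And>t. t \<in> {a..b} \<Longrightarrow> x t = C + integral {a..t} g"
    and \<sigma>: "0 \<le> \<sigma>"
    and Q: "Q \<in> borel_measurable borel" "negligible N"
      "\<And>r. r \<notin> N \<Longrightarrow> Q r = (if r \<in> {a..b} then (g r)\<^sup>2 else 0)"
    and ts: "a < s" "s < t" "t < b"
  shows "ennreal (gagliardo_quot \<sigma> x (t, s)) \<le>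
    (\<integral>\<^sup>+ r. indicator {a<..<b} r * ennreal \<bar>Q r\<bar> * ennreal (\<bar>t - r\<bar> powr - \<sigma>) * ennreal (\<bar>s - r\<bar> powr - \<sigma>) \<partial>lborel)"
proof -
  let ?R = "\<lambda>r. indicator {a<..<b} r * ennreal \<bar>Q r\<bar> * ennreal (\<bar>t - r\<bar> powr - \<sigma>) * ennreal (\<bar>s - r\<bar> powr - \<sigma>)"
  let ?d = "(t - s) powr - \<sigma>"
  note [measurable] = Q(1)
  have gst: "g \<in> L2 s t" using L2_subinterval[OF g] ts by simp
  let ?A = "integral {s..t} (\<lambda>r. (g r)\<^sup>2)"
  have g2: "(\<lambda>r. (g r)\<^sup>2) integrable_on {s..t}"
    by (rule set_lebesgue_integral_eq_integral(1)[OF L2_square_integrable[OF gst]])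
  have A0: "0 \<le> ?A" by (rule integral_nonneg[OF g2]) simp
  have "integral {a..s} g + integral {s..t} g = integral {a..t} g"
    using ts by (intro Henstock_Kurzweil_Integration.integral_combine
        L2_integrable[OF L2_subinterval[OF g]]) auto
  then have "x t - x s = integral {s..t} g" using x[of t] x[of s] ts by simp
  then have "(x t - x s)\<^sup>2 \<le> (t - s) * ?A" using integral_square_le[OF gst] ts by simp
  then have "gagliardo_quot \<sigma> x (t, s) \<le> (t - s) * ?A / (t - s) powr (1 + 2 * \<sigma>)"
    using ts by (simp add: gagliardo_quot_def divide_right_mono)
  \<comment> \<open>The power of \<open>t - s\<close> gained from Cauchy-Schwarz cancels one in the
    denominator; the remaining exponent \<open>- 2 \<sigma>\<close> is shared equally between two
    factors.\<close>
  also have "\<dots> = ?d * ?d * ?A"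
  proof -
    have "(t - s) powr (1 + 2 * \<sigma>) = (t - s) * ((t - s) powr \<sigma> * (t - s) powr \<sigma>)"
      using ts by (simp add: powr_add flip: powr_add[of _ \<sigma> \<sigma>])
    moreover have "t - s \<noteq> 0" using ts by simp
    ultimately show ?thesis by (simp add: powr_minus divide_inverse mult_ac)
  qed
  finally have "ennreal (gagliardo_quot \<sigma> x (t, s)) \<le>
      ennreal (?d * ?d) * ennreal ?A"
    by (subst ennreal_mult[symmetric]) (auto intro: ennreal_leI A0)
  also have "ennreal ?A = (\<integral>\<^sup>+ r. ennreal (if r \<in> {s<..<t} then \<bar>Q r\<bar> else 0) \<partial>lborel)"
  proof (rule nn_integral_has_integral_lborel[symmetric])
    have "((\<lambda>r. if r \<in> {s..t} then (g r)\<^sup>2 else 0) has_integral ?A) UNIV"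
      unfolding has_integral_restrict_UNIV by (rule integrable_integral[OF g2])
    then show "((\<lambda>r. if r \<in> {s<..<t} then \<bar>Q r\<bar> else 0) has_integral ?A) UNIV"
      by (rule has_integral_spike[of "N \<union> {s, t}", rotated 2])
         (use Q(2,3) ts in \<open>auto simp: negligible_Un\<close>)
  qed auto
  also have "ennreal (?d * ?d) * \<dots> =
      (\<integral>\<^sup>+ r. ennreal (?d * ?d) * ennreal (if r \<in> {s<..<t} then \<bar>Q r\<bar> else 0) \<partial>lborel)"
    by (rule nn_integral_cmult[symmetric]) measurable
  also have "\<dots> \<le> (\<integral>\<^sup>+ r. ?R r \<partial>lborel)"
  proof (rule nn_integral_mono)
    fix r :: real
    show "ennreal (?d * ?d) * ennreal (if r \<in> {s<..<t} then \<bar>Q r\<bar> else 0)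
        \<le> ?R r"
    proof (cases "r \<in> {s<..<t}")
      case True
      \<comment> \<open>Both \<open>t - r\<close> and \<open>r - s\<close> are shorter than
        \<open>t - s\<close>, and the exponent is not positive.\<close>
      have "?d \<le> (t - r) powr - \<sigma>" "?d \<le> (r - s) powr - \<sigma>"
        using True \<sigma> by (auto intro!: powr_mono2')
      then have "?d * ?d * \<bar>Q r\<bar> \<le>
          (t - r) powr - \<sigma> * (r - s) powr - \<sigma> * \<bar>Q r\<bar>"
        by (intro mult_right_mono mult_mono) auto
      then have "ennreal (?d * ?d * \<bar>Q r\<bar>) \<le>
          ennreal ((t - r) powr - \<sigma> * (r - s) powr - \<sigma> * \<bar>Q r\<bar>)" by (rule ennreal_leI)
      moreover have "\<bar>t - r\<bar> = t - r" "\<bar>s - r\<bar> = r - s" "r \<in> {a<..<b}" using True ts by auto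
      ultimately show ?thesis using True by (simp add: ennreal_mult mult_ac)
    qed auto
  qed
  finally show ?thesis .
qed

lemma gagliardo_quot_commute: "gagliardo_quot \<sigma> x (t, s) = gagliardo_quot \<sigma> x (s, t)"
  by (simp add: gagliardo_quot_def power2_commute abs_minus_commute)

text \<open>Integrating the pointwise bound over \<open>s\<close> and \<open>t\<close> and pulling
  \<open>r\<close> outwards by Tonelli leaves two copies of the singular kernel, each with integral
  at most \<open>M\<close>. The double integral is therefore at most \<open>M^2\<close> times the
  integral of \<open>|Q|\<close>, that is, of \<open>g^2\<close>.\<close>

lemma finite_gagliardo_primitive:
  assumes ab: "a < b" and g: "g \<in> L2 a b" and x: "\<And>t. t \<in> {a..b} \<Longrightarrow> x t = C + integral {a..t} g"
    and \<sigma>: "0 \<le> \<sigma>" "\<sigma> < 1"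
  shows "finite_gagliardo a b \<sigma> x"
proof -
  obtain Q N where Q: "Q \<in> borel_measurable borel" "integrable lborel Q" "negligible N"
    "\<And>r. r \<notin> N \<Longrightarrow> Q r = (if r \<in> {a..b} then (g r)\<^sup>2 else 0)"
    using borel_representative[OF L2_square_integrable[OF g]] by blast
  note [measurable] = Q(1)
  have "0 \<le> b - a" using ab by simp
  obtain M where M: "0 \<le> M" "\<And>r. r \<in> {a..a + (b - a)} \<Longrightarrow>
    (\<integral>\<^sup>+ t. indicator {a<..<a + (b - a)} t * ennreal (\<bar>t - r\<bar> powr - \<sigma>) \<partial>lborel) \<le> ennreal M"
    using nn_integral_abs_powr_le[OF \<sigma>(2) \<open>0 \<le> b - a\<close>, of a] by blast
  let ?I = "{a<..<b}"
  let ?k = "\<lambda>t r. ennreal (\<bar>t - r\<bar> powr - \<sigma>)"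
  let ?Q = "\<lambda>r. indicator ?I r * ennreal \<bar>Q r\<bar>"
  let ?K = "\<lambda>t r. indicator ?I t * ?k t r"
  have M': "(\<integral>\<^sup>+ t. indicator ?I t * ?k t r \<partial>lborel) \<le> ennreal M" if "r \<in> ?I" for r
    using M(2)[of r] that by simp
  have cont: "continuous_on {a..b} x" by (rule primitive_continuous_on[OF g x])
  \<comment> \<open>Cut off by zero to make the quotient Borel; on the open square nothing
    changes.\<close>
  define X where "X t = indicator {a..b} t *\<^sub>R x t" for t
  have X: "X \<in> borel_measurable borel"
    unfolding X_def by (rule borel_measurable_continuous_on_indicator[OF _ cont]) simp
  have IxI: "?I \<times> ?I \<in> sets borel" by (intro borel_open open_Times open_greaterThanLessThan)
  define q where "q z = indicator (?I \<times> ?I) z *\<^sub>R gagliardo_quot \<sigma> X z" for z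
  have q: "q \<in> borel_measurable borel"
    unfolding q_def by (rule borel_measurable_scaleR[OF borel_measurable_indicator[OF IxI]
        borel_measurable_gagliardo_quot[OF X]])
  have q0: "0 \<le> q z" for z
    unfolding q_def using gagliardo_quot_nonneg by (simp add: indicator_def)
  have ptw: "ennreal (q (t, s)) \<le> (\<integral>\<^sup>+ r. ?Q r * ?K t r * ?K s r \<partial>lborel)" for t s
  proof (cases "t \<in> ?I \<and> s \<in> ?I")
    case True
    have eq: "q (t, s) = gagliardo_quot \<sigma> x (t, s)"
      using True by (simp add: q_def X_def gagliardo_quot_def)
    consider "s < t" | "t < s" | "s = t" by linarith
    then have "ennreal (gagliardo_quot \<sigma> x (t, s)) \<le>
      (\<integral>\<^sup>+ r. ?Q r * ?k t r * ?k s r \<partial>lborel)"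
    proof cases
      case 1
      then show ?thesis using gagliardo_quot_primitive_le[OF g x \<sigma>(1) Q(1,3,4), of s t] True by simp
    next
      case 2
      then show ?thesis
        using gagliardo_quot_primitive_le[OF g x \<sigma>(1) Q(1,3,4), of t s] True
        by (simp add: gagliardo_quot_commute[of _ _ t s] mult_ac)
    next
      \<comment> \<open>On the diagonal the quotient is \<open>0 / 0\<close>, that is, 0.\<close>
      case 3
      then show ?thesis by (simp add: gagliardo_quot_def)
    qed
    then show ?thesis using True by (simp add: eq)
  next
    case False
    then show ?thesis by (auto simp: q_def indicator_def)
  qed
  have "(\<integral>\<^sup>+ z. ennreal (q z) \<partial>(lborel \<Otimes>\<^sub>M lborel)) =
      (\<integral>\<^sup>+ t. \<integral>\<^sup>+ s. ennreal (q (t, s)) \<partial>lborel \<partial>lborel)"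
    by (rule lborel.nn_integral_fst[symmetric]) (use q in \<open>simp add: lborel_prod\<close>)
  also have "\<dots> \<le> (\<integral>\<^sup>+ t. \<integral>\<^sup>+ s. (\<integral>\<^sup>+ r. ?Q r * ?K t r * ?K s r \<partial>lborel) \<partial>lborel \<partial>lborel)"
    by (intro nn_integral_mono ptw)
  also have "\<dots> = (\<integral>\<^sup>+ t. \<integral>\<^sup>+ r. \<integral>\<^sup>+ s. ?Q r * ?K t r * ?K s r \<partial>lborel \<partial>lborel \<partial>lborel)"
    by (intro nn_integral_cong lborel_pair.Fubini') measurable
  also have "\<dots> \<le> (\<integral>\<^sup>+ t. \<integral>\<^sup>+ r. ?Q r * ennreal M * ?K t r \<partial>lborel \<partial>lborel)"
  proof (intro nn_integral_mono)
    fix t r :: real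
    have "(\<integral>\<^sup>+ s. ?Q r * ?K t r * ?K s r \<partial>lborel) = ?Q r * ?K t r * (\<integral>\<^sup>+ s. ?K s r \<partial>lborel)"
      by (rule nn_integral_cmult) measurable
    also have "\<dots> \<le> ?Q r * ?K t r * ennreal M"
      using M' by (cases "r \<in> ?I") (auto intro: mult_left_mono)
    finally show "(\<integral>\<^sup>+ s. ?Q r * ?K t r * ?K s r \<partial>lborel) \<le> ?Q r * ennreal M * ?K t r"
      by (simp only: mult_ac)
  qed
  also have "\<dots> = (\<integral>\<^sup>+ r. \<integral>\<^sup>+ t. ?Q r * ennreal M * ?K t r \<partial>lborel \<partial>lborel)"
    by (rule lborel_pair.Fubini') measurable
  also have "\<dots> \<le> (\<integral>\<^sup>+ r. ennreal M * ennreal M * ennreal (norm (Q r)) \<partial>lborel)"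
  proof (intro nn_integral_mono)
    fix r :: real
    have "(\<integral>\<^sup>+ t. ?Q r * ennreal M * ?K t r \<partial>lborel) = ?Q r * ennreal M * (\<integral>\<^sup>+ t. ?K t r \<partial>lborel)"
      by (rule nn_integral_cmult) measurable
    also have "\<dots> \<le> ennreal \<bar>Q r\<bar> * ennreal M * ennreal M"
      using M' by (cases "r \<in> ?I") (auto intro: mult_left_mono)
    finally show "(\<integral>\<^sup>+ t. ?Q r * ennreal M * ?K t r \<partial>lborel) \<le> ennreal M * ennreal M * ennreal (norm (Q r))"
      by (simp add: mult_ac)
  qed
  also have "\<dots> = ennreal M * ennreal M * (\<integral>\<^sup>+ r. ennreal (norm (Q r)) \<partial>lborel)"
    by (rule nn_integral_cmult) measurable
  also have "\<dots> < \<infinity>"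
    using Q(2) unfolding integrable_iff_bounded by (simp add: ennreal_mult_less_top)
  finally have "(\<integral>\<^sup>+ z. ennreal (norm (q z)) \<partial>lborel) < \<infinity>"
    using q0 by (simp add: lborel_prod)
  then have "integrable lborel q" using q by (intro integrableI_bounded) auto
  then have "integrable lebesgue q" using q by (simp add: integrable_completion)
  moreover have "q = (\<lambda>z. indicator (?I \<times> ?I) z *\<^sub>R gagliardo_quot \<sigma> x z)"
    by (auto simp: q_def X_def gagliardo_quot_def fun_eq_iff indicator_def)
  ultimately show ?thesis unfolding finite_gagliardo_iff set_integrable_def by simp
qed

section \<open>Sobolev spaces\<close>

lemma has_weak_deriv_0: "has_weak_deriv a b 0 u u"
  by (simp add: has_weak_deriv_def dist_eq_def)

text \<open>Trades one order of differentiation of \<open>u\<close> for the passage to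
  \<open>g\<close>, the step by which the inductions over the integer part of the order
  proceed.\<close>

lemma has_weak_deriv_Suc:
  assumes ab: "a < b" and ug: "has_weak_deriv a b 1 u g"
  shows "has_weak_deriv a b (Suc i) u h \<longleftrightarrow> has_weak_deriv a b i g h"
proof -
  have "(dist_deriv ^^ Suc i) (regular_dist a b u) \<phi> = (dist_deriv ^^ i) (regular_dist a b g) \<phi>"
    if \<phi>: "\<phi> \<in> test_functions a b" for \<phi>
  proof -
    have "regular_dist a b g ((deriv ^^ i) \<phi>) = - regular_dist a b u (deriv ((deriv ^^ i) \<phi>))"
      by (rule has_weak_derivD[OF ug test_function_deriv_funpow[OF \<phi> ab]])
    then show ?thesis unfolding dist_deriv_funpow by simp
  qed
  then show ?thesis unfolding has_weak_deriv_def dist_eq_def by simp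
qed

lemma has_weak_deriv_add:
  assumes ab: "a < b" and L: "u \<in> L2 a b" "v \<in> L2 a b" "g \<in> L2 a b" "h \<in> L2 a b"
    and w: "has_weak_deriv a b j u g" "has_weak_deriv a b j v h"
  shows "has_weak_deriv a b j (\<lambda>t. u t + v t) (\<lambda>t. g t + h t)"
  unfolding has_weak_deriv_def dist_eq_def
proof
  fix \<phi> assume \<phi>: "\<phi> \<in> test_functions a b"
  note d = test_function_deriv_funpow[OF \<phi> ab, of j]
  show "regular_dist a b (\<lambda>t. g t + h t) \<phi> = (dist_deriv ^^ j) (regular_dist a b (\<lambda>t. u t + v t)) \<phi>"
    using w \<phi> unfolding has_weak_deriv_def dist_eq_def dist_deriv_funpow
    by (simp add: regular_dist_add[OF L(3,4) \<phi>] regular_dist_add[OF L(1,2) d] distrib_left)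
qed

lemma has_weak_deriv_cmult:
  assumes "has_weak_deriv a b j u g"
  shows "has_weak_deriv a b j (\<lambda>t. c * u t) (\<lambda>t. c * g t)"
  using assms unfolding has_weak_deriv_def dist_eq_def dist_deriv_funpow
  by (simp add: regular_dist_cmult)

lemma sobolev_fun_L2: "u \<in> sobolev_fun a b s \<Longrightarrow> u \<in> L2 a b"
  by (simp add: sobolev_fun_def)

lemma sobolev_fun_add:
  assumes ab: "a < b" and u: "u \<in> sobolev_fun a b s" and v: "v \<in> sobolev_fun a b s"
  shows "(\<lambda>t. u t + v t) \<in> sobolev_fun a b s"
proof -
  have "\<exists>g\<in>L2 a b. has_weak_deriv a b j (\<lambda>t. u t + v t) g \<and>
      (j = nat \<lfloor>s\<rfloor> \<and> frac s > 0 \<longrightarrow> finite_gagliardo a b (frac s) g)" if j: "j \<le> nat \<lfloor>s\<rfloor>" for j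
  proof -
    obtain g where g: "g \<in> L2 a b" "has_weak_deriv a b j u g"
      "j = nat \<lfloor>s\<rfloor> \<and> frac s > 0 \<longrightarrow> finite_gagliardo a b (frac s) g"
      using u j by (auto simp: sobolev_fun_def)
    obtain h where h: "h \<in> L2 a b" "has_weak_deriv a b j v h"
      "j = nat \<lfloor>s\<rfloor> \<and> frac s > 0 \<longrightarrow> finite_gagliardo a b (frac s) h"
      using v j by (auto simp: sobolev_fun_def)
    have "has_weak_deriv a b j (\<lambda>t. u t + v t) (\<lambda>t. g t + h t)"
      by (rule has_weak_deriv_add[OF ab sobolev_fun_L2[OF u] sobolev_fun_L2[OF v] g(1) h(1) g(2) h(2)])
    moreover have "j = nat \<lfloor>s\<rfloor> \<and> frac s > 0 \<longrightarrow> finite_gagliardo a b (frac s) (\<lambda>t. g t + h t)"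
      using finite_gagliardo_add[OF g(1) h(1)] g(3) h(3) by simp
    ultimately show ?thesis using L2_add[OF g(1) h(1)] by blast
  qed
  then show ?thesis
    using L2_add[OF sobolev_fun_L2[OF u] sobolev_fun_L2[OF v]] unfolding sobolev_fun_def by blast
qed

lemma sobolev_fun_cmult:
  assumes u: "u \<in> sobolev_fun a b s"
  shows "(\<lambda>t. c * u t) \<in> sobolev_fun a b s"
proof -
  have "\<exists>g\<in>L2 a b. has_weak_deriv a b j (\<lambda>t. c * u t) g \<and>
      (j = nat \<lfloor>s\<rfloor> \<and> frac s > 0 \<longrightarrow> finite_gagliardo a b (frac s) g)" if j: "j \<le> nat \<lfloor>s\<rfloor>" for j
  proof -
    obtain g where g: "g \<in> L2 a b" "has_weak_deriv a b j u g"
      "j = nat \<lfloor>s\<rfloor> \<and> frac s > 0 \<longrightarrow> finite_gagliardo a b (frac s) g"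
      using u j by (auto simp: sobolev_fun_def)
    have "j = nat \<lfloor>s\<rfloor> \<and> frac s > 0 \<longrightarrow> finite_gagliardo a b (frac s) (\<lambda>t. c * g t)"
      using finite_gagliardo_cmult g(3) by simp
    then show ?thesis using L2_cmult[OF g(1)] has_weak_deriv_cmult[OF g(2)] by blast
  qed
  then show ?thesis
    using L2_cmult[OF sobolev_fun_L2[OF u]] unfolding sobolev_fun_def by blast
qed

lemma sobolev_fun_diff:
  assumes "a < b" "u \<in> sobolev_fun a b s" "v \<in> sobolev_fun a b s"
  shows "(\<lambda>t. u t - v t) \<in> sobolev_fun a b s"
  using sobolev_fun_add[OF assms(1,2) sobolev_fun_cmult[OF assms(3), of "-1"]] by simp

lemma nat_floor_Suc: "0 \<le> s \<Longrightarrow> nat \<lfloor>s + 1\<rfloor> = Suc (nat \<lfloor>s\<rfloor>)" for s :: real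
  by (simp add: nat_add_distrib)

text \<open>Passing from \<open>g\<close> to \<open>u\<close> raises the integer part of the order
  by one and keeps the fractional part. Together with the converse
  \<open>sobolev_fun_weak_deriv\<close> this reduces questions about order \<open>s\<close> to
  orders between 0 and 1.\<close>

lemma sobolev_fun_of_weak_deriv:
  assumes ab: "a < b" and s: "0 \<le> s" and u: "u \<in> L2 a b"
    and g: "g \<in> sobolev_fun a b s" and w: "has_weak_deriv a b 1 u g"
  shows "u \<in> sobolev_fun a b (s + 1)"
proof -
  have "\<exists>h\<in>L2 a b. has_weak_deriv a b j u h \<and>
      (j = nat \<lfloor>s + 1\<rfloor> \<and> frac (s + 1) > 0 \<longrightarrow> finite_gagliardo a b (frac (s + 1)) h)"
    if j: "j \<le> nat \<lfloor>s + 1\<rfloor>" for j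
  proof (cases j)
    case 0
    then show ?thesis using u has_weak_deriv_0 nat_floor_Suc[OF s] by auto
  next
    case (Suc i)
    then have "i \<le> nat \<lfloor>s\<rfloor>" using j nat_floor_Suc[OF s] by simp
    then obtain h where h: "h \<in> L2 a b" "has_weak_deriv a b i g h"
      "i = nat \<lfloor>s\<rfloor> \<and> frac s > 0 \<longrightarrow> finite_gagliardo a b (frac s) h"
      using g by (auto simp: sobolev_fun_def)
    then have "has_weak_deriv a b j u h" using has_weak_deriv_Suc[OF ab w] Suc by simp
    moreover have "j = nat \<lfloor>s + 1\<rfloor> \<and> frac (s + 1) > 0 \<longrightarrow> finite_gagliardo a b (frac (s + 1)) h"
      using h(3) Suc nat_floor_Suc[OF s] by (simp add: frac_1_eq)
    ultimately show ?thesis using h(1) by blast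
  qed
  then show ?thesis using u unfolding sobolev_fun_def by blast
qed

lemma sobolev_fun_weak_deriv:
  assumes ab: "a < b" and s: "0 \<le> s" and u: "u \<in> sobolev_fun a b (s + 1)"
  obtains g where "g \<in> sobolev_fun a b s" "has_weak_deriv a b 1 u g"
proof -
  have U: "\<exists>h\<in>L2 a b. has_weak_deriv a b j u h \<and>
      (j = nat \<lfloor>s + 1\<rfloor> \<and> frac (s + 1) > 0 \<longrightarrow> finite_gagliardo a b (frac (s + 1)) h)"
    if "j \<le> nat \<lfloor>s + 1\<rfloor>" for j
    using u that unfolding sobolev_fun_def by blast
  obtain g where g: "g \<in> L2 a b" "has_weak_deriv a b 1 u g"
    using U[of 1] nat_floor_Suc[OF s] by auto
  have "\<exists>h\<in>L2 a b. has_weak_deriv a b i g h \<and>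
      (i = nat \<lfloor>s\<rfloor> \<and> frac s > 0 \<longrightarrow> finite_gagliardo a b (frac s) h)"
    if i: "i \<le> nat \<lfloor>s\<rfloor>" for i
  proof -
    obtain h where h: "h \<in> L2 a b" "has_weak_deriv a b (Suc i) u h"
      "Suc i = nat \<lfloor>s + 1\<rfloor> \<and> frac (s + 1) > 0 \<longrightarrow> finite_gagliardo a b (frac (s + 1)) h"
      using U[of "Suc i"] i nat_floor_Suc[OF s] by auto
    have "has_weak_deriv a b i g h" using h(2) has_weak_deriv_Suc[OF ab g(2)] by simp
    moreover have "i = nat \<lfloor>s\<rfloor> \<and> frac s > 0 \<longrightarrow> finite_gagliardo a b (frac s) h"
      using h(3) nat_floor_Suc[OF s] by (simp add: frac_1_eq)
    ultimately show ?thesis using h(1) by blast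
  qed
  then have "g \<in> sobolev_fun a b s" using g(1) unfolding sobolev_fun_def by blast
  then show ?thesis using g(2) that by blast
qed

text \<open>Start of the order inductions: almost everywhere \<open>u\<close> is a primitive of an
  L^2 function, and such primitives have finite seminorm of every order in
  \<open>[0, 1)\<close>.\<close>

lemma sobolev_fun_fractional:
  assumes ab: "a < b" and s: "0 \<le> s" "s < 1" and u: "u \<in> L2 a b" and g: "g \<in> L2 a b"
    and w: "has_weak_deriv a b 1 u g"
  shows "u \<in> sobolev_fun a b s"
proof -
  obtain C where C: "AE t in lebesgue. t \<in> {a<..<b} \<longrightarrow> u t = C + integral {a..t} g"
    using weak_deriv_imp_primitive[OF ab u g w] by blast
  have "finite_gagliardo a b s (\<lambda>t. C + integral {a..t} g)"
    by (rule finite_gagliardo_primitive[OF ab g _ s, of _ C]) simp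
  then have "finite_gagliardo a b s u"
    using C by (elim finite_gagliardo_cong_AE[rotated]) auto
  moreover have "frac s = s" "\<lfloor>s\<rfloor> = 0" using s by (auto simp: frac_eq floor_eq_iff)
  ultimately show ?thesis using u has_weak_deriv_0 by (auto simp: sobolev_fun_def)
qed

text \<open>Not immediate from the definition, which controls the seminorm of the top derivative
  only. Below order 1 it is the embedding of H^1; above, one derivative is stripped and
  restored.\<close>

lemma sobolev_fun_mono_1:
  assumes ab: "a < b" and s: "0 \<le> s" and u: "u \<in> sobolev_fun a b (s + 1)"
  shows "u \<in> sobolev_fun a b s"
  using s u
proof (induction "nat \<lfloor>s\<rfloor>" arbitrary: s u)
  case 0
  obtain g where g: "g \<in> sobolev_fun a b s" "has_weak_deriv a b 1 u g"
    using sobolev_fun_weak_deriv[OF ab 0(2,3)] by blast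
  have "s < 1" using 0 by linarith
  then show ?case
    by (rule sobolev_fun_fractional[OF ab 0(2) _ sobolev_fun_L2[OF 0(3)] sobolev_fun_L2[OF g(1)] g(2)])
next
  case (Suc n)
  obtain g where g: "g \<in> sobolev_fun a b s" "has_weak_deriv a b 1 u g"
    using sobolev_fun_weak_deriv[OF ab Suc(3,4)] by blast
  have s1: "0 \<le> s - 1" "n = nat \<lfloor>s - 1\<rfloor>" using Suc(2) by linarith+
  have "g \<in> sobolev_fun a b (s - 1 + 1)" using g by simp
  then have "g \<in> sobolev_fun a b (s - 1)" using Suc(1) s1 by blast
  then have "u \<in> sobolev_fun a b (s - 1 + 1)"
    by (rule sobolev_fun_of_weak_deriv[OF ab s1(1) sobolev_fun_L2[OF Suc(4)] _ g(2)])
  then show ?case by simp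
qed

section \<open>Classically differentiable functions\<close>

lemma Cm_continuous:
  assumes "v \<in> Cm a b m"
  shows "continuous_on {a..b} v"
proof -
  obtain g where "\<forall>t\<in>{a..b}. g 0 t = v t" "continuous_on {a..b} (g 0)"
    using assms by (auto simp: Cm_def)
  then show ?thesis by (metis continuous_on_cong)
qed

lemma Cm_Suc:
  assumes "v \<in> Cm a b (Suc m)"
  obtains w where "w \<in> Cm a b m" "\<And>t. t \<in> {a..b} \<Longrightarrow> v t = v a + integral {a..t} w"
proof -
  obtain g where g: "\<forall>t\<in>{a..b}. g 0 t = v t"
    "\<forall>j<Suc m. \<forall>t\<in>{a..b}. (g j has_real_derivative g (Suc j) t) (at t within {a..b})"
    "\<forall>j\<le>Suc m. continuous_on {a..b} (g j)"
    using assms by (auto simp: Cm_def)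
  have "g 1 \<in> Cm a b m"
    unfolding Cm_def using g(2,3) by (intro CollectI exI[of _ "\<lambda>j. g (Suc j)"]) auto
  moreover have "v t = v a + integral {a..t} (g 1)" if t: "t \<in> {a..b}" for t
  proof -
    have "(g 1 has_integral (g 0 t - g 0 a)) {a..t}"
    proof (rule fundamental_theorem_of_calculus)
      show "a \<le> t" using t by simp
      fix r assume r: "r \<in> {a..t}"
      then have "(g 0 has_real_derivative g 1 r) (at r within {a..b})" using g(2) t by simp
      then show "(g 0 has_vector_derivative g 1 r) (at r within {a..t})"
        unfolding has_real_derivative_iff_has_vector_derivative
        by (rule has_vector_derivative_within_subset) (use t in auto)
    qed
    then show ?thesis using g(1) t by (simp add: integral_unique)
  qed
  ultimately show ?thesis using that by blast
qed

text \<open>The rounding up in \<open>Cr\<close> is what makes this work: for non-integral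
  \<open>s\<close> it grants one continuous derivative beyond \<open>\<lfloor>s\<rfloor>\<close>,
  and an L^2 derivative makes the fractional seminorm finite.\<close>

lemma Cr_subset_sobolev_fun:
  assumes ab: "a < b" and s: "0 \<le> s" and v: "v \<in> Cr a b s"
  shows "v \<in> sobolev_fun a b s"
  using s v
proof (induction "nat \<lfloor>s\<rfloor>" arbitrary: s v)
  case 0
  have s1: "s < 1" using 0 by linarith
  have vc: "continuous_on {a..b} v" using 0(3) Cm_continuous unfolding Cr_def by blast
  show ?case
  proof (cases "s = 0")
    case True
    then show ?thesis using L2_continuous[OF vc] sobolev_fun_0 by simp
  next
    case False
    then have "nat \<lceil>s\<rceil> = Suc 0" using 0 s1 by (simp add: nat_eq_iff ceiling_eq_iff)
    then have "v \<in> Cm a b (Suc 0)" using 0(3) by (simp add: Cr_def)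
    then obtain w where w: "w \<in> Cm a b 0" "\<And>t. t \<in> {a..b} \<Longrightarrow> v t = v a + integral {a..t} w"
      using Cm_Suc by blast
    have "w \<in> L2 a b" using L2_continuous[OF Cm_continuous[OF w(1)]] .
    then show ?thesis
      using sobolev_fun_fractional[OF ab 0(2) s1 L2_continuous[OF vc]]
        primitive_has_weak_deriv[OF ab _ w(2)] by blast
  qed
next
  case (Suc n)
  have vc: "continuous_on {a..b} v" using Suc(4) Cm_continuous unfolding Cr_def by blast
  have s1: "0 \<le> s - 1" "n = nat \<lfloor>s - 1\<rfloor>" using Suc(2) by linarith+
  have "nat \<lceil>s\<rceil> = Suc (nat \<lceil>s - 1\<rceil>)" using s1 by linarith
  then have "v \<in> Cm a b (Suc (nat \<lceil>s - 1\<rceil>))" using Suc(4) by (simp add: Cr_def)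
  then obtain w where w: "w \<in> Cm a b (nat \<lceil>s - 1\<rceil>)" "\<And>t. t \<in> {a..b} \<Longrightarrow> v t = v a + integral {a..t} w"
    using Cm_Suc by blast
  have "w \<in> sobolev_fun a b (s - 1)" using Suc(1)[OF s1(2,1)] w(1) by (simp add: Cr_def)
  moreover have "has_weak_deriv a b 1 v w"
    by (rule primitive_has_weak_deriv[OF ab L2_continuous[OF Cm_continuous[OF w(1)]] w(2)])
  ultimately have "v \<in> sobolev_fun a b (s - 1 + 1)"
    using sobolev_fun_of_weak_deriv[OF ab s1(1) L2_continuous[OF vc]] by blast
  then show ?case by simp
qed

lemma Cr_subset_H1:
  assumes ab: "a < b" and s: "1 \<le> s" and v: "v \<in> Cr a b s"
  shows "v \<in> H1 a b"
proof -
  have "nat \<lceil>s\<rceil> = Suc (nat \<lceil>s - 1\<rceil>)" using s by linarith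
  then have "v \<in> Cm a b (Suc (nat \<lceil>s - 1\<rceil>))" using v by (simp add: Cr_def)
  then obtain w where w: "w \<in> Cm a b (nat \<lceil>s - 1\<rceil>)" "\<And>t. t \<in> {a..b} \<Longrightarrow> v t = v a + integral {a..t} w"
    using Cm_Suc by blast
  have "w \<in> L2 a b" using L2_continuous[OF Cm_continuous[OF w(1)]] .
  then show ?thesis using w(2) unfolding H1_iff[OF ab] by blast
qed

text \<open>Affine functions realise arbitrary boundary values within every class
  \<open>Cr\<close>.\<close>

lemma affine_in_Cr: "(\<lambda>t. p + m * t) \<in> Cr a b s"
proof -
  let ?g = "\<lambda>j::nat. \<lambda>t. if j = 0 then p + m * t else if j = 1 then m else 0"
  have "(?g j has_real_derivative ?g (Suc j) t) (at t within {a..b})" for j t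
    by (cases "j = 0"; cases "j = 1") (auto intro!: derivative_eq_intros)
  moreover have "continuous_on {a..b} (?g j)" for j
    by (cases "j = 0"; cases "j = 1") (auto intro!: continuous_intros)
  ultimately show ?thesis unfolding Cr_def Cm_def by (intro CollectI exI[of _ ?g]) auto
qed

section \<open>Convergence of averages\<close>

text \<open>The difference of the two averages is the mean of \<open>F x - F y\<close> over the box
  \<open>(0, t) \<times> (0, s)\<close>, on which \<open>|x - y| \<le> t\<close>. Passing to the
  Gagliardo quotient therefore costs a factor \<open>t powr (1 + 2 \<sigma>)\<close>, while
  \<open>t \<le> 2 s\<close> keeps the area of the box comparable to \<open>t^2\<close>.\<close>

lemma finite_gagliardo_average_diff:
  assumes F: "F \<in> L2 0 d" and \<sigma>: "0 \<le> \<sigma>" and gag: "finite_gagliardo 0 d \<sigma> F"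
  obtains B where "0 \<le> B" "\<And>s t. 0 < s \<Longrightarrow> s \<le> t \<Longrightarrow> t \<le> d \<Longrightarrow> t \<le> 2 * s \<Longrightarrow>
    \<bar>integral {0..t} F / t - integral {0..s} F / s\<bar> \<le> B * t powr (\<sigma> - 1/2)"
proof -
  let ?J = "\<lambda>t. integral {0..t} F"
  obtain G N where G: "G \<in> borel_measurable borel" "integrable lborel G" "negligible N"
    "\<And>x. x \<notin> N \<Longrightarrow> G x = (if x \<in> {0..d} then F x else 0)"
    using borel_representative[OF L2_absolutely_integrable[OF F]] by blast
  note [measurable] = G(1)
  let ?M = "lborel \<Otimes>\<^sub>M lborel :: (real \<times> real) measure"
  let ?D = "{0<..<d} \<times> {0<..<d}"
  have "AE x in lebesgue. x \<in> {0<..<d} \<longrightarrow> F x = G x"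
    unfolding AE_lebesgue_iff_negligible using G(3,4) by (intro exI[of _ N]) simp
  then have gagG: "finite_gagliardo 0 d \<sigma> G" using gag by (rule finite_gagliardo_cong_AE)
  define q where "q z = indicator ?D z *\<^sub>R gagliardo_quot \<sigma> G z" for z
  have D: "?D \<in> sets borel" by (intro borel_open open_Times open_greaterThanLessThan)
  have qm: "q \<in> borel_measurable borel"
    unfolding q_def by (rule borel_measurable_scaleR[OF borel_measurable_indicator[OF D]
        borel_measurable_gagliardo_quot[OF G(1)]])
  have "integrable lebesgue q"
    using gagG unfolding finite_gagliardo_iff set_integrable_def q_def .
  then have "integrable lborel q" using qm integrable_completion[of q lborel] by simp
  then have qi: "integrable ?M q" by (simp add: lborel_prod)
  have q0: "0 \<le> q z" for z
    unfolding q_def using gagliardo_quot_nonneg by (simp add: indicator_def)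
  define Q where "Q = integral\<^sup>L ?M q"
  have Q0: "0 \<le> Q" unfolding Q_def by (rule integral_nonneg_AE) (simp add: q0)
  have Gint: "(LINT x|lborel. indicator {0<..<t} x * G x) = ?J t" if t: "0 < t" "t \<le> d" for t
  proof -
    have i: "integrable lborel (\<lambda>x. indicator {0<..<t} x * G x)"
      using integrable_mult_indicator[OF _ G(2), of "{0<..<t}"] by simp
    have "(LINT x|lborel. indicator {0<..<t} x * G x) = integral UNIV (\<lambda>x. indicator {0<..<t} x * G x)"
      by (rule integral_lborel[OF i, symmetric])
    also have "\<dots> = integral UNIV (\<lambda>x. if x \<in> {0..t} then F x else 0)"
      by (rule integral_spike[of "N \<union> {0, t}"])
         (use G(3,4) t in \<open>auto simp: negligible_Un indicator_def\<close>)
    also have "\<dots> = ?J t" by (rule integral_restrict_UNIV)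
    finally show ?thesis .
  qed
  show ?thesis
  proof (rule that[of "Q + 1/2"])
    fix s t :: real assume st: "0 < s" "s \<le> t" "t \<le> d" "t \<le> 2 * s"
    let ?E = "{0<..<t} \<times> {0<..<s}" and ?P = "t powr (1 + 2 * \<sigma>)"
    have t: "0 < t" using st by simp
    \<comment> \<open>Weight in the inequality \<open>e \<le> l/2 e^2 + 1/(2 l)\<close>, chosen so
      that after division by the area both terms scale like
      \<open>t powr (\<sigma> - 1/2)\<close>.\<close>
    define l where "l = t powr - (\<sigma> - 1/2)"
    have l: "0 < l" using t by (simp add: l_def)
    define u where "u z = indicator ?E z * (G (fst z) - G (snd z))" for z
    define j where "j z = (indicator ?E z :: real)" for z
    define W where "W z = (l / 2 * ?P) * q z + (1 / (2 * l)) * j z" for z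
    have box: "?E \<in> sets ?M" by measurable
    have um: "u \<in> borel_measurable ?M"
      unfolding u_def using box by measurable
    have jbox: "emeasure ?M ?E = ennreal (t * s)"
      using st t by (subst lborel.emeasure_pair_measure_Times) (auto simp: ennreal_mult)
    have ji: "integrable ?M j"
      unfolding j_def by (rule integrable_real_indicator[OF box]) (simp add: jbox)
    have jI: "integral\<^sup>L ?M j = t * s"
      unfolding j_def using jbox st t by (simp add: measure_def space_pair_measure)
    have Wi: "integrable ?M W"
      unfolding W_def using qi ji by (intro Bochner_Integration.integrable_add integrable_mult_right)
    have WI: "integral\<^sup>L ?M W = (l / 2 * ?P) * Q + (1 / (2 * l)) * (t * s)"
      unfolding W_def using qi ji by (simp add: Q_def jI)
    have bd: "\<bar>u z\<bar> \<le> W z" for z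
    proof (cases "z \<in> ?E")
      case True
      obtain x y where z: "z = (x, y)" by (cases z)
      have xy: "0 < x" "x < t" "0 < y" "y < s" using True z by auto
      have zD: "z \<in> ?D" using xy z st by auto
      let ?e = "\<bar>G x - G y\<bar>"
      have e2: "?e\<^sup>2 \<le> ?P * q z"
      proof (cases "x = y")
        case True
        then show ?thesis using q0[of z] by simp
      next
        case False
        have p: "0 < \<bar>x - y\<bar> powr (1 + 2 * \<sigma>)" using False by simp
        have "\<bar>x - y\<bar> powr (1 + 2 * \<sigma>) \<le> ?P"
          using xy st \<sigma> by (intro powr_mono2) auto
        moreover have "?e\<^sup>2 = \<bar>x - y\<bar> powr (1 + 2 * \<sigma>) * q z"
          using zD p by (simp add: q_def gagliardo_quot_def z)
        ultimately show ?thesis using q0[of z] by (simp add: mult_right_mono)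
      qed
      \<comment> \<open>Young's inequality, used pointwise in place of Cauchy-Schwarz on the
        box.\<close>
      have "0 \<le> (l * ?e - 1)\<^sup>2" by simp
      then have "2 * l * ?e \<le> l * (l * ?e\<^sup>2) + 1" by (simp add: power2_eq_square algebra_simps)
      also have "\<dots> \<le> l * (l * (?P * q z)) + 1"
        using e2 l by simp
      finally have "?e \<le> (l * (l * (?P * q z)) + 1) / (2 * l)"
        using l by (simp add: pos_le_divide_eq mult_ac)
      also have "\<dots> = W z" using True l by (simp add: W_def j_def field_simps)
      finally show ?thesis using True z by (simp add: u_def)
    next
      case False
      then show ?thesis using q0[of z] l by (simp add: u_def W_def j_def)
    qed
    have ui: "integrable ?M u"
      by (rule Bochner_Integration.integrable_bound[OF Wi um]) (use bd in \<open>auto intro!: AE_I2 order_trans[OF bd]\<close>)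
    have "\<bar>integral\<^sup>L ?M u\<bar> \<le> integral\<^sup>L ?M (\<lambda>z. \<bar>u z\<bar>)"
      by (rule integral_abs_bound)
    also have "\<dots> \<le> integral\<^sup>L ?M W"
      by (rule integral_mono[OF integrable_abs[OF ui] Wi bd])
    finally have "\<bar>integral\<^sup>L ?M u\<bar> \<le> integral\<^sup>L ?M W" .
    moreover have "integral\<^sup>L ?M u = s * ?J t - t * ?J s"
    proof -
      have Gi: "integrable lborel (\<lambda>x. indicator {0<..<r} x * G x)" for r
        using integrable_mult_indicator[OF _ G(2), of "{0<..<r}"] by simp
      have ii: "integrable lborel (\<lambda>x. indicator {0<..<r} x :: real)" for r :: real
        by (intro integrable_real_indicator emeasure_bounded_finite) auto
      have iI: "(LINT x|lborel. (indicator {0<..<r} x :: real)) = r" if "0 < r" for r :: real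
        using that by simp
      have "integral\<^sup>L ?M u = (LINT x|lborel. LINT y|lborel. u (x, y))"
        by (rule lborel_pair.integral_fst'[OF ui, symmetric])
      also have "\<dots> = (LINT x|lborel. s * (indicator {0<..<t} x * G x) - ?J s * indicator {0<..<t} x)"
      proof (rule Bochner_Integration.integral_cong[OF refl])
        fix x :: real
        have "(LINT y|lborel. u (x, y)) = (LINT y|lborel. (indicator {0<..<t} x * G x) * indicator {0<..<s} y
            - indicator {0<..<t} x * (indicator {0<..<s} y * G y))"
          by (rule Bochner_Integration.integral_cong[OF refl]) (simp add: u_def indicator_times algebra_simps)
        also have "\<dots> = (indicator {0<..<t} x * G x) * s - indicator {0<..<t} x * ?J s"
          using Gint[of s] st iI[of s]
          by (subst Bochner_Integration.integral_diff) (auto intro!: integrable_mult_right ii Gi)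
        finally show "(LINT y|lborel. u (x, y)) = s * (indicator {0<..<t} x * G x) - ?J s * indicator {0<..<t} x"
          by (simp add: mult_ac)
      qed
      also have "\<dots> = s * ?J t - ?J s * t"
        using Gint[of t] st t iI[of t]
        by (subst Bochner_Integration.integral_diff) (auto intro!: integrable_mult_right ii Gi)
      finally show ?thesis by (simp add: mult.commute)
    qed
    ultimately have main: "\<bar>s * ?J t - t * ?J s\<bar> \<le>
        (l / 2 * ?P) * Q + (1 / (2 * l)) * (t * s)"
      by (simp add: WI)
    have "\<bar>?J t / t - ?J s / s\<bar> = \<bar>s * ?J t - t * ?J s\<bar> / (t * s)"
    proof -
      have "?J t / t - ?J s / s = (s * ?J t - t * ?J s) / (t * s)"
        using st t by (simp add: field_simps)
      then show ?thesis using st t by (simp add: abs_mult)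
    qed
    also have "\<dots> \<le> ((l / 2 * ?P) * Q + (1 / (2 * l)) * (t * s)) / (t * s)"
      using main st t by (intro divide_right_mono) auto
    also have "\<dots> = l / 2 * ?P * Q / (t * s) + 1 / (2 * l)"
      using st t by (simp add: add_divide_distrib)
    \<comment> \<open>Here \<open>t / 2 \<le> s\<close> enters.\<close>
    also have "l / 2 * ?P * Q / (t * s) \<le> l / 2 * ?P * Q / (t * (t / 2))"
      using st t l Q0 by (intro divide_left_mono mult_nonneg_nonneg mult_left_mono) auto
    also have "l / 2 * ?P * Q / (t * (t / 2)) = t powr (\<sigma> - 1/2) * Q"
    proof -
      have "l * ?P = t powr (\<sigma> - 1/2 + 2)"
        unfolding l_def by (simp flip: powr_add)
      also have "\<dots> = t powr (\<sigma> - 1/2) * (t * t)"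
      proof -
        have "t powr 2 = t * t" using t by (simp add: power2_eq_square)
        then show ?thesis using powr_add[of t "\<sigma> - 1/2" 2] by simp
      qed
      finally have "l * ?P = t powr (\<sigma> - 1/2) * (t * t)" .
      then show ?thesis using t by (simp add: field_simps)
    qed
    also have "1 / (2 * l) = 1/2 * t powr (\<sigma> - 1/2)"
      unfolding l_def by (simp add: powr_minus field_simps)
    finally show "\<bar>?J t / t - ?J s / s\<bar> \<le> (Q + 1/2) * t powr (\<sigma> - 1/2)"
      by (simp add: algebra_simps)
  qed (use Q0 in simp)
qed

text \<open>Halving \<open>t\<close> until it comes within a factor 2 of \<open>s\<close> sums a
  geometric series of ratio \<open>\<theta>\<close>, the factor by which
  \<open>t powr \<gamma>\<close> shrinks in one halving. Hence \<open>A\<close> is Cauchy at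
  0.\<close>

lemma tendsto_of_dyadic_bound:
  fixes A :: "real \<Rightarrow> real"
  assumes d: "0 < d" and \<gamma>: "0 < \<gamma>" and B: "0 \<le> B"
    and A: "\<And>s t. 0 < s \<Longrightarrow> s \<le> t \<Longrightarrow> t \<le> d \<Longrightarrow> t \<le> 2 * s \<Longrightarrow> \<bar>A t - A s\<bar> \<le> B * t powr \<gamma>"
  obtains L where "(A \<longlongrightarrow> L) (at_right 0)"
proof -
  define \<theta> where "\<theta> = (1/2::real) powr \<gamma>"
  have \<theta>: "0 < \<theta>" "\<theta> < 1" using powr_less_mono2[OF \<gamma>, of "1/2" 1] by (auto simp: \<theta>_def)
  \<comment> \<open>The sum of that series. The identity \<open>B + D * \<theta> = D\<close> is the
    induction step: one halving costs \<open>B\<close>, and the rest costs \<open>D\<close> at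
    \<open>t / 2\<close>.\<close>
  define D where "D = B / (1 - \<theta>)"
  have D: "B + D * \<theta> = D" "B \<le> D" "0 \<le> D"
    using \<theta> B by (auto simp: D_def field_simps)
  have chain: "\<bar>A t - A s\<bar> \<le> D * t powr \<gamma>" if "0 < s" "s \<le> t" "t \<le> d" "t \<le> 2 ^ n * s" for n s t
    using that
  proof (induction n arbitrary: t)
    case 0
    then show ?case using D by simp
  next
    case (Suc n)
    show ?case
    proof (cases "t \<le> 2 * s")
      case True
      have "\<bar>A t - A s\<bar> \<le> B * t powr \<gamma>" using A Suc True by simp
      also have "\<dots> \<le> D * t powr \<gamma>" using D by (intro mult_right_mono) auto
      finally show ?thesis .
    next
      case False
      have 1: "\<bar>A t - A (t / 2)\<bar> \<le> B * t powr \<gamma>" using A[of "t / 2" t] Suc by simp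
      have 2: "\<bar>A (t / 2) - A s\<bar> \<le> D * (t / 2) powr \<gamma>" using Suc False by (intro Suc.IH) auto
      have "(t / 2) powr \<gamma> = \<theta> * t powr \<gamma>"
        using Suc.prems powr_mult[of "1/2" t \<gamma>] by (simp add: \<theta>_def)
      then have "\<bar>A t - A s\<bar> \<le> B * t powr \<gamma> + D * \<theta> * t powr \<gamma>" using 1 2 by simp
      also have "\<dots> = (B + D * \<theta>) * t powr \<gamma>" by (simp add: algebra_simps)
      finally show ?thesis using D(1) by simp
    qed
  qed
  have bound: "\<bar>A t - A s\<bar> \<le> D * t powr \<gamma>" if "0 < s" "s \<le> t" "t \<le> d" for s t
  proof -
    obtain n where "t / s < 2 ^ n" using real_arch_pow[of 2 "t / s"] by auto
    then have "t \<le> 2 ^ n * s" using that by (simp add: pos_divide_less_eq)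
    then show ?thesis using chain that by blast
  qed
  have small: "((\<lambda>t. D * t powr \<gamma>) \<longlongrightarrow> 0) (at_right 0)"
  proof -
    have "((\<lambda>t. t powr \<gamma>) \<longlongrightarrow> 0 powr \<gamma>) (at_right 0)"
      using \<gamma> by (intro tendsto_powr' tendsto_ident_at tendsto_const) (auto simp: eventually_at_filter)
    then have "((\<lambda>t. D * t powr \<gamma>) \<longlongrightarrow> D * 0 powr \<gamma>) (at_right 0)" by (intro tendsto_mult tendsto_const)
    then show ?thesis by simp
  qed
  \<comment> \<open>A sequence to produce the limit; the uniform bound then transfers it to the full
    one-sided limit.\<close>
  define X where "X n = A (d / real (Suc n))" for n
  have pos: "0 < d / real (Suc n)" "d / real (Suc n) \<le> d" for n
    using d by (auto simp: field_simps)
  have lim0: "filterlim (\<lambda>n. d / real (Suc n)) (at_right 0) sequentially"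
  proof -
    have "(\<lambda>n. d / real (Suc n)) \<longlonglongrightarrow> 0" using LIMSEQ_Suc[OF lim_const_over_n[of d]] by simp
    then show ?thesis using pos by (auto simp: filterlim_at eventually_sequentially intro!: exI[of _ 0])
  qed
  have XD: "(\<lambda>n. D * (d / real (Suc n)) powr \<gamma>) \<longlonglongrightarrow> 0"
    by (rule filterlim_compose[OF small lim0])
  have "Cauchy X"
  proof (rule metric_CauchyI)
    fix e :: real assume "0 < e"
    then have "\<forall>\<^sub>F n in sequentially. D * (d / real (Suc n)) powr \<gamma> < e" using XD by (intro order_tendstoD)
    then obtain n0 where n0: "\<And>n. n \<ge> n0 \<Longrightarrow> D * (d / real (Suc n)) powr \<gamma> < e"
      by (auto simp: eventually_sequentially)
    have *: "\<bar>X m - X n\<bar> < e" if "n0 \<le> m" "m \<le> n" for m n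
    proof -
      have "d / real (Suc n) \<le> d / real (Suc m)" using that d by (intro divide_left_mono) auto
      then have "\<bar>X m - X n\<bar> \<le> D * (d / real (Suc m)) powr \<gamma>"
        unfolding X_def by (intro bound pos)
      also have "\<dots> < e" using n0 that by simp
      finally show ?thesis .
    qed
    have "dist (X m) (X n) < e" if "n0 \<le> m" "n0 \<le> n" for m n
      using *[of m n] *[of n m] that by (cases "m \<le> n") (auto simp: dist_real_def abs_minus_commute)
    then show "\<exists>M. \<forall>m\<ge>M. \<forall>n\<ge>M. dist (X m) (X n) < e" by blast
  qed
  then obtain L where L: "X \<longlonglongrightarrow> L" using Cauchy_convergent convergentD by blast
  have AL: "\<bar>A t - L\<bar> \<le> D * t powr \<gamma>" if t: "0 < t" "t \<le> d" for t
  proof (rule tendsto_upperbound)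
    show "(\<lambda>n. \<bar>A t - X n\<bar>) \<longlonglongrightarrow> \<bar>A t - L\<bar>" by (intro tendsto_intros L)
    have "(\<lambda>n. d / real (Suc n)) \<longlonglongrightarrow> 0" using LIMSEQ_Suc[OF lim_const_over_n[of d]] by simp
    then have "\<forall>\<^sub>F n in sequentially. d / real (Suc n) < t" using t by (intro order_tendstoD)
    then show "\<forall>\<^sub>F n in sequentially. \<bar>A t - X n\<bar> \<le> D * t powr \<gamma>"
      by eventually_elim (use t pos in \<open>auto simp: X_def intro!: bound\<close>)
  qed simp
  have "((\<lambda>t. A t - L) \<longlongrightarrow> 0) (at_right 0)"
  proof (rule Lim_null_comparison[OF _ small])
    have "\<forall>\<^sub>F t in at_right 0. t \<in> {0<..<d}" using d by (rule eventually_at_right_real)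
    then show "\<forall>\<^sub>F t in at_right 0. norm (A t - L) \<le> D * t powr \<gamma>"
      by eventually_elim (use AL in auto)
  qed
  then have "(A \<longlongrightarrow> L) (at_right 0)" by (rule LIM_zero_cancel)
  then show ?thesis by (rule that)
qed

text \<open>The gap \<open>\<sigma> - 1/2\<close> becomes the exponent \<open>\<gamma>\<close> of
  the dyadic bound, which has to be positive.\<close>

lemma finite_gagliardo_average_tendsto:
  assumes d: "0 < d" and F: "F \<in> L2 0 d" and \<sigma>: "1/2 < \<sigma>" and gag: "finite_gagliardo 0 d \<sigma> F"
  obtains L where "((\<lambda>t. integral {0..t} F / t) \<longlongrightarrow> L) (at_right 0)"
proof -
  have "0 \<le> \<sigma>" using \<sigma> by simp
  obtain B where "0 \<le> B" "\<And>s t. 0 < s \<Longrightarrow> s \<le> t \<Longrightarrow> t \<le> d \<Longrightarrow> t \<le> 2 * s \<Longrightarrow>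
    \<bar>integral {0..t} F / t - integral {0..s} F / s\<bar> \<le> B * t powr (\<sigma> - 1/2)"
    using finite_gagliardo_average_diff[OF F \<open>0 \<le> \<sigma>\<close> gag] by blast
  note B = this
  show ?thesis
  proof (rule tendsto_of_dyadic_bound[OF d])
    show "0 < \<sigma> - 1/2" using \<sigma> by simp
    show "0 \<le> B" by (rule B(1))
    show "\<bar>integral {0..t} F / t - integral {0..s} F / s\<bar> \<le> B * t powr (\<sigma> - 1/2)"
      if "0 < s" "s \<le> t" "t \<le> d" "t \<le> 2 * s" for s t
      by (rule B(2)[OF that])
  qed (rule that)
qed

section \<open>The weak form as an equation between distributions\<close>

text \<open>The left-hand side of the equation with all derivatives moved to the test function,
  whence the minus sign of the damping term.\<close>

definition osc_dist :: "real \<Rightarrow> real \<Rightarrow> real \<Rightarrow> (real \<Rightarrow> real) \<Rightarrow> distribution" where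
  "osc_dist T c k x = (\<lambda>\<psi>. regular_dist 0 T x (deriv (deriv \<psi>)) - c * regular_dist 0 T x (deriv \<psi>)
     + k * regular_dist 0 T x \<psi>)"

lemma solves_ode_iff: "solves_ode T c k f x \<longleftrightarrow> dist_eq 0 T (osc_dist T c k x) f"
  by (simp add: solves_ode_def osc_dist_def dist_deriv_def Let_def)

lemma osc_dist_add:
  assumes "0 < T" "u \<in> L2 0 T" "v \<in> L2 0 T" "\<psi> \<in> test_functions 0 T"
  shows "osc_dist T c k (\<lambda>t. u t + v t) \<psi> = osc_dist T c k u \<psi> + osc_dist T c k v \<psi>"
  using assms by (simp add: osc_dist_def regular_dist_add test_function_deriv algebra_simps)

lemma smooth_exp_mult: "smooth (\<lambda>t. exp (c * t))"
  by (intro smooth_exp smooth_mult smooth_const smooth_ident)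

lemma deriv_exp_mult:
  assumes "smooth \<phi>"
  shows "deriv (\<lambda>t. exp (c * t) * \<phi> t) = (\<lambda>t. exp (c * t) * deriv \<phi> t + c * (exp (c * t) * \<phi> t))"
proof
  fix t
  show "deriv (\<lambda>t. exp (c * t) * \<phi> t) t = exp (c * t) * deriv \<phi> t + c * (exp (c * t) * \<phi> t)"
    by (rule DERIV_imp_deriv) (auto intro!: derivative_eq_intros smooth_DERIV[OF assms])
qed

lemma regular_dist_test_add:
  assumes "u \<in> L2 a b" "\<phi> \<in> test_functions a b" "\<psi> \<in> test_functions a b" "a < b"
  shows "regular_dist a b u (\<lambda>t. \<phi> t + c * \<psi> t) = regular_dist a b u \<phi> + c * regular_dist a b u \<psi>"
proof -
  have "(\<lambda>t. \<phi> t + c * \<psi> t) \<in> test_functions a b"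
    using assms by (intro test_function_add test_function_cmult)
  then have "regular_dist a b u (\<lambda>t. \<phi> t + c * \<psi> t) = integral {a..b} (\<lambda>t. u t * \<phi> t + c * (u t * \<psi> t))"
    using assms(1) by (simp add: regular_dist_test algebra_simps)
  also have "\<dots> = regular_dist a b u \<phi> + c * regular_dist a b u \<psi>"
    using integral_add[OF L2_mult_test_integrable[OF assms(1,2)]
        integrable_on_mult_right[OF L2_mult_test_integrable[OF assms(1,3)]]] assms
    by (simp add: regular_dist_test)
  finally show ?thesis .
qed

lemma regular_dist_mult: "regular_dist a b (\<lambda>t. w t * u t) \<phi> = regular_dist a b u (\<lambda>t. w t * \<phi> t)"
  by (simp add: regular_dist_def mult_ac)

lemma weighted_inner_eq: "weighted_inner T c u \<phi> = regular_dist 0 T u (\<lambda>t. exp (c * t) * \<phi> t)"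
  by (simp add: weighted_inner_def regular_dist_def mult_ac)

lemma H1_L2: "u \<in> H1 a b \<Longrightarrow> u \<in> L2 a b"
  unfolding H1_def using sobolev_fun_L2 by blast

lemma H1_continuous: "u \<in> H1 a b \<Longrightarrow> continuous_on {a..b} u"
  by (simp add: H1_def)

lemma weak_deriv:
  assumes "u \<in> H1 a b"
  shows "weak_deriv a b u \<in> L2 a b" "has_weak_deriv a b 1 u (weak_deriv a b u)"
proof -
  have "\<exists>g. g \<in> L2 a b \<and> has_weak_deriv a b 1 u g"
    using assms unfolding H1_def sobolev_fun_1 by blast
  then have "weak_deriv a b u \<in> L2 a b \<and> has_weak_deriv a b 1 u (weak_deriv a b u)"
    unfolding weak_deriv_def by (rule someI_ex)
  then show "weak_deriv a b u \<in> L2 a b" "has_weak_deriv a b 1 u (weak_deriv a b u)" by auto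
qed

text \<open>With \<open>\<psi> = exp(c t) \<phi>\<close> one has
  \<open>exp(c t) \<phi>' = \<psi>' - c \<psi>\<close>: differentiating the weight creates the
  damping term.\<close>

lemma weighted_bilinear_form:
  assumes T: "0 < T" and u: "u \<in> H1 0 T" and \<phi>: "\<phi> \<in> test_functions 0 T"
  shows "- weighted_inner T c (weak_deriv 0 T u) (deriv \<phi>) + k * weighted_inner T c u \<phi> =
    osc_dist T c k u (\<lambda>t. exp (c * t) * \<phi> t)"
proof -
  let ?\<psi> = "\<lambda>t. exp (c * t) * \<phi> t"
  let ?g = "weak_deriv 0 T u"
  have \<psi>: "?\<psi> \<in> test_functions 0 T" by (rule test_function_mult[OF \<phi> T smooth_exp_mult])
  have d\<psi>: "deriv ?\<psi> \<in> test_functions 0 T" by (rule test_function_deriv[OF \<psi> T])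
  have g: "regular_dist 0 T ?g \<eta> = - regular_dist 0 T u (deriv \<eta>)" if "\<eta> \<in> test_functions 0 T" for \<eta>
    by (rule has_weak_derivD[OF weak_deriv(2)[OF u] that])
  have "(\<lambda>t. exp (c * t) * deriv \<phi> t) = (\<lambda>t. deriv ?\<psi> t + (- c) * ?\<psi> t)"
    by (simp add: deriv_exp_mult[OF test_function_smooth[OF \<phi>]])
  then have "weighted_inner T c ?g (deriv \<phi>) = regular_dist 0 T ?g (deriv ?\<psi>) + (- c) * regular_dist 0 T ?g ?\<psi>"
    using regular_dist_test_add[OF weak_deriv(1)[OF u] d\<psi> \<psi> T, of "- c"] by (simp add: weighted_inner_eq)
  then show ?thesis using g[OF d\<psi>] g[OF \<psi>] by (simp add: osc_dist_def weighted_inner_eq)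
qed

text \<open>The pairing is defined by a choice, so a witness is needed. If \<open>f = G'\<close>,
  then \<open>exp(c t) f = (exp(c t) G)' - c exp(c t) G\<close>, which suggests
  \<open>exp(c t) G\<close> minus the primitive \<open>J\<close> of \<open>c exp(c t) G\<close>.
  Whatever is chosen has the same weak derivative, hence the same value on
  \<open>\<phi>\<close>.\<close>

lemma weighted_pairing_eq:
  assumes T: "0 < T" and f: "f \<in> sobolev 0 T (-1)" and \<phi>: "\<phi> \<in> test_functions 0 T"
  shows "weighted_pairing T c f \<phi> = f (\<lambda>t. exp (c * t) * \<phi> t)"
proof -
  obtain G where G: "G \<in> L2 0 T" "dist_eq 0 T f (dist_deriv (regular_dist 0 T G))"
    using f unfolding sobolev_minus_1 by blast
  let ?E = "\<lambda>t. exp (c * t)"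
  let ?P = "\<lambda>F. F \<in> L2 0 T \<and> dist_eq 0 T (dist_deriv (regular_dist 0 T F)) (dist_mult ?E f)"
  define H where "H = (\<lambda>t. c * (?E t * G t))"
  have EG: "(\<lambda>t. ?E t * G t) \<in> L2 0 T" by (intro L2_continuous_mult G continuous_intros)
  have H: "H \<in> L2 0 T" unfolding H_def by (rule L2_cmult[OF EG])
  define J where "J = (\<lambda>t. integral {0..t} H)"
  have J: "J \<in> L2 0 T" unfolding J_def by (rule L2_primitive[OF H])
  have JH: "has_weak_deriv 0 T 1 J H" unfolding J_def by (rule integral_has_weak_deriv[OF T H])
  have "?P (\<lambda>t. ?E t * G t - J t)"
    unfolding dist_eq_def
  proof (intro conjI ballI L2_diff EG J)
    fix \<phi> assume \<phi>: "\<phi> \<in> test_functions 0 T"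
    note d = test_function_deriv[OF \<phi> T]
    have E\<phi>: "(\<lambda>t. ?E t * \<phi> t) \<in> test_functions 0 T" by (rule test_function_mult[OF \<phi> T smooth_exp_mult])
    have Ed: "(\<lambda>t. ?E t * deriv \<phi> t) \<in> test_functions 0 T" by (rule test_function_mult[OF d T smooth_exp_mult])
    have "regular_dist 0 T (\<lambda>t. ?E t * G t - J t) (deriv \<phi>) =
        regular_dist 0 T G (\<lambda>t. ?E t * deriv \<phi> t) - regular_dist 0 T J (deriv \<phi>)"
      using regular_dist_add[OF EG L2_cmult[OF J, of "-1"] d] regular_dist_cmult[of 0 T "-1" J "deriv \<phi>"]
      by (simp add: regular_dist_mult)
    also have "regular_dist 0 T J (deriv \<phi>) = - regular_dist 0 T H \<phi>"
      using has_weak_derivD[OF JH \<phi>] by simp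
    also have "regular_dist 0 T H \<phi> = c * regular_dist 0 T G (\<lambda>t. ?E t * \<phi> t)"
      unfolding H_def regular_dist_cmult regular_dist_mult ..
    finally have "regular_dist 0 T (\<lambda>t. ?E t * G t - J t) (deriv \<phi>) =
        regular_dist 0 T G (\<lambda>t. ?E t * deriv \<phi> t + c * (?E t * \<phi> t))"
      using regular_dist_test_add[OF G(1) Ed E\<phi> T, of c] by simp
    also have "\<dots> = - f (\<lambda>t. ?E t * \<phi> t)"
      using G(2) E\<phi> unfolding dist_eq_def dist_deriv_def
      by (simp add: deriv_exp_mult[OF test_function_smooth[OF \<phi>]])
    finally show "dist_deriv (regular_dist 0 T (\<lambda>t. ?E t * G t - J t)) \<phi> = dist_mult ?E f \<phi>"
      by (simp add: dist_deriv_def dist_mult_def)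
  qed
  then have P: "?P (SOME F. ?P F)" by (rule someI[of ?P])
  have "weighted_pairing T c f \<phi> = dist_deriv (regular_dist 0 T (SOME F. ?P F)) \<phi>"
    by (simp add: weighted_pairing_def Let_def dist_deriv_def regular_dist_def)
  also have "\<dots> = dist_mult ?E f \<phi>" using conjunct2[OF P] \<phi> unfolding dist_eq_def by (rule bspec)
  finally show ?thesis by (simp add: dist_mult_def)
qed

text \<open>Multiplication by \<open>exp(c t)\<close> permutes the test functions, its inverse being
  multiplication by \<open>exp(- c t)\<close>, so quantifying over \<open>\<phi>\<close> and over
  \<open>exp(c t) \<phi>\<close> is the same.\<close>

lemma weak_form_iff_solves_ode:
  assumes T: "0 < T" and f: "f \<in> sobolev 0 T (-1)" and u: "u \<in> H1 0 T" and v: "v \<in> H1 0 T"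
  shows "weak_form T c k f v u \<longleftrightarrow> solves_ode T c k f (\<lambda>t. u t + v t)"
proof -
  let ?e = "\<lambda>\<phi> t. exp (c * t) * \<phi> t"
  have eq: "(- weighted_inner T c (weak_deriv 0 T u) (deriv \<phi>) + k * weighted_inner T c u \<phi> =
        weighted_pairing T c f \<phi> + weighted_inner T c (weak_deriv 0 T v) (deriv \<phi>)
          - k * weighted_inner T c v \<phi>) \<longleftrightarrow>
      osc_dist T c k (\<lambda>t. u t + v t) (?e \<phi>) = f (?e \<phi>)"
    if \<phi>: "\<phi> \<in> test_functions 0 T" for \<phi>
    using weighted_bilinear_form[OF T u \<phi>, of c k] weighted_bilinear_form[OF T v \<phi>, of c k]
      weighted_pairing_eq[OF T f \<phi>, of c]
      osc_dist_add[OF T H1_L2[OF u] H1_L2[OF v] test_function_mult[OF \<phi> T smooth_exp_mult], of c k c]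
    by linarith
  have "weak_form T c k f v u \<longleftrightarrow>
      (\<forall>\<phi>\<in>test_functions 0 T. osc_dist T c k (\<lambda>t. u t + v t) (?e \<phi>) = f (?e \<phi>))"
    unfolding weak_form_def using eq by (intro ball_cong refl)
  also have "\<dots> \<longleftrightarrow> (\<forall>\<psi>\<in>test_functions 0 T. osc_dist T c k (\<lambda>t. u t + v t) \<psi> = f \<psi>)"
  proof (intro iffI ballI)
    fix \<psi> assume all: "\<forall>\<phi>\<in>test_functions 0 T. osc_dist T c k (\<lambda>t. u t + v t) (?e \<phi>) = f (?e \<phi>)"
      and \<psi>: "\<psi> \<in> test_functions 0 T"
    have "?e (\<lambda>t. exp (- c * t) * \<psi> t) = \<psi>" by (simp add: fun_eq_iff exp_minus)
    then show "osc_dist T c k (\<lambda>t. u t + v t) \<psi> = f \<psi>"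
      using bspec[OF all test_function_mult[OF \<psi> T smooth_exp_mult[of "- c"]]] by simp
  next
    fix \<phi> assume "\<forall>\<psi>\<in>test_functions 0 T. osc_dist T c k (\<lambda>t. u t + v t) \<psi> = f \<psi>" "\<phi> \<in> test_functions 0 T"
    then show "osc_dist T c k (\<lambda>t. u t + v t) (?e \<phi>) = f (?e \<phi>)"
      using test_function_mult[OF _ T smooth_exp_mult] by blast
  qed
  finally show ?thesis unfolding solves_ode_iff dist_eq_def .
qed

section \<open>Integral form of the equation\<close>

text \<open>The equation integrated twice. \<open>C\<close> stands in for the initial velocity: for
  continuous \<open>F\<close> it amounts to \<open>x' 0 = F 0 - c x 0 + C\<close>. Continuity of
  \<open>x\<close> guards the inner integral, which would be 0 by default on a non-integrable
  function.\<close>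

definition osc_integral_eq ::
  "real \<Rightarrow> real \<Rightarrow> real \<Rightarrow> (real \<Rightarrow> real) \<Rightarrow> real \<Rightarrow> (real \<Rightarrow> real) \<Rightarrow> bool" where
  "osc_integral_eq T c k F C x \<longleftrightarrow> continuous_on {0..T} x \<and>
     (\<forall>t\<in>{0..T}. x t = x 0 + integral {0..t} (\<lambda>s. F s - c * x s - k * integral {0..s} x + C))"

lemma osc_rhs_L2:
  assumes "F \<in> L2 0 T" "continuous_on {0..T} x"
  shows "(\<lambda>s. F s - c * x s - k * integral {0..s} x + C) \<in> L2 0 T"
  by (intro L2_add[OF L2_diff[OF L2_diff]] L2_cmult L2_continuous assms continuous_intros
      L2_primitive_continuous)

lemma regular_dist_diff:
  assumes "u \<in> L2 a b" "v \<in> L2 a b" "\<phi> \<in> test_functions a b"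
  shows "regular_dist a b (\<lambda>t. u t - v t) \<phi> = regular_dist a b u \<phi> - regular_dist a b v \<phi>"
  using regular_dist_add[OF assms(1) L2_cmult[OF assms(2), of "-1"] assms(3)]
    regular_dist_cmult[of a b "-1" v \<phi>] by simp

lemma regular_dist_const_deriv:
  assumes ab: "a < b" and \<phi>: "\<phi> \<in> test_functions a b"
  shows "regular_dist a b (\<lambda>t. C) (deriv \<phi>) = 0"
  using has_weak_derivD[OF const_has_weak_deriv[OF ab] \<phi>] by (simp add: regular_dist_def)

text \<open>The oscillator operator applied to \<open>x\<close> is the distributional derivative of
  \<open>x' + c x + k \<integral> x\<close>; this is the fact \<open>ode\<close>. The equation thus
  says that this function and \<open>F\<close> have the same derivative, so that they differ by a
  constant \<open>C\<close> almost everywhere.\<close>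

lemma H1_solves_ode_iff:
  assumes T: "0 < T" and F: "F \<in> L2 0 T" and f: "dist_eq 0 T f (dist_deriv (regular_dist 0 T F))"
  shows "x \<in> H1 0 T \<and> solves_ode T c k f x \<longleftrightarrow> (\<exists>C. osc_integral_eq T c k F C x)"
proof -
  have ode: "osc_dist T c k x \<psi> = - regular_dist 0 T (\<lambda>t. g t + c * x t + k * integral {0..t} x) (deriv \<psi>)"
    if xc: "continuous_on {0..T} x" and g: "g \<in> L2 0 T" "has_weak_deriv 0 T 1 x g" and \<psi>: "\<psi> \<in> test_functions 0 T" for g \<psi>
  proof -
    note d = test_function_deriv[OF \<psi> T]
    have x: "x \<in> L2 0 T" by (rule L2_continuous[OF xc])
    let ?X = "\<lambda>t. integral {0..t} x"
    have X: "?X \<in> L2 0 T" by (rule L2_primitive[OF x])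
    have Xx: "regular_dist 0 T x \<psi> = - regular_dist 0 T ?X (deriv \<psi>)"
      by (rule has_weak_derivD[OF integral_has_weak_deriv[OF T x] \<psi>])
    have xg: "regular_dist 0 T g (deriv \<psi>) = - regular_dist 0 T x (deriv (deriv \<psi>))"
      by (rule has_weak_derivD[OF g(2) d])
    have "regular_dist 0 T (\<lambda>t. g t + c * x t + k * ?X t) (deriv \<psi>) =
        regular_dist 0 T g (deriv \<psi>) + c * regular_dist 0 T x (deriv \<psi>) + k * regular_dist 0 T ?X (deriv \<psi>)"
      by (simp add: regular_dist_add[OF L2_add[OF g(1) L2_cmult[OF x]] L2_cmult[OF X] d]
          regular_dist_add[OF g(1) L2_cmult[OF x] d] regular_dist_cmult)
    then show ?thesis using Xx xg by (simp add: osc_dist_def)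
  qed
  show ?thesis
  proof
    assume a: "x \<in> H1 0 T \<and> solves_ode T c k f x"
    then have xc: "continuous_on {0..T} x" by (simp add: H1_continuous)
    have x: "x \<in> L2 0 T" by (rule L2_continuous[OF xc])
    obtain g where g: "g \<in> L2 0 T" "\<And>t. t \<in> {0..T} \<Longrightarrow> x t = x 0 + integral {0..t} g"
      using a unfolding H1_iff[OF T] by blast
    note w = primitive_has_weak_deriv[OF T g]
    let ?h = "\<lambda>t. g t + c * x t + k * integral {0..t} x"
    have h: "?h \<in> L2 0 T"
      by (intro L2_add L2_cmult g x L2_continuous L2_primitive_continuous)
    have "dist_eq 0 T (dist_deriv (regular_dist 0 T ?h)) (dist_deriv (regular_dist 0 T F))"
      using a f ode[OF xc g(1) w] unfolding solves_ode_iff dist_eq_def by (simp add: dist_deriv_def)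
    then obtain C where C: "AE t in lebesgue. t \<in> {0<..<T} \<longrightarrow> ?h t = F t + C"
      using dist_deriv_regular_eq_imp[OF T h F] by blast
    obtain N where N: "negligible N" "\<And>t. t \<notin> N \<Longrightarrow> t \<in> {0<..<T} \<longrightarrow> ?h t = F t + C"
      using AE_lebesgueE[OF C] by blast
    have "x t = x 0 + integral {0..t} (\<lambda>s. F s - c * x s - k * integral {0..s} x + C)" if t: "t \<in> {0..T}" for t
    proof -
      have "integral {0..t} g = integral {0..t} (\<lambda>s. F s - c * x s - k * integral {0..s} x + C)"
      proof (rule integral_spike[of "N \<union> {0, T}"])
        show "negligible (N \<union> {0, T})" using N(1) by (simp add: negligible_Un)
        fix s assume "s \<in> {0..t} - (N \<union> {0, T})"
        then have "?h s = F s + C" using N(2)[of s] t by auto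
        then show "F s - c * x s - k * integral {0..s} x + C = g s" by linarith
      qed
      then show ?thesis using g(2)[OF t] by simp
    qed
    then show "\<exists>C. osc_integral_eq T c k F C x" using xc unfolding osc_integral_eq_def by blast
  next
    assume "\<exists>C. osc_integral_eq T c k F C x"
    then obtain C where C: "osc_integral_eq T c k F C x" by blast
    let ?g = "\<lambda>s. F s - c * x s - k * integral {0..s} x + C"
    have xc: "continuous_on {0..T} x" using C unfolding osc_integral_eq_def by blast
    have x: "\<And>t. t \<in> {0..T} \<Longrightarrow> x t = x 0 + integral {0..t} ?g"
      using C unfolding osc_integral_eq_def by blast
    have g: "?g \<in> L2 0 T" by (rule osc_rhs_L2[OF F xc])
    have "x \<in> H1 0 T" unfolding H1_iff[OF T] using g x by blast
    moreover have "solves_ode T c k f x"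
      unfolding solves_ode_iff dist_eq_def
    proof
      fix \<psi> assume \<psi>: "\<psi> \<in> test_functions 0 T"
      note d = test_function_deriv[OF \<psi> T]
      have "osc_dist T c k x \<psi> = - regular_dist 0 T (\<lambda>t. F t + C) (deriv \<psi>)"
        using ode[OF xc g primitive_has_weak_deriv[OF T g x] \<psi>] by simp
      also have "\<dots> = - regular_dist 0 T F (deriv \<psi>)"
        using regular_dist_add[OF F L2_const d] regular_dist_const_deriv[OF T \<psi>] by simp
      also have "\<dots> = f \<psi>" using f \<psi> unfolding dist_eq_def dist_deriv_def by simp
      finally show "osc_dist T c k x \<psi> = f \<psi>" .
    qed
    ultimately show "x \<in> H1 0 T \<and> solves_ode T c k f x" by blast
  qed
qed

lemma osc_integral_eq_lin:
  assumes F: "F \<in> L2 0 T" "G \<in> L2 0 T"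
    and x: "osc_integral_eq T c k F C x" and y: "osc_integral_eq T c k G D y"
  shows "osc_integral_eq T c k (\<lambda>t. F t + \<alpha> * G t) (C + \<alpha> * D) (\<lambda>t. x t + \<alpha> * y t)"
  unfolding osc_integral_eq_def
proof (intro conjI ballI)
  have xc: "continuous_on {0..T} x" and yc: "continuous_on {0..T} y"
    using x y unfolding osc_integral_eq_def by blast+
  then show "continuous_on {0..T} (\<lambda>t. x t + \<alpha> * y t)" by (intro continuous_intros)
  fix t assume t: "t \<in> {0..T}"
  let ?p = "\<lambda>s. F s - c * x s - k * integral {0..s} x + C"
  let ?q = "\<lambda>s. G s - c * y s - k * integral {0..s} y + D"
  have pq: "?p integrable_on {0..t}" "?q integrable_on {0..t}"
    using L2_integrable[OF L2_subinterval[OF osc_rhs_L2[OF F(1) xc], of 0 t]]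
      L2_integrable[OF L2_subinterval[OF osc_rhs_L2[OF F(2) yc], of 0 t]] t by auto
  have "integral {0..t} (\<lambda>s. F s + \<alpha> * G s - c * (x s + \<alpha> * y s) - k * integral {0..s} (\<lambda>t. x t + \<alpha> * y t) + (C + \<alpha> * D)) =
      integral {0..t} (\<lambda>s. ?p s + \<alpha> * ?q s)"
  proof (rule integral_cong)
    fix s assume s: "s \<in> {0..t}"
    have sub: "{0..s} \<subseteq> {0..T}" using s t by auto
    have xi: "x integrable_on {0..s}" and yi: "y integrable_on {0..s}"
      using integrable_continuous_real[OF continuous_on_subset[OF xc sub]]
        integrable_continuous_real[OF continuous_on_subset[OF yc sub]] by auto
    have "integral {0..s} (\<lambda>t. x t + \<alpha> * y t) = integral {0..s} x + \<alpha> * integral {0..s} y"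
      using integral_add[OF xi integrable_on_mult_right[OF yi, of \<alpha>]] by simp
    then show "F s + \<alpha> * G s - c * (x s + \<alpha> * y s) - k * integral {0..s} (\<lambda>t. x t + \<alpha> * y t) + (C + \<alpha> * D) = ?p s + \<alpha> * ?q s"
      by (simp add: algebra_simps)
  qed
  also have "\<dots> = integral {0..t} ?p + \<alpha> * integral {0..t} ?q"
    using integral_add[OF pq(1) integrable_on_mult_right[OF pq(2)]] by simp
  finally have I: "integral {0..t} (\<lambda>s. F s + \<alpha> * G s - c * (x s + \<alpha> * y s) - k * integral {0..s} (\<lambda>t. x t + \<alpha> * y t) + (C + \<alpha> * D))
      = integral {0..t} ?p + \<alpha> * integral {0..t} ?q" .
  have xt: "x t = x 0 + integral {0..t} ?p" and yt: "y t = y 0 + integral {0..t} ?q"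
    using x y t unfolding osc_integral_eq_def by blast+
  show "x t + \<alpha> * y t = x 0 + \<alpha> * y 0 + integral {0..t} (\<lambda>s. F s + \<alpha> * G s - c * (x s + \<alpha> * y s) - k * integral {0..s} (\<lambda>t. x t + \<alpha> * y t) + (C + \<alpha> * D))"
    unfolding I xt yt by (simp only: distrib_left add.assoc add.left_commute)
qed

section \<open>Solutions of the damped oscillator equation\<close>

text \<open>The Leibniz rule in integrated form, as \<open>F\<close> is only square integrable:
  write \<open>K (t - s)\<close> as \<open>K 0\<close> plus the integral of
  \<open>K' (r - s)\<close> over \<open>r\<close> from \<open>s\<close> to \<open>t\<close>, and
  swap the triangle. Continuity is read off from the resulting formula.\<close>

lemma convolution_primitive:
  assumes F: "F \<in> L2 0 T" and K: "\<And>t. (K has_real_derivative K' t) (at t)" and K': "continuous_on UNIV K'"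
  shows "t \<in> {0..T} \<Longrightarrow> integral {0..t} (\<lambda>s. K (t - s) * F s) =
      K 0 * integral {0..t} F + integral {0..t} (\<lambda>r. integral {0..r} (\<lambda>s. K' (r - s) * F s))"
    and "continuous_on {0..T} (\<lambda>t. integral {0..t} (\<lambda>s. K (t - s) * F s))"
proof -
  have K'2: "continuous_on UNIV (\<lambda>z. K' (fst z - snd z))"
    by (rule continuous_on_compose2[OF K']) (auto intro!: continuous_intros)
  have KU: "continuous_on UNIV K"
    by (rule DERIV_continuous_on) (rule has_field_derivative_at_within[OF K])
  have Kc: "continuous_on A (\<lambda>s. K (t - s))" for A t
    by (rule continuous_on_compose2[OF KU]) (auto intro!: continuous_intros)
  show eq: "integral {0..t} (\<lambda>s. K (t - s) * F s) =
      K 0 * integral {0..t} F + integral {0..t} (\<lambda>r. integral {0..r} (\<lambda>s. K' (r - s) * F s))"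
    if t: "t \<in> {0..T}" for t
  proof -
    have Ft: "F \<in> L2 0 t" using L2_subinterval[OF F] t by simp
    have "integral {0..t} (\<lambda>r. integral {0..r} (\<lambda>s. K' (r - s) * F s)) =
        integral {0..t} (\<lambda>s. F s * integral {s..t} (\<lambda>r. K' (r - s)))"
      by (rule integral_triangle_swap(2)[OF L2_absolutely_integrable[OF Ft] K'2])
    also have "\<dots> = integral {0..t} (\<lambda>s. K (t - s) * F s - K 0 * F s)"
    proof (rule integral_cong)
      fix s assume s: "s \<in> {0..t}"
      have "((\<lambda>r. K (r - s)) has_real_derivative K' (r - s)) (at r)" for r
      proof -
        have "((\<lambda>r. r - s) has_real_derivative 1) (at r)" by (auto intro!: derivative_eq_intros)
        from DERIV_chain2[OF K this] show ?thesis by simp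
      qed
      then have "((\<lambda>r. K' (r - s)) has_integral (K (t - s) - K (s - s))) {s..t}"
        using s by (intro has_integral_DERIV) auto
      then show "F s * integral {s..t} (\<lambda>r. K' (r - s)) = K (t - s) * F s - K 0 * F s"
        by (simp add: integral_unique algebra_simps)
    qed
    also have "\<dots> = integral {0..t} (\<lambda>s. K (t - s) * F s) - K 0 * integral {0..t} F"
      using integral_diff[OF L2_integrable[OF L2_continuous_mult[OF Kc Ft]]
        integrable_on_mult_right[OF L2_integrable[OF Ft]], of t "K 0"] by simp
    finally show ?thesis by simp
  qed
  have int: "(\<lambda>r. integral {0..r} (\<lambda>s. K' (r - s) * F s)) integrable_on {0..T}"
    by (rule integral_triangle_swap(1)[OF L2_absolutely_integrable[OF F] K'2])
  have "continuous_on {0..T} (\<lambda>t. K 0 * integral {0..t} F + integral {0..t} (\<lambda>r. integral {0..r} (\<lambda>s. K' (r - s) * F s)))"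
    by (intro continuous_intros L2_primitive_continuous F indefinite_integral_continuous_1 int)
  then show "continuous_on {0..T} (\<lambda>t. integral {0..t} (\<lambda>s. K (t - s) * F s))"
    using continuous_on_cong[OF refl eq, of "{0..T}"] by simp
qed

section \<open>Homogeneous and particular solutions\<close>

definition osc_cos :: "real \<Rightarrow> real \<Rightarrow> real \<Rightarrow> real" where
  "osc_cos c \<omega> t = exp (- c / 2 * t) * cos (\<omega> * t)"

definition osc_sin :: "real \<Rightarrow> real \<Rightarrow> real \<Rightarrow> real" where
  "osc_sin c \<omega> t = exp (- c / 2 * t) * sin (\<omega> * t)"

lemma osc_DERIV:
  "(osc_cos c \<omega> has_real_derivative - c / 2 * osc_cos c \<omega> t - \<omega> * osc_sin c \<omega> t) (at t)"
  "(osc_sin c \<omega> has_real_derivative - c / 2 * osc_sin c \<omega> t + \<omega> * osc_cos c \<omega> t) (at t)"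
  unfolding osc_cos_def osc_sin_def
  by (auto intro!: derivative_eq_intros simp: algebra_simps)

text \<open>The derivatives are written as \<open>- c y' - k y\<close>, the shape in which
  \<open>osc_integral_eq_classical\<close> takes them.\<close>

lemma osc_DERIV2:
  assumes k: "k = \<omega>\<^sup>2 + c\<^sup>2 / 4"
  shows "((\<lambda>t. - c / 2 * osc_cos c \<omega> t - \<omega> * osc_sin c \<omega> t) has_real_derivative
      - c * (- c / 2 * osc_cos c \<omega> t - \<omega> * osc_sin c \<omega> t) - k * osc_cos c \<omega> t) (at t)"
    and "((\<lambda>t. - c / 2 * osc_sin c \<omega> t + \<omega> * osc_cos c \<omega> t) has_real_derivative
      - c * (- c / 2 * osc_sin c \<omega> t + \<omega> * osc_cos c \<omega> t) - k * osc_sin c \<omega> t) (at t)"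
  by (rule derivative_eq_intros osc_DERIV refl | simp add: k power2_eq_square algebra_simps)+

lemma osc_at_0 [simp]: "osc_cos c \<omega> 0 = 1" "osc_sin c \<omega> 0 = 0"
  by (simp_all add: osc_cos_def osc_sin_def)

text \<open>Integrating \<open>y'' = - c y' - k y\<close> once from 0 produces the constant
  \<open>y' 0 + c y 0\<close>; integrating again gives the claim.\<close>

lemma osc_integral_eq_classical:
  assumes y: "\<And>t. (y has_real_derivative y' t) (at t)"
    and y': "\<And>t. (y' has_real_derivative - c * y' t - k * y t) (at t)"
  shows "osc_integral_eq T c k (\<lambda>_. 0) (y' 0 + c * y 0) y"
  unfolding osc_integral_eq_def
proof (intro conjI ballI)
  show "continuous_on {0..T} y"
    by (rule DERIV_continuous_on) (rule has_field_derivative_at_within[OF y])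
  fix t assume t: "t \<in> {0..T}"
  have "integral {0..t} (\<lambda>s. 0 - c * y s - k * integral {0..s} y + (y' 0 + c * y 0)) = integral {0..t} y'"
  proof (rule integral_cong)
    fix s assume s: "s \<in> {0..t}"
    have yc: "continuous_on {0..s} y"
      by (rule DERIV_continuous_on) (rule has_field_derivative_at_within[OF y])
    have 1: "(y' has_integral (y s - y 0)) {0..s}"
      using s by (intro has_integral_DERIV y) auto
    have 2: "((\<lambda>t. - c * y' t - k * y t) has_integral (y' s - y' 0)) {0..s}"
      using s by (intro has_integral_DERIV y') auto
    have "((\<lambda>t. - c * y' t - k * y t) has_integral (- c * (y s - y 0) - k * integral {0..s} y)) {0..s}"
      by (intro has_integral_diff has_integral_mult_right 1 integrable_integral integrable_continuous_real yc)
    then have "y' s - y' 0 = - c * (y s - y 0) - k * integral {0..s} y" using 2 has_integral_unique by blast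
    then show "0 - c * y s - k * integral {0..s} y + (y' 0 + c * y 0) = y' s" by (simp add: algebra_simps)
  qed
  also have "\<dots> = y t - y 0"
    using t by (intro integral_unique has_integral_DERIV y) auto
  finally show "y t = y 0 + integral {0..t} (\<lambda>s. 0 - c * y s - k * integral {0..s} y + (y' 0 + c * y 0))"
    by simp
qed

lemma osc_homogeneous:
  assumes "k = \<omega>\<^sup>2 + c\<^sup>2 / 4"
  obtains C D where "osc_integral_eq T c k (\<lambda>_. 0) C (osc_cos c \<omega>)" "osc_integral_eq T c k (\<lambda>_. 0) D (osc_sin c \<omega>)"
  using osc_integral_eq_classical[OF osc_DERIV(1) osc_DERIV2(1)[OF assms]]
    osc_integral_eq_classical[OF osc_DERIV(2) osc_DERIV2(2)[OF assms]] by blast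

text \<open>The convolution of \<open>F\<close> with the derivative of the impulse response solves the equation with
  right-hand side \<open>F'\<close>.\<close>

lemma osc_particular:
  assumes T: "0 < T" and F: "F \<in> L2 0 T" and \<omega>: "\<omega> \<noteq> 0" and k: "k = \<omega>\<^sup>2 + c\<^sup>2 / 4"
  obtains x where "osc_integral_eq T c k F 0 x" "x 0 = 0"
proof -
  \<comment> \<open>The impulse response: \<open>h 0 = 0\<close> and
    \<open>h' 0 = 1\<close>.\<close>
  define h where "h t = osc_sin c \<omega> t / \<omega>" for t
  define h1 where "h1 t = (- c / 2 * osc_sin c \<omega> t + \<omega> * osc_cos c \<omega> t) / \<omega>" for t
  have h: "(h has_real_derivative h1 t) (at t)" for t
    unfolding h_def h1_def by (intro DERIV_cdivide osc_DERIV)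
  have h1: "(h1 has_real_derivative - c * h1 t - k * h t) (at t)" for t
  proof -
    have "(h1 has_real_derivative (- c * (- c / 2 * osc_sin c \<omega> t + \<omega> * osc_cos c \<omega> t) - k * osc_sin c \<omega> t) / \<omega>) (at t)"
      unfolding h1_def[abs_def] by (rule DERIV_cdivide[OF osc_DERIV2(2)[OF k]])
    moreover have "(- c * (- c / 2 * osc_sin c \<omega> t + \<omega> * osc_cos c \<omega> t) - k * osc_sin c \<omega> t) / \<omega> = - c * h1 t - k * h t"
      unfolding h_def h1_def by (simp only: diff_divide_distrib times_divide_eq_right)
    ultimately show ?thesis by (simp only:)
  qed
  have h1c: "continuous_on A h1" and hc: "continuous_on A h" for A
    by (rule DERIV_continuous_on, rule has_field_derivative_at_within, rule h1 h)+
  have h0: "h 0 = 0" "h1 0 = 1" using \<omega> by (simp_all add: h_def h1_def)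
  \<comment> \<open>Formally \<open>h\<close> convolved with \<open>F'\<close> and integrated by
    parts, up to a multiple of the homogeneous solution \<open>h\<close>.\<close>
  define x where "x t = integral {0..t} (\<lambda>s. h1 (t - s) * F s)" for t
  have xc: "continuous_on {0..T} x"
    unfolding x_def by (rule convolution_primitive(2)[OF F h1]) (intro continuous_intros h1c hc)
  have hx: "integral {0..t} (\<lambda>s. h (t - s) * F s) = integral {0..t} x" if "t \<in> {0..T}" for t
    using convolution_primitive(1)[OF F h h1c that] h0 by (simp add: x_def[abs_def])
  have "osc_integral_eq T c k F 0 x"
    unfolding osc_integral_eq_def
  proof (intro conjI ballI xc)
    fix t assume t: "t \<in> {0..T}"
    \<comment> \<open>\<open>h1 0 = 1\<close> contributes the primitive of \<open>F\<close>; the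
      remaining kernel \<open>h1' = - c h1 - k h\<close> reproduces
      \<open>- c x - k \<integral> x\<close>, where \<open>hx\<close> identifies the second
      part.\<close>
    have "x t = integral {0..t} F + integral {0..t} (\<lambda>r. integral {0..r} (\<lambda>s. (- c * h1 (r - s) - k * h (r - s)) * F s))"
      using convolution_primitive(1)[OF F h1 _ t] h0 by (simp add: x_def continuous_intros h1c hc)
    also have "integral {0..t} (\<lambda>r. integral {0..r} (\<lambda>s. (- c * h1 (r - s) - k * h (r - s)) * F s)) =
        integral {0..t} (\<lambda>r. - c * x r - k * integral {0..r} x)"
    proof (rule integral_cong)
      fix r assume r: "r \<in> {0..t}"
      have Fr: "F \<in> L2 0 r" using L2_subinterval[OF F] r t by simp
      have c1: "continuous_on {0..r} (\<lambda>s. h1 (r - s))" and c2: "continuous_on {0..r} (\<lambda>s. h (r - s))"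
        by (rule continuous_on_compose2[OF h1c[of UNIV]], auto intro!: continuous_intros)
          (rule continuous_on_compose2[OF hc[of UNIV]], auto intro!: continuous_intros)
      have "integral {0..r} (\<lambda>s. (- c * h1 (r - s) - k * h (r - s)) * F s) =
          integral {0..r} (\<lambda>s. - c * (h1 (r - s) * F s) - k * (h (r - s) * F s))"
        by (simp add: algebra_simps)
      also have "\<dots> = - c * x r - k * integral {0..r} (\<lambda>s. h (r - s) * F s)"
        using integral_diff[OF integrable_on_mult_right[OF L2_integrable[OF L2_continuous_mult[OF c1 Fr]], of "- c"]
          integrable_on_mult_right[OF L2_integrable[OF L2_continuous_mult[OF c2 Fr]], of k]]
        by (simp add: x_def)
      finally show "integral {0..r} (\<lambda>s. (- c * h1 (r - s) - k * h (r - s)) * F s) = - c * x r - k * integral {0..r} x"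
        using hx[of r] r t by simp
    qed
    also have "integral {0..t} F + \<dots> = integral {0..t} (\<lambda>s. F s + (- c * x s - k * integral {0..s} x))"
    proof (rule integral_add[symmetric])
      show "F integrable_on {0..t}" using L2_integrable[OF L2_subinterval[OF F]] t by simp
      have "continuous_on {0..t} x" using xc t by (auto elim: continuous_on_subset)
      then show "(\<lambda>s. - c * x s - k * integral {0..s} x) integrable_on {0..t}"
        by (intro integrable_continuous_real continuous_intros L2_primitive_continuous L2_continuous)
    qed
    finally show "x t = x 0 + integral {0..t} (\<lambda>s. F s - c * x s - k * integral {0..s} x + 0)"
      by (simp add: x_def algebra_simps)
  qed
  moreover have "x 0 = 0" by (simp add: x_def)
  ultimately show ?thesis by (rule that)
qed

text \<open>The two first integrals of the undamped equation for \<open>exp (c t / 2) w(t)\<close> are constant.\<close>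

lemma osc_homogeneous_unique:
  assumes T: "0 < T" and \<omega>: "\<omega> \<noteq> 0" and k: "k = \<omega>\<^sup>2 + c\<^sup>2 / 4"
    and w: "osc_integral_eq T c k (\<lambda>_. 0) C w"
  obtains B where "\<And>t. t \<in> {0..T} \<Longrightarrow> w t = w 0 * osc_cos c \<omega> t + B * osc_sin c \<omega> t"
proof -
  define w1 where "w1 s = 0 - c * w s - k * integral {0..s} w + C" for s
  have wc: "continuous_on {0..T} w" using w unfolding osc_integral_eq_def by blast
  have w1c: "continuous_on {0..T} w1"
    unfolding w1_def by (intro continuous_intros wc L2_primitive_continuous L2_continuous)
  have weq: "w t = w 0 + integral {0..t} w1" if "t \<in> {0..T}" for t
    using w that unfolding osc_integral_eq_def w1_def by blast
  have dw: "(w has_real_derivative w1 t) (at t within {0..T})" if t: "t \<in> {0..T}" for t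
  proof -
    have "((\<lambda>t. w 0 + integral {0..t} w1) has_real_derivative 0 + w1 t) (at t within {0..T})"
      by (intro DERIV_add DERIV_const integral_has_real_derivative w1c t)
    then have "((\<lambda>t. w 0 + integral {0..t} w1) has_real_derivative w1 t) (at t within {0..T})" by simp
    then show ?thesis
    proof (rule has_field_derivative_transform_within[where d=1])
      show "w 0 + integral {0..r} w1 = w r" if "r \<in> {0..T}" for r by (rule weq[OF that, symmetric])
    qed (use t in auto)
  qed
  have dw1: "(w1 has_real_derivative - c * w1 t - k * w t) (at t within {0..T})" if t: "t \<in> {0..T}" for t
    unfolding w1_def[abs_def]
    by (rule derivative_eq_intros dw[OF t] integral_has_real_derivative[OF wc t] refl | simp add: w1_def)+
  \<comment> \<open>\<open>exp (c / 2 * t) * z1 t\<close> is the derivative of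
    \<open>exp (c / 2 * t) * w t\<close>. Thus \<open>P\<close> and \<open>Q\<close> are position
    and scaled velocity of the undamped motion, rotated back by the angle
    \<open>\<omega> t\<close>.\<close>
  define z1 where "z1 t = w1 t + c / 2 * w t" for t
  define P where "P t = exp (c / 2 * t) * (w t * cos (\<omega> * t) - z1 t * sin (\<omega> * t) / \<omega>)" for t
  define Q where "Q t = exp (c / 2 * t) * (w t * sin (\<omega> * t) + z1 t * cos (\<omega> * t) / \<omega>)" for t
  have dz1: "(z1 has_real_derivative (- c * w1 t - k * w t) + c / 2 * w1 t) (at t within {0..T})" if "t \<in> {0..T}" for t
    unfolding z1_def[abs_def] by (intro DERIV_add DERIV_cmult dw dw1 that)
  have dP: "(P has_real_derivative 0) (at t within {0..T})" if t: "t \<in> {0..T}" for t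
    unfolding P_def[abs_def]
    by (rule derivative_eq_intros dw[OF t] dz1[OF t] refl | simp add: \<omega>)+
       (simp add: z1_def k \<omega> field_simps power2_eq_square)
  have dQ: "(Q has_real_derivative 0) (at t within {0..T})" if t: "t \<in> {0..T}" for t
    unfolding Q_def[abs_def]
    by (rule derivative_eq_intros dw[OF t] dz1[OF t] refl | simp add: \<omega>)+
       (simp add: z1_def k \<omega> field_simps power2_eq_square)
  obtain p where p: "\<And>t. t \<in> {0..T} \<Longrightarrow> P t = p"
    using has_field_derivative_zero_constant[OF _ dP] by auto
  obtain q where q: "\<And>t. t \<in> {0..T} \<Longrightarrow> Q t = q"
    using has_field_derivative_zero_constant[OF _ dQ] by auto
  have "p = w 0" using p[of 0] T by (simp add: P_def)
  have "w t = w 0 * osc_cos c \<omega> t + q * osc_sin c \<omega> t" if t: "t \<in> {0..T}" for t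
  proof -
    let ?e = "exp (c / 2 * t)" and ?s = "sin (\<omega> * t)" and ?c = "cos (\<omega> * t)"
    \<comment> \<open>Rotating forward again eliminates the velocity.\<close>
    have "p * ?c + q * ?s = P t * ?c + Q t * ?s" using p[OF t] q[OF t] by simp
    also have "\<dots> = ?e * (w t * (?c * ?c + ?s * ?s))"
      unfolding P_def Q_def by (simp only: ring_distribs diff_divide_distrib) (simp add: mult_ac)
    also have "\<dots> = ?e * w t" by (simp only: sin_cos_squared_add3 mult_1_right)
    finally have "exp (- c / 2 * t) * (p * ?c + q * ?s) = exp (- c / 2 * t) * ?e * w t" by simp
    also have "exp (- c / 2 * t) * ?e = 1" by (simp flip: exp_add)
    finally show ?thesis using \<open>p = w 0\<close> by (simp add: osc_cos_def osc_sin_def algebra_simps)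
  qed
  then show ?thesis by (rule that)
qed

section \<open>One-sided derivative at the initial time\<close>

lemma at_0_within_unique:
  assumes "0 < T" "(x has_real_derivative p) (at 0 within {0..T})" "(x has_real_derivative q) (at 0 within {0..T})"
  shows "p = q"
  using assms unfolding has_field_derivative_iff at_within_Icc_at_right[OF assms(1)]
  by (intro tendsto_unique[OF trivial_limit_at_right_real])

text \<open>The rest of the integrand is continuous, so the only obstacle to a derivative at 0 is
  the difference quotient of the primitive of \<open>F\<close>, which is an average of
  \<open>F\<close>; its limit \<open>L\<close> replaces the value \<open>F 0\<close>.\<close>

lemma osc_derivative_at_0:
  assumes T: "0 < T" and F: "F \<in> L2 0 T" and L: "((\<lambda>t. integral {0..t} F / t) \<longlongrightarrow> L) (at_right 0)"
    and x: "osc_integral_eq T c k F C x"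
  shows "(x has_real_derivative L + (C - c * x 0)) (at 0 within {0..T})"
proof -
  have xc: "continuous_on {0..T} x" using x unfolding osc_integral_eq_def by blast
  let ?m = "\<lambda>s. - c * x s - k * integral {0..s} x + C"
  have mc: "continuous_on {0..T} ?m"
    by (intro continuous_intros xc L2_primitive_continuous L2_continuous)
  have "((\<lambda>t. integral {0..t} F) has_real_derivative L) (at 0 within {0..T})"
    using L unfolding has_field_derivative_iff at_within_Icc_at_right[OF T] by simp
  moreover have "((\<lambda>t. integral {0..t} ?m) has_real_derivative ?m 0) (at 0 within {0..T})"
    using T by (intro integral_has_real_derivative mc) simp
  ultimately have "((\<lambda>t. x 0 + (integral {0..t} F + integral {0..t} ?m)) has_real_derivative 0 + (L + ?m 0)) (at 0 within {0..T})"
    by (intro DERIV_add DERIV_const)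
  then have "((\<lambda>t. x 0 + (integral {0..t} F + integral {0..t} ?m)) has_real_derivative L + (C - c * x 0)) (at 0 within {0..T})"
    by simp
  then show ?thesis
  proof (rule has_field_derivative_transform_within[where d=1])
    fix t assume "t \<in> {0..T}"
    then have "{0..t} \<subseteq> {0..T}" and t: "t \<in> {0..T}" by auto
    have "F integrable_on {0..t}" using L2_integrable[OF L2_subinterval[OF F]] t by simp
    moreover have "?m integrable_on {0..t}"
      by (rule integrable_continuous_real[OF continuous_on_subset[OF mc \<open>{0..t} \<subseteq> {0..T}\<close>]])
    ultimately have "integral {0..t} (\<lambda>s. F s + ?m s) = integral {0..t} F + integral {0..t} ?m"
      by (rule integral_add)
    moreover have "x t = x 0 + integral {0..t} (\<lambda>s. F s - c * x s - k * integral {0..s} x + C)"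
      using x t unfolding osc_integral_eq_def by blast
    moreover have "(\<lambda>s. F s - c * x s - k * integral {0..s} x + C) = (\<lambda>s. F s + ?m s)"
      by (simp add: fun_eq_iff)
    ultimately show "x 0 + (integral {0..t} F + integral {0..t} ?m) = x t" by (simp only:)
  qed (use T in auto)
qed

section \<open>Regularity\<close>

lemma dist_deriv_primitive:
  assumes T: "0 < T" and F: "F \<in> L2 0 T" and f: "dist_eq 0 T f (regular_dist 0 T F)"
  shows "dist_eq 0 T f (dist_deriv (regular_dist 0 T (\<lambda>t. integral {0..t} F)))"
  using f integral_has_weak_deriv[OF T F] unfolding has_weak_deriv_1 dist_eq_def by simp

lemma sobolev_neg:
  assumes "-1 \<le> s" "s < 0"
  shows "f \<in> sobolev a b s \<longleftrightarrow> (\<exists>F\<in>sobolev_fun a b (s + 1). dist_eq a b f (dist_deriv (regular_dist a b F)))"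
proof -
  have "nat \<lceil>- s\<rceil> = 1" using assms by linarith
  then show ?thesis by (simp add: sobolev_def Let_def)
qed

lemma sobolev_nonneg:
  assumes "0 \<le> s"
  shows "f \<in> sobolev a b s \<longleftrightarrow> (\<exists>F\<in>sobolev_fun a b s. dist_eq a b f (regular_dist a b F))"
proof -
  have "nat \<lceil>- s\<rceil> = 0" using assms by linarith
  then show ?thesis by (simp add: sobolev_def Let_def)
qed

text \<open>Makes the two shapes of \<open>sobolev\<close> uniform: for \<open>s \<ge> 0\<close> the
  distribution is itself a function, and the primitive of that function serves as
  \<open>F\<close>.\<close>

lemma sobolev_imp_dist_deriv:
  assumes T: "0 < T" and s: "-1 \<le> s" and f: "f \<in> sobolev 0 T s"
  obtains F where "F \<in> L2 0 T" "dist_eq 0 T f (dist_deriv (regular_dist 0 T F))"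
proof (cases "s < 0")
  case True
  then obtain F where "F \<in> sobolev_fun 0 T (s + 1)" "dist_eq 0 T f (dist_deriv (regular_dist 0 T F))"
    using f sobolev_neg[OF s True] by blast
  then show ?thesis using that sobolev_fun_L2 by blast
next
  case False
  then have "0 \<le> s" by simp
  then obtain F where F: "F \<in> sobolev_fun 0 T s" "dist_eq 0 T f (regular_dist 0 T F)"
    using f sobolev_nonneg by blast
  have "F \<in> L2 0 T" using F(1) by (rule sobolev_fun_L2)
  then show ?thesis
    using that[OF L2_primitive] dist_deriv_primitive[OF T _ F(2)] by blast
qed

lemma sobolev_subset_minus_1:
  assumes "0 < T" "-1 \<le> s" "f \<in> sobolev 0 T s"
  shows "f \<in> sobolev 0 T (-1)"
  using sobolev_imp_dist_deriv[OF assms] unfolding sobolev_minus_1 by blast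

lemma primitive_sobolev_fun:
  assumes T: "0 < T" and s: "0 \<le> s" "s < 1" and F: "F \<in> L2 0 T"
  shows "(\<lambda>t. integral {0..t} F) \<in> sobolev_fun 0 T s"
  by (rule sobolev_fun_fractional[OF T s L2_primitive[OF F] F integral_has_weak_deriv[OF T F]])

text \<open>The delicate range is \<open>0 \<le> s < 1\<close>: the target order is negative there,
  and \<open>f\<close> has to be rewritten as the derivative of a function of order
  \<open>s\<close>. The primitive has that order by the embedding of H^1.\<close>

lemma sobolev_mono_1:
  assumes T: "0 < T" and s: "0 \<le> s" and f: "f \<in> sobolev 0 T s"
  shows "f \<in> sobolev 0 T (s - 1)"
proof -
  obtain F where F: "F \<in> sobolev_fun 0 T s" "dist_eq 0 T f (regular_dist 0 T F)"
    using f sobolev_nonneg[OF s] by blast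
  show ?thesis
  proof (cases "s < 1")
    case True
    have "(\<lambda>t. integral {0..t} F) \<in> sobolev_fun 0 T (s - 1 + 1)"
      using primitive_sobolev_fun[OF T s True sobolev_fun_L2[OF F(1)]] by simp
    moreover have "-1 \<le> s - 1" "s - 1 < 0" using s True by auto
    ultimately show ?thesis
      using dist_deriv_primitive[OF T sobolev_fun_L2[OF F(1)] F(2)]
      by (subst sobolev_neg) auto
  next
    case False
    then have s1: "0 \<le> s - 1" by simp
    have "F \<in> sobolev_fun 0 T (s - 1 + 1)" using F(1) by simp
    then have "F \<in> sobolev_fun 0 T (s - 1)" by (rule sobolev_fun_mono_1[OF T s1])
    then show ?thesis using F(2) sobolev_nonneg[OF s1] by blast
  qed
qed

text \<open>Induction on \<open>\<lfloor>s + 1\<rfloor>\<close>. For \<open>s < 0\<close> every term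
  of \<open>F - c x - k \<integral> x + C\<close> has order \<open>s + 1\<close>. For
  \<open>s \<ge> 0\<close> the hypothesis at \<open>s - 1\<close> gives \<open>x\<close> order
  \<open>s + 1\<close> and \<open>x'\<close> order \<open>s\<close>, and then
  \<open>x'' = f - c x' - k x\<close> lifts \<open>x'\<close> by one.\<close>

lemma solves_ode_regularity:
  assumes T: "0 < T" and s: "-1 \<le> s" and f: "f \<in> sobolev 0 T s"
    and x: "x \<in> H1 0 T" and ode: "solves_ode T c k f x"
  shows "x \<in> sobolev_fun 0 T (s + 2)"
  using s f ode
proof (induction "nat \<lfloor>s + 1\<rfloor>" arbitrary: s)
  case 0
  have s0: "s < 0" using 0 by linarith
  have s1: "0 \<le> s + 1" "s + 1 < 1" using 0 s0 by auto
  obtain F where F: "F \<in> sobolev_fun 0 T (s + 1)" "dist_eq 0 T f (dist_deriv (regular_dist 0 T F))"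
    using 0 sobolev_neg[OF 0(2) s0] by blast
  note FL = sobolev_fun_L2[OF F(1)]
  obtain C where C: "osc_integral_eq T c k F C x"
    using H1_solves_ode_iff[OF T FL F(2)] x 0 by blast
  have xc: "continuous_on {0..T} x" using C unfolding osc_integral_eq_def by blast
  have xL: "x \<in> L2 0 T" by (rule L2_continuous[OF xc])
  let ?g = "\<lambda>s. F s - c * x s - k * integral {0..s} x + C"
  have g: "?g \<in> L2 0 T" by (rule osc_rhs_L2[OF FL xc])
  have "\<And>t. t \<in> {0..T} \<Longrightarrow> x t = x 0 + integral {0..t} ?g"
    using C unfolding osc_integral_eq_def by blast
  then have w: "has_weak_deriv 0 T 1 x ?g" by (rule primitive_has_weak_deriv[OF T g])
  have xS: "x \<in> sobolev_fun 0 T (s + 1)"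
    by (rule sobolev_fun_fractional[OF T s1 xL g w])
  have CS: "(\<lambda>_. C) \<in> sobolev_fun 0 T (s + 1)"
    by (rule sobolev_fun_fractional[OF T s1 L2_const L2_const const_has_weak_deriv[OF T]])
  have "?g \<in> sobolev_fun 0 T (s + 1)"
    by (intro sobolev_fun_add[OF T _ CS] sobolev_fun_diff[OF T] sobolev_fun_cmult F(1) xS
        primitive_sobolev_fun[OF T s1 xL])
  then have "x \<in> sobolev_fun 0 T (s + 1 + 1)"
    by (rule sobolev_fun_of_weak_deriv[OF T s1(1) xL _ w])
  then show ?case by (simp add: add.assoc)
next
  case (Suc n)
  have s0: "0 \<le> s" using Suc(2) by linarith
  have s1: "0 \<le> s + 1" using s0 by simp
  obtain F where F: "F \<in> sobolev_fun 0 T s" "dist_eq 0 T f (regular_dist 0 T F)"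
    using Suc(4) sobolev_nonneg[OF s0] by blast
  have "n = nat \<lfloor>s - 1 + 1\<rfloor>" "-1 \<le> s - 1" using Suc(2) s0 by linarith+
  then have "x \<in> sobolev_fun 0 T (s - 1 + 2)"
    using Suc(1)[of "s - 1"] sobolev_mono_1[OF T s0 Suc(4)] Suc(5) by blast
  moreover have "s - 1 + 2 = s + 1" by simp
  ultimately have x1: "x \<in> sobolev_fun 0 T (s + 1)" by (simp only:)
  obtain g where g: "g \<in> sobolev_fun 0 T s" "has_weak_deriv 0 T 1 x g"
    using sobolev_fun_weak_deriv[OF T s0 x1] by blast
  let ?r = "\<lambda>t. F t - c * g t - k * x t"
  have r: "?r \<in> sobolev_fun 0 T s"
    by (intro sobolev_fun_diff[OF T] sobolev_fun_cmult F(1) g(1) sobolev_fun_mono_1[OF T s0 x1])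
  have "has_weak_deriv 0 T 1 g ?r"
    unfolding has_weak_deriv_1 dist_eq_def
  proof
    fix \<phi> assume \<phi>: "\<phi> \<in> test_functions 0 T"
    note d = test_function_deriv[OF \<phi> T]
    have G: "regular_dist 0 T g \<eta> = - regular_dist 0 T x (deriv \<eta>)" if "\<eta> \<in> test_functions 0 T" for \<eta>
      by (rule has_weak_derivD[OF g(2) that])
    note L = sobolev_fun_L2[OF F(1)] sobolev_fun_L2[OF g(1)] sobolev_fun_L2[OF x1]
    have "regular_dist 0 T ?r \<phi> = regular_dist 0 T F \<phi> - c * regular_dist 0 T g \<phi> - k * regular_dist 0 T x \<phi>"
      by (simp add: regular_dist_diff[OF L2_diff[OF L(1) L2_cmult[OF L(2)]] L2_cmult[OF L(3)] \<phi>]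
          regular_dist_diff[OF L(1) L2_cmult[OF L(2)] \<phi>] regular_dist_cmult)
    moreover have "osc_dist T c k x \<phi> = regular_dist 0 T F \<phi>"
      using Suc(5) F(2) \<phi> unfolding solves_ode_iff dist_eq_def by simp
    ultimately show "regular_dist 0 T ?r \<phi> = dist_deriv (regular_dist 0 T g) \<phi>"
      using G[OF \<phi>] G[OF d] by (simp add: osc_dist_def dist_deriv_def)
  qed
  then have "g \<in> sobolev_fun 0 T (s + 1)"
    by (rule sobolev_fun_of_weak_deriv[OF T s0 sobolev_fun_L2[OF g(1)] r])
  then have "x \<in> sobolev_fun 0 T (s + 1 + 1)"
    by (rule sobolev_fun_of_weak_deriv[OF T s1 sobolev_fun_L2[OF x1] _ g(2)])
  then show ?case by (simp add: add.assoc)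
qed

section \<open>Regularity at the initial time\<close>

lemma regular_dist_restrict:
  assumes d: "0 < d" "d \<le> T" and F: "F \<in> L2 0 T" and \<phi>: "\<phi> \<in> test_functions 0 d"
  shows "regular_dist 0 T F \<phi> = regular_dist 0 d F \<phi>"
proof -
  have \<phi>T: "\<phi> \<in> test_functions 0 T" using test_function_mono[OF \<phi>] d by simp
  obtain p q where pq: "smooth \<phi>" "0 < p" "p \<le> q" "q < d" "\<And>t. t \<notin> {p..q} \<Longrightarrow> \<phi> t = 0"
    using test_functionE[OF \<phi> d(1)] by blast
  have "integral {0..d} (\<lambda>t. F t * \<phi> t) + integral {d..T} (\<lambda>t. F t * \<phi> t) = integral {0..T} (\<lambda>t. F t * \<phi> t)"
    using d by (intro Henstock_Kurzweil_Integration.integral_combine L2_mult_test_integrable F \<phi>T) auto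
  moreover have "integral {d..T} (\<lambda>t. F t * \<phi> t) = integral {d..T} (\<lambda>_. 0)"
    by (rule integral_cong) (use pq(4) in \<open>simp add: pq(5)\<close>)
  ultimately show ?thesis
    using regular_dist_test[OF F \<phi>T] regular_dist_test[OF L2_subinterval[OF F] \<phi>] d by simp
qed

text \<open>Near 0 the forcing is the derivative of some \<open>G\<close> with finite seminorm of
  order above 1/2. There \<open>F\<close> differs from \<open>G\<close> by a constant, which the
  seminorm does not see.\<close>

lemma regular_at_ends_average:
  assumes T: "0 < T" and F: "F \<in> L2 0 T" and f: "dist_eq 0 T f (dist_deriv (regular_dist 0 T F))"
    and reg: "regular_at_ends T f"
  obtains L where "((\<lambda>t. integral {0..t} F / t) \<longlongrightarrow> L) (at_right 0)"
proof -
  obtain \<epsilon> d where \<epsilon>: "0 < \<epsilon>" and d: "0 < d" "d \<le> T" and fd: "f \<in> sobolev 0 d (- 1/2 + \<epsilon>)"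
    using reg unfolding regular_at_ends_def by blast
  have Fd: "F \<in> L2 0 d" using L2_subinterval[OF F] d by simp
  have fF: "dist_eq 0 d f (dist_deriv (regular_dist 0 d F))"
    unfolding dist_eq_def
  proof
    fix \<phi> assume \<phi>: "\<phi> \<in> test_functions 0 d"
    have "\<phi> \<in> test_functions 0 T" using test_function_mono[OF \<phi>] d by simp
    then have "f \<phi> = - regular_dist 0 T F (deriv \<phi>)" using f unfolding dist_eq_def dist_deriv_def by blast
    then show "f \<phi> = dist_deriv (regular_dist 0 d F) \<phi>"
      using regular_dist_restrict[OF d F test_function_deriv[OF \<phi> d(1)]] by (simp add: dist_deriv_def)
  qed
  have "\<exists>\<sigma> G. 1/2 < \<sigma> \<and> G \<in> L2 0 d \<and> finite_gagliardo 0 d \<sigma> G \<and> dist_eq 0 d f (dist_deriv (regular_dist 0 d G))"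
  proof (cases "\<epsilon> < 1/2")
    case True
    obtain G where G: "G \<in> sobolev_fun 0 d (- 1/2 + \<epsilon> + 1)" "dist_eq 0 d f (dist_deriv (regular_dist 0 d G))"
      using fd sobolev_neg[of "- 1/2 + \<epsilon>" f 0 d] \<epsilon> True by auto
    let ?\<sigma> = "- 1/2 + \<epsilon> + 1"
    have fl: "\<lfloor>?\<sigma>\<rfloor> = 0" "frac ?\<sigma> = ?\<sigma>" using \<epsilon> True by (auto simp: frac_eq floor_eq_iff)
    \<comment> \<open>\<open>sobolev_fun\<close> attaches the seminorm to a weak derivative of order
      0, which agrees with \<open>G\<close> only almost everywhere.\<close>
    then obtain g where g: "g \<in> L2 0 d" "has_weak_deriv 0 d 0 G g" "finite_gagliardo 0 d ?\<sigma> g"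
      using G(1) \<epsilon> unfolding sobolev_fun_def by auto
    have "dist_eq 0 d (regular_dist 0 d g) (regular_dist 0 d G)"
      using g(2) by (simp add: has_weak_deriv_def)
    then have "AE t in lebesgue. t \<in> {0<..<d} \<longrightarrow> g t = G t"
      by (rule regular_dist_inj[OF d(1) g(1) sobolev_fun_L2[OF G(1)]])
    then have "finite_gagliardo 0 d ?\<sigma> G" using g(3) by (rule finite_gagliardo_cong_AE)
    moreover have "1/2 < ?\<sigma>" using \<epsilon> by simp
    ultimately show ?thesis using G sobolev_fun_L2 by blast
  next
    case False
    then have "0 \<le> - 1/2 + \<epsilon>" by simp
    then obtain H where H: "H \<in> sobolev_fun 0 d (- 1/2 + \<epsilon>)" "dist_eq 0 d f (regular_dist 0 d H)"
      using fd sobolev_nonneg by blast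
    have HL: "H \<in> L2 0 d" using H(1) by (rule sobolev_fun_L2)
    \<comment> \<open>Here \<open>f\<close> is an L^2 function near 0, and its primitive has every
      order in \<open>[0, 1)\<close>; 3/4 is one that exceeds 1/2.\<close>
    have "finite_gagliardo 0 d (3/4) (\<lambda>t. integral {0..t} H)"
      by (rule finite_gagliardo_primitive[OF d(1) HL, of _ 0]) auto
    moreover have "(1/2::real) < 3/4" by simp
    ultimately show ?thesis
      using L2_primitive[OF HL]
        dist_deriv_primitive[OF d(1) HL H(2)] by blast
  qed
  then obtain \<sigma> G where G: "1/2 < \<sigma>" "G \<in> L2 0 d" "finite_gagliardo 0 d \<sigma> G"
    "dist_eq 0 d f (dist_deriv (regular_dist 0 d G))" by blast
  have "dist_eq 0 d (dist_deriv (regular_dist 0 d G)) (dist_deriv (regular_dist 0 d F))"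
    using fF G(4) unfolding dist_eq_def by simp
  then obtain C where C: "AE t in lebesgue. t \<in> {0<..<d} \<longrightarrow> G t = F t + C"
    using dist_deriv_regular_eq_imp[OF d(1) G(2) Fd] by blast
  have "finite_gagliardo 0 d \<sigma> (\<lambda>t. F t + C)" by (rule finite_gagliardo_cong_AE[OF C G(3)])
  then have "finite_gagliardo 0 d \<sigma> F" by (simp add: finite_gagliardo_def)
  then show ?thesis using finite_gagliardo_average_tendsto[OF d(1) Fd G(1)] that by blast
qed

section \<open>Boundary value and initial value problems\<close>

text \<open>Underdamping in the form in which it is used: a nonzero real frequency
  \<open>\<omega>\<close>, with \<open>k\<close> expressed through it so that the algebraic
  identities can be checked by rewriting.\<close>

locale damped_oscillator =
  fixes T k c \<omega> :: real
  assumes T: "0 < T" and omega: "\<omega> \<noteq> 0" and k_eq: "k = \<omega>\<^sup>2 + c\<^sup>2 / 4"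
begin

text \<open>The two solutions may carry different constants in their integral equations, but
  \<open>F\<close> cancels in the difference, which is therefore a homogeneous solution.\<close>

lemma homogeneous_difference:
  assumes f: "f \<in> sobolev 0 T (-1)"
    and x: "x \<in> H1 0 T" "solves_ode T c k f x" and y: "y \<in> H1 0 T" "solves_ode T c k f y"
  obtains B where "\<And>t. t \<in> {0..T} \<Longrightarrow> y t - x t = (y 0 - x 0) * osc_cos c \<omega> t + B * osc_sin c \<omega> t"
proof -
  obtain F where F: "F \<in> L2 0 T" "dist_eq 0 T f (dist_deriv (regular_dist 0 T F))"
    using f unfolding sobolev_minus_1 by blast
  obtain C D where "osc_integral_eq T c k F C x" "osc_integral_eq T c k F D y"
    using H1_solves_ode_iff[OF T F] x y by metis
  then have "osc_integral_eq T c k (\<lambda>t. F t + (-1) * F t) (D + (-1) * C) (\<lambda>t. y t + (-1) * x t)"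
    by (intro osc_integral_eq_lin F)
  then have "osc_integral_eq T c k (\<lambda>_. 0) (D - C) (\<lambda>t. y t - x t)" by simp
  from osc_homogeneous_unique[OF T omega k_eq this] that show ?thesis by blast
qed

text \<open>As \<open>x\<close> and \<open>osc_sin\<close> vanish at 0, \<open>\<alpha>\<close> is
  the initial value; \<open>\<beta>\<close> is left for either the final value or the initial
  velocity.\<close>

lemma solution_family:
  assumes F: "F \<in> L2 0 T"
  obtains x where "x 0 = 0"
    "\<And>\<alpha> \<beta>. \<exists>C. osc_integral_eq T c k F C (\<lambda>t. x t + \<alpha> * osc_cos c \<omega> t + \<beta> * osc_sin c \<omega> t)"
proof -
  obtain x where x: "osc_integral_eq T c k F 0 x" "x 0 = 0"
    using osc_particular[OF T F omega k_eq] by blast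
  obtain C D where CD: "osc_integral_eq T c k (\<lambda>_. 0) C (osc_cos c \<omega>)" "osc_integral_eq T c k (\<lambda>_. 0) D (osc_sin c \<omega>)"
    using osc_homogeneous[OF k_eq] by blast
  have fam: "osc_integral_eq T c k (\<lambda>t. F t + \<beta> * 0) (0 + \<alpha> * C + \<beta> * D) (\<lambda>t. x t + \<alpha> * osc_cos c \<omega> t + \<beta> * osc_sin c \<omega> t)" for \<alpha> \<beta>
  proof -
    have "osc_integral_eq T c k (\<lambda>t. F t + \<alpha> * 0) (0 + \<alpha> * C) (\<lambda>t. x t + \<alpha> * osc_cos c \<omega> t)"
      by (rule osc_integral_eq_lin[OF F L2_const x(1) CD(1)])
    then have "osc_integral_eq T c k F (0 + \<alpha> * C) (\<lambda>t. x t + \<alpha> * osc_cos c \<omega> t)" by simp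
    then show ?thesis by (rule osc_integral_eq_lin[OF F L2_const _ CD(2)])
  qed
  have "\<exists>C. osc_integral_eq T c k F C (\<lambda>t. x t + \<alpha> * osc_cos c \<omega> t + \<beta> * osc_sin c \<omega> t)" for \<alpha> \<beta>
    using fam[of \<beta> \<alpha>] by (intro exI[of _ "0 + \<alpha> * C + \<beta> * D"]) simp
  then show ?thesis by (rule that[of x, OF x(2)])
qed

text \<open>The difference of two solutions is a multiple of \<open>osc_sin\<close>, which is
  nonzero at \<open>T\<close> precisely off the exceptional set.\<close>

lemma bvp_unique:
  assumes res: "sin (\<omega> * T) \<noteq> 0" and f: "f \<in> sobolev 0 T (-1)"
    and x: "solves_bvp T c k f x0 xT x" and y: "solves_bvp T c k f x0 xT y" and t: "t \<in> {0..T}"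
  shows "y t = x t"
proof -
  obtain B where B: "\<And>t. t \<in> {0..T} \<Longrightarrow> y t - x t = (y 0 - x 0) * osc_cos c \<omega> t + B * osc_sin c \<omega> t"
    using homogeneous_difference[OF f, of x y] x y unfolding solves_bvp_def by blast
  have "B * osc_sin c \<omega> T = 0" using B[of T] x y T by (simp add: solves_bvp_def)
  then have "B = 0" using res by (simp add: osc_sin_def)
  then show ?thesis using B[OF t] x y by (simp add: solves_bvp_def)
qed

lemma bvp_exists:
  assumes res: "sin (\<omega> * T) \<noteq> 0" and f: "f \<in> sobolev 0 T (-1)"
  obtains x where "solves_bvp T c k f x0 xT x"
proof -
  obtain F where F: "F \<in> L2 0 T" "dist_eq 0 T f (dist_deriv (regular_dist 0 T F))"
    using f unfolding sobolev_minus_1 by blast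
  obtain x where x: "x 0 = 0"
    "\<And>\<alpha> \<beta>. \<exists>C. osc_integral_eq T c k F C (\<lambda>t. x t + \<alpha> * osc_cos c \<omega> t + \<beta> * osc_sin c \<omega> t)"
    using solution_family[OF F(1)] by blast
  define \<beta> where "\<beta> = (xT - x T - x0 * osc_cos c \<omega> T) / osc_sin c \<omega> T"
  have "osc_sin c \<omega> T \<noteq> 0" using res by (simp add: osc_sin_def)
  then have "x T + x0 * osc_cos c \<omega> T + \<beta> * osc_sin c \<omega> T = xT" by (simp add: \<beta>_def)
  moreover have "x 0 + x0 * osc_cos c \<omega> 0 + \<beta> * osc_sin c \<omega> 0 = x0" using x(1) by simp
  ultimately have "solves_bvp T c k f x0 xT (\<lambda>t. x t + x0 * osc_cos c \<omega> t + \<beta> * osc_sin c \<omega> t)"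
    using x(2)[of x0 \<beta>] H1_solves_ode_iff[OF T F] unfolding solves_bvp_def by blast
  then show ?thesis by (rule that)
qed

text \<open>Here the remaining coefficient is detected by the derivative \<open>B * \<omega>\<close>
  at 0 instead of the value at \<open>T\<close>.\<close>

lemma ivp_unique:
  assumes f: "f \<in> sobolev 0 T (-1)"
    and x: "solves_ivp T c k f x0 p x" and y: "solves_ivp T c k f x0 p y" and t: "t \<in> {0..T}"
  shows "y t = x t"
proof -
  obtain B where B: "\<And>t. t \<in> {0..T} \<Longrightarrow> y t - x t = (y 0 - x 0) * osc_cos c \<omega> t + B * osc_sin c \<omega> t"
    using homogeneous_difference[OF f, of x y] x y unfolding solves_ivp_def by blast
  have B': "y t - x t = B * osc_sin c \<omega> t" if "t \<in> {0..T}" for t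
    using B[OF that] x y by (simp add: solves_ivp_def)
  have "((\<lambda>t. y t - x t) has_real_derivative p - p) (at 0 within {0..T})"
    using x y unfolding solves_ivp_def by (intro DERIV_diff) auto
  then have "((\<lambda>t. B * osc_sin c \<omega> t) has_real_derivative p - p) (at 0 within {0..T})"
    by (rule has_field_derivative_transform_within[where d=1]) (use T B' in auto)
  moreover have "((\<lambda>t. B * osc_sin c \<omega> t) has_real_derivative B * \<omega>) (at 0 within {0..T})"
    using has_field_derivative_at_within[OF DERIV_cmult[OF osc_DERIV(2)[of c \<omega> 0], of B]] by simp
  ultimately have "p - p = B * \<omega>" by (rule at_0_within_unique[OF T])
  then have "B = 0" using omega by simp
  then show ?thesis using B'[OF t] by simp
qed

lemma solution_differentiable_at_0:
  assumes f: "f \<in> sobolev 0 T (-1)" and reg: "regular_at_ends T f"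
    and x: "x \<in> H1 0 T" "solves_ode T c k f x"
  obtains p where "(x has_real_derivative p) (at 0 within {0..T})"
proof -
  obtain F where F: "F \<in> L2 0 T" "dist_eq 0 T f (dist_deriv (regular_dist 0 T F))"
    using f unfolding sobolev_minus_1 by blast
  obtain L where L: "((\<lambda>t. integral {0..t} F / t) \<longlongrightarrow> L) (at_right 0)"
    using regular_at_ends_average[OF T F reg] by blast
  obtain C where "osc_integral_eq T c k F C x" using H1_solves_ode_iff[OF T F] x by blast
  then show ?thesis using osc_derivative_at_0[OF T F(1) L] that by blast
qed

lemma ivp_exists:
  assumes f: "f \<in> sobolev 0 T (-1)" and reg: "regular_at_ends T f"
  obtains x where "solves_ivp T c k f x0 p x"
proof -
  obtain F where F: "F \<in> L2 0 T" "dist_eq 0 T f (dist_deriv (regular_dist 0 T F))"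
    using f unfolding sobolev_minus_1 by blast
  obtain x where x: "x 0 = 0"
    "\<And>\<alpha> \<beta>. \<exists>C. osc_integral_eq T c k F C (\<lambda>t. x t + \<alpha> * osc_cos c \<omega> t + \<beta> * osc_sin c \<omega> t)"
    using solution_family[OF F(1)] by blast
  obtain C where C: "osc_integral_eq T c k F C (\<lambda>t. x t + 0 * osc_cos c \<omega> t + 0 * osc_sin c \<omega> t)"
    using x(2) by blast
  then have "osc_integral_eq T c k F C x" by simp
  then have "x \<in> H1 0 T" "solves_ode T c k f x" using H1_solves_ode_iff[OF T F] by blast+
  then obtain q where q: "(x has_real_derivative q) (at 0 within {0..T})"
    using solution_differentiable_at_0[OF f reg] by blast
  \<comment> \<open>Solves \<open>q - x0 * c / 2 + \<beta> * \<omega> = p\<close>: at 0 the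
    derivative of \<open>osc_cos\<close> is \<open>- c / 2\<close> and that of
    \<open>osc_sin\<close> is \<open>\<omega>\<close>.\<close>
  define \<beta> where "\<beta> = (p - q + x0 * c / 2) / \<omega>"
  have dc: "((\<lambda>t. x0 * osc_cos c \<omega> t) has_real_derivative x0 * (- c / 2 * osc_cos c \<omega> 0 - \<omega> * osc_sin c \<omega> 0)) (at 0 within {0..T})"
    by (rule has_field_derivative_at_within[OF DERIV_cmult[OF osc_DERIV(1)]])
  have ds: "((\<lambda>t. \<beta> * osc_sin c \<omega> t) has_real_derivative \<beta> * (- c / 2 * osc_sin c \<omega> 0 + \<omega> * osc_cos c \<omega> 0)) (at 0 within {0..T})"
    by (rule has_field_derivative_at_within[OF DERIV_cmult[OF osc_DERIV(2)]])
  have "q + x0 * (- c / 2 * osc_cos c \<omega> 0 - \<omega> * osc_sin c \<omega> 0) + \<beta> * (- c / 2 * osc_sin c \<omega> 0 + \<omega> * osc_cos c \<omega> 0) = p"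
    using omega by (simp add: \<beta>_def)
  then have "((\<lambda>t. x t + x0 * osc_cos c \<omega> t + \<beta> * osc_sin c \<omega> t) has_real_derivative p) (at 0 within {0..T})"
    using DERIV_add[OF DERIV_add[OF q dc] ds] by simp
  moreover have "x 0 + x0 * osc_cos c \<omega> 0 + \<beta> * osc_sin c \<omega> 0 = x0" using x(1) by simp
  ultimately have "solves_ivp T c k f x0 p (\<lambda>t. x t + x0 * osc_cos c \<omega> t + \<beta> * osc_sin c \<omega> t)"
    using x(2)[of x0 \<beta>] H1_solves_ode_iff[OF T F] unfolding solves_ivp_def by blast
  then show ?thesis by (rule that)
qed

text \<open>Uniqueness for the initial value problem is what makes the \<open>THE\<close> in
  \<open>boundary_map\<close> denote.\<close>

lemma boundary_map_eq:
  assumes f: "f \<in> sobolev 0 T (-1)" and x: "solves_ivp T c k f x0 p x"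
  shows "boundary_map c k f T x0 p = x T"
  unfolding boundary_map_def
proof (rule the_equality)
  show "\<exists>x'. solves_ivp T c k f x0 p x' \<and> x' T = x T" using x by blast
  fix y assume "\<exists>x'. solves_ivp T c k f x0 p x' \<and> x' T = y"
  then obtain x' where "solves_ivp T c k f x0 p x'" "x' T = y" by blast
  then show "y = x T" using ivp_unique[OF f x, of x' T] T by simp
qed

lemma ivp_imp_bvp:
  assumes f: "f \<in> sobolev 0 T (-1)" and x: "solves_ivp T c k f x0 p x"
  shows "solves_bvp T c k f x0 (boundary_map c k f T x0 p) x"
  using x boundary_map_eq[OF f x] by (simp add: solves_ivp_def solves_bvp_def)

text \<open>Injective: equal end values give the same boundary value problem, hence the same
  solution, hence the same velocity. Surjective: solve the boundary value problem and read off the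
  velocity at 0, which exists by the regularity of the forcing there.\<close>

lemma bij_boundary_map:
  assumes res: "sin (\<omega> * T) \<noteq> 0" and f: "f \<in> sobolev 0 T (-1)" and reg: "regular_at_ends T f"
  shows "bij (\<lambda>(x0, p). (x0, boundary_map c k f T x0 p))"
proof (rule bijI)
  show "inj (\<lambda>(x0, p). (x0, boundary_map c k f T x0 p))"
  proof (rule injI)
    fix z w :: "real \<times> real"
    assume e: "(case z of (x0, p) \<Rightarrow> (x0, boundary_map c k f T x0 p)) =
      (case w of (x0, p) \<Rightarrow> (x0, boundary_map c k f T x0 p))"
    obtain x0 p where z: "z = (x0, p)" by (cases z)
    obtain q where w: "w = (x0, q)" and eq: "boundary_map c k f T x0 p = boundary_map c k f T x0 q"
      using e z by (cases w) auto
    obtain x where x: "solves_ivp T c k f x0 p x" using ivp_exists[OF f reg] by blast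
    obtain y where y: "solves_ivp T c k f x0 q y" using ivp_exists[OF f reg] by blast
    have "y t = x t" if "t \<in> {0..T}" for t
      using bvp_unique[OF res f ivp_imp_bvp[OF f x] _ that] ivp_imp_bvp[OF f y] eq by simp
    moreover have "(x has_real_derivative p) (at 0 within {0..T})" using x by (simp add: solves_ivp_def)
    ultimately have "(y has_real_derivative p) (at 0 within {0..T})"
      using T by (elim has_field_derivative_transform_within[where d=1]) auto
    then have "p = q" using y at_0_within_unique[OF T] by (simp add: solves_ivp_def)
    then show "z = w" by (simp add: z w)
  qed
  show "surj (\<lambda>(x0, p). (x0, boundary_map c k f T x0 p))"
    unfolding surj_def
  proof
    fix z :: "real \<times> real"
    obtain x0 xT where z: "z = (x0, xT)" by (cases z)
    obtain x where x: "solves_bvp T c k f x0 xT x" using bvp_exists[OF res f] by blast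
    then obtain p where "(x has_real_derivative p) (at 0 within {0..T})"
      using solution_differentiable_at_0[OF f reg] unfolding solves_bvp_def by blast
    then have "solves_ivp T c k f x0 p x" using x by (simp add: solves_bvp_def solves_ivp_def)
    then have "boundary_map c k f T x0 p = xT" using boundary_map_eq[OF f] x by (simp add: solves_bvp_def)
    then show "\<exists>w. z = (case w of (x0, p) \<Rightarrow> (x0, boundary_map c k f T x0 p))"
      unfolding z by (intro exI[of _ "(x0, p)"]) simp
  qed
qed

lemma weak_form_iff_solves_bvp:
  assumes f: "f \<in> sobolev 0 T (-1)" and v: "v \<in> H1 0 T"
  shows "u \<in> H1_0 0 T \<and> weak_form T c k f v u \<longleftrightarrow> solves_bvp T c k f (v 0) (v T) (\<lambda>t. u t + v t)"
proof -
  \<comment> \<open>Used with \<open>m = 1\<close> and \<open>m = -1\<close>: adding and removing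
    \<open>v\<close> keeps functions in H^1.\<close>
  have add: "(\<lambda>t. x t + m * y t) \<in> H1 0 T" if "x \<in> H1 0 T" "y \<in> H1 0 T" for x y m
    using that sobolev_fun_add[OF T _ sobolev_fun_cmult] unfolding H1_def by (auto intro!: continuous_intros)
  have "u \<in> H1 0 T \<longleftrightarrow> (\<lambda>t. u t + v t) \<in> H1 0 T"
    using add[OF _ v, of u 1] add[OF _ v, of "\<lambda>t. u t + v t" "-1"] by auto
  then show ?thesis
    using weak_form_iff_solves_ode[OF T f _ v, of u c k] unfolding H1_0_def solves_bvp_def by auto
qed

text \<open>The initial value problem has a solution \<open>y\<close> with the same end values;
  uniqueness for the boundary value problem identifies it with \<open>u + v\<close>, which thereby
  inherits the velocity \<open>p\<close>.\<close>

lemma weak_form_iff_solves_ivp: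
  assumes res: "sin (\<omega> * T) \<noteq> 0" and f: "f \<in> sobolev 0 T (-1)" and reg: "regular_at_ends T f"
    and v: "v \<in> H1 0 T" "v 0 = x0" "v T = boundary_map c k f T x0 p"
  shows "u \<in> H1_0 0 T \<and> weak_form T c k f v u \<longleftrightarrow> solves_ivp T c k f x0 p (\<lambda>t. u t + v t)"
proof -
  let ?x = "\<lambda>t. u t + v t"
  have "solves_bvp T c k f x0 (boundary_map c k f T x0 p) ?x \<longleftrightarrow> solves_ivp T c k f x0 p ?x"
  proof
    assume b: "solves_bvp T c k f x0 (boundary_map c k f T x0 p) ?x"
    obtain y where y: "solves_ivp T c k f x0 p y" using ivp_exists[OF f reg] by blast
    have eq: "y t = ?x t" if "t \<in> {0..T}" for t
      by (rule bvp_unique[OF res f b ivp_imp_bvp[OF f y] that])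
    have "(y has_real_derivative p) (at 0 within {0..T})" using y by (simp add: solves_ivp_def)
    then have "(?x has_real_derivative p) (at 0 within {0..T})"
      by (rule has_field_derivative_transform_within[where d=1]) (use T eq in auto)
    then show "solves_ivp T c k f x0 p ?x" using b by (simp add: solves_ivp_def solves_bvp_def)
  qed (rule ivp_imp_bvp[OF f])
  then show ?thesis using weak_form_iff_solves_bvp[OF f v(1), of u] v by simp
qed

end

theorem theorem4p3:
  fixes T k c \<omega>\<^sub>d :: real
  assumes T: "0 < T" and k: "0 < k" and c: "0 \<le> c" "c < 2 * sqrt k"
    and \<omega>: "\<omega>\<^sub>d = sqrt (k - c\<^sup>2 / 4)"
  shows
    "(\<forall>f \<in> sobolev 0 T (-1). \<forall>x0 xT. \<forall>v \<in> H1 0 T. v 0 = x0 \<longrightarrow> v T = xT \<longrightarrow>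
        (\<forall>u. u \<in> H1_0 0 T \<and> weak_form T c k f v u \<longleftrightarrow>
             solves_bvp T c k f x0 xT (\<lambda>t. u t + v t)))
   \<and> (T \<notin> {\<tau>. sin (\<omega>\<^sub>d * \<tau>) = 0} \<longrightarrow>
        (\<forall>x0 xT. \<forall>v \<in> H1 0 T. v 0 = x0 \<longrightarrow> v T = xT \<longrightarrow>
          (\<forall>f \<in> sobolev 0 T (-1).
             \<exists>u \<in> H1_0 0 T. weak_form T c k f v u \<and>
               (\<forall>u' \<in> H1_0 0 T. weak_form T c k f v u' \<longrightarrow> (\<forall>t\<in>{0..T}. u' t = u t))))
      \<and> (\<forall>x0 xT s. \<forall>v \<in> H1 0 T. v 0 = x0 \<longrightarrow> v T = xT \<longrightarrow> s \<ge> -1 \<longrightarrow>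
          (\<forall>f \<in> sobolev 0 T s. \<forall>u \<in> H1_0 0 T. weak_form T c k f v u \<longrightarrow>
             (\<lambda>t. u t + v t) \<in> sobolev_fun 0 T (s + 2) \<and>
             (v \<in> Cr 0 T (s + 2) \<or> v \<in> sobolev_fun 0 T (s + 2) \<longrightarrow>
                u \<in> sobolev_fun 0 T (s + 2))))
      \<and> (\<forall>s \<ge> -1. \<forall>f \<in> sobolev 0 T s. regular_at_ends T f \<longrightarrow>
          (\<forall>x0 p. \<exists>x. solves_ivp T c k f x0 p x \<and>
             (\<forall>x'. solves_ivp T c k f x0 p x' \<longrightarrow> (\<forall>t\<in>{0..T}. x' t = x t)))
        \<and> bij_betw (\<lambda>(x0, p). (x0, boundary_map c k f T x0 p)) UNIV
             {(v 0, v T) | v. v \<in> Cr 0 T (s + 2)}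
        \<and> (\<forall>x0 p. \<forall>v \<in> Cr 0 T (s + 2). v 0 = x0 \<longrightarrow> v T = boundary_map c k f T x0 p \<longrightarrow>
             (\<forall>u. u \<in> H1_0 0 T \<and> weak_form T c k f v u \<longleftrightarrow>
                  solves_ivp T c k f x0 p (\<lambda>t. u t + v t)))))"
proof -
  \<comment> \<open>Squaring the underdamping condition makes the radicand of
    \<open>\<omega>\<^sub>d\<close> positive.\<close>
  have "c\<^sup>2 < (2 * sqrt k)\<^sup>2" using c by (intro power_strict_mono) auto
  then have pos: "0 < k - c\<^sup>2 / 4" using k by (simp add: power_mult_distrib)
  interpret damped_oscillator T k c \<omega>\<^sub>d
    by unfold_locales (use T pos \<omega> in auto)
  note sub = sobolev_subset_minus_1[OF T]
  show ?thesis
  proof (intro conjI impI allI ballI)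
    fix f x0 xT v u
    assume "f \<in> sobolev 0 T (-1)" "v \<in> H1 0 T" "v 0 = x0" "v T = xT"
    then show "u \<in> H1_0 0 T \<and> weak_form T c k f v u \<longleftrightarrow> solves_bvp T c k f x0 xT (\<lambda>t. u t + v t)"
      using weak_form_iff_solves_bvp by blast
  next
    assume "T \<notin> {\<tau>. sin (\<omega>\<^sub>d * \<tau>) = 0}"
    then have res: "sin (\<omega>\<^sub>d * T) \<noteq> 0" by simp
    fix v f assume v: "v \<in> H1 0 T" and f: "f \<in> sobolev 0 T (-1)"
    obtain x where x: "solves_bvp T c k f (v 0) (v T) x" using bvp_exists[OF res f] by blast
    let ?u = "\<lambda>t. x t - v t"
    have "?u \<in> H1_0 0 T \<and> weak_form T c k f v ?u"
      using weak_form_iff_solves_bvp[OF f v, of ?u] x by simp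
    moreover have "u' t = ?u t" if "u' \<in> H1_0 0 T" "weak_form T c k f v u'" "t \<in> {0..T}" for u' t
      using bvp_unique[OF res f x _ that(3), of "\<lambda>t. u' t + v t"] weak_form_iff_solves_bvp[OF f v, of u'] that by simp
    ultimately show "\<exists>u \<in> H1_0 0 T. weak_form T c k f v u \<and>
        (\<forall>u' \<in> H1_0 0 T. weak_form T c k f v u' \<longrightarrow> (\<forall>t\<in>{0..T}. u' t = u t))"
      by blast
  next
    fix s v f u
    assume v: "v \<in> H1 0 T" and s: "-1 \<le> s" and f: "f \<in> sobolev 0 T s"
      and u: "u \<in> H1_0 0 T" "weak_form T c k f v u"
    have "solves_bvp T c k f (v 0) (v T) (\<lambda>t. u t + v t)"
      using weak_form_iff_solves_bvp[OF sub[OF s f] v] u by blast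
    \<comment> \<open>Regularity is first that of \<open>u + v\<close>; it passes to
      \<open>u\<close> once \<open>v\<close> has the same order.\<close>
    then show x: "(\<lambda>t. u t + v t) \<in> sobolev_fun 0 T (s + 2)"
      using solves_ode_regularity[OF T s f] unfolding solves_bvp_def by blast
    assume "v \<in> Cr 0 T (s + 2) \<or> v \<in> sobolev_fun 0 T (s + 2)"
    then have "v \<in> sobolev_fun 0 T (s + 2)" using Cr_subset_sobolev_fun[OF T, of "s + 2"] s by auto
    then have "(\<lambda>t. u t + v t - v t) \<in> sobolev_fun 0 T (s + 2)" by (rule sobolev_fun_diff[OF T x])
    then show "u \<in> sobolev_fun 0 T (s + 2)" by simp
  next
    assume "T \<notin> {\<tau>. sin (\<omega>\<^sub>d * \<tau>) = 0}"
    then have res: "sin (\<omega>\<^sub>d * T) \<noteq> 0" by simp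
    fix s f assume s: "-1 \<le> s" and "f \<in> sobolev 0 T s" and reg: "regular_at_ends T f"
    then have f: "f \<in> sobolev 0 T (-1)" using sub by blast
    show "\<exists>x. solves_ivp T c k f x0 p x \<and>
        (\<forall>x'. solves_ivp T c k f x0 p x' \<longrightarrow> (\<forall>t\<in>{0..T}. x' t = x t))" for x0 p
    proof -
      obtain x where x: "solves_ivp T c k f x0 p x" using ivp_exists[OF f reg] by blast
      then show ?thesis using ivp_unique[OF f x] by blast
    qed
    \<comment> \<open>The affine interpolant realises every pair of boundary values, so the target
      of the bijection is the whole plane.\<close>
    have "\<exists>v. (x0, xT) = (v 0, v T) \<and> v \<in> Cr 0 T (s + 2)" for x0 xT
      using T by (intro exI[of _ "\<lambda>t. x0 + (xT - x0) / T * t"] conjI affine_in_Cr) simp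
    then have "{(v 0, v T) | v. v \<in> Cr 0 T (s + 2)} = UNIV" by auto
    then show "bij_betw (\<lambda>(x0, p). (x0, boundary_map c k f T x0 p)) UNIV {(v 0, v T) | v. v \<in> Cr 0 T (s + 2)}"
      using bij_boundary_map[OF res f reg] by simp
    show "u \<in> H1_0 0 T \<and> weak_form T c k f v u \<longleftrightarrow> solves_ivp T c k f x0 p (\<lambda>t. u t + v t)"
      if v: "v \<in> Cr 0 T (s + 2)" "v 0 = x0" "v T = boundary_map c k f T x0 p" for x0 p v u
      using weak_form_iff_solves_ivp[OF res f reg Cr_subset_H1[OF T _ v(1)] v(2,3)] s by simp
  qed
qed

end
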